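(* Let $\Omega\subset\mathbb{R}^N$ be a bounded open set with boundary of class $C^2$, let $d(x)=d(x,\partial\Omega)$ be the distance from $x$ to $\partial\Omega$ and $D=\|d\|_{L^\infty(\Omega)}=\max_{x\in\overline\Omega}d(x,\partial\Omega)$. Let $\boldsymbol b\in\mathbb{R}^N$ be a constant vector, $z_0\in\mathbb{K}_1$, and let $f=f(t)$, $t>0$, be a function of time only with $f\in L^\infty(0,T)$ for every $T>0$. Suppose that: (i) for every $t>0$, $\boldsymbol b\cdot\nabla z_0\le f(t)$ a.e. in $\{x\in\Omega: -d(x)<z_0(x)\}$; (ii) $f$ is increasing (that is, $f(t)\le f(t+h)$ for all $t,h>0$) and nonnegative; (iii) $\displaystyle\liminf_{t\to\infty}f(t)>|\boldsymbol b|+2D$. Let $z$ be the global solution of the variational inequality with gradient constraint $|\nabla z|\le1$ with data $\boldsymbol b, f, z_0$, or equivalently of the two obstacles problem with the same data (both defined in the context). Then there exists $T_*<\infty$ such that $$z(t)=d\quad\text{for all } t\ge T_*.$$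
   Context: $\mathbb{K}_1=\{v\in H^1_0(\Omega):|\nabla v(x)|\le1\text{ for a.e. }x\in\Omega\}$ and $\mathbb{K}_\vee^\wedge=\{v\in H^1_0(\Omega): -d(x)\le v(x)\le d(x)\text{ for a.e. }x\in\Omega\}$. For $T>0$, $Q_T=\Omega\times(0,T)$. The gradient $\nabla$ is in the space variable only. $W^{1,\infty}_0(\Omega)$ denotes the functions of $W^{1,\infty}(\Omega)$ vanishing on $\partial\Omega$. Variational inequality with gradient constraint: $z$ is the function such that, for every $T>0$, $z\in L^\infty(0,T;W^{1,\infty}_0(\Omega))\cap H^1(0,T;L^2(\Omega))\cap C(\overline{Q}_T)$, $z(0)=z_0$, $z(t)\in\mathbb{K}_1$ for a.e. $t$, and for a.e. $t$ and all $v\in\mathbb{K}_1$, $$\int_\Omega\partial_tz(t)(v-z(t))+\int_\Omega\boldsymbol b\cdot\nabla z(t)(v-z(t))\ge\int_\Omega f(t)(v-z(t)).$$ Two obstacles problem: the same with $\mathbb{K}_1$ replaced by $\mathbb{K}_\vee^\wedge$ in both places. Under the assumptions that $\partial\Omega$ is $C^2$, $\boldsymbol b$ is constant, $f\in L^\infty(0,T)$ for every $T$ and $z_0\in\mathbb{K}_1$, each problem has a unique solution and the two solutions coincide. *)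

theory Defs
  imports "HOL-Analysis.Analysis"
begin

text \<open>
  Elements of function spaces over \<open>\<Omega>\<close> are represented by functions on the whole type;
  only their values on \<open>\<Omega>\<close> (up to null sets, where the space consists of classes) matter.
\<close>

section \<open>Smooth functions and regularity of the boundary\<close>

primrec C_k :: "nat \<Rightarrow> ('a::euclidean_space \<Rightarrow> real) \<Rightarrow> bool" where
  "C_k 0 f \<longleftrightarrow> continuous_on UNIV f"
| "C_k (Suc k) f \<longleftrightarrow> (\<forall>x. f differentiable (at x)) \<and>
     (\<forall>i\<in>Basis. C_k k (\<lambda>x. frechet_derivative f (at x) i))"

definition test_functions :: "'a::euclidean_space set \<Rightarrow> ('a \<Rightarrow> real) set" where
  "test_functions \<Omega> =
     {\<phi>. (\<forall>k. C_k k \<phi>) \<and> (\<exists>K. compact K \<and> K \<subseteq> \<Omega> \<and> (\<forall>x. x \<notin> K \<longrightarrow> \<phi> x = 0))}"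

definition grad :: "('a::euclidean_space \<Rightarrow> real) \<Rightarrow> 'a \<Rightarrow> 'a" where
  "grad f x = (\<Sum>i\<in>Basis. frechet_derivative f (at x) i *\<^sub>R i)"

text \<open>
  Near each boundary point, \<open>\<Omega>\<close> is the region above the graph of a \<open>C\<^sup>2\<close> function in some rotated
  coordinate system whose last axis is \<open>e\<close>. Invariance of \<open>\<gamma>\<close> along \<open>e\<close> makes \<open>\<gamma>\<close> a function of the
  coordinates orthogonal to \<open>e\<close>.
\<close>

definition C2_boundary :: "'a::euclidean_space set \<Rightarrow> bool" where
  "C2_boundary \<Omega> \<longleftrightarrow>
     (\<forall>p\<in>frontier \<Omega>. \<exists>r>0. \<exists>e \<gamma>. norm e = 1 \<and> C_k 2 \<gamma> \<and>
        (\<forall>x s. \<gamma> (x + s *\<^sub>R e) = \<gamma> x) \<and>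
        \<Omega> \<inter> ball p r = {x \<in> ball p r. \<gamma> x < x \<bullet> e})"

section \<open>Sobolev spaces\<close>

definition L2 :: "'a::euclidean_space set \<Rightarrow> ('a \<Rightarrow> 'b::euclidean_space) set" where
  "L2 \<Omega> = {u. u \<in> borel_measurable (lebesgue_on \<Omega>) \<and>
               integrable (lebesgue_on \<Omega>) (\<lambda>x. (norm (u x))\<^sup>2)}"

definition Linf :: "'a::euclidean_space set \<Rightarrow> ('a \<Rightarrow> 'b::euclidean_space) set" where
  "Linf \<Omega> = {u. u \<in> borel_measurable (lebesgue_on \<Omega>) \<and>
                 (\<exists>C. AE x in lebesgue_on \<Omega>. norm (u x) \<le> C)}"

definition locally_integrable :: "'a::euclidean_space set \<Rightarrow> ('a \<Rightarrow> 'b::euclidean_space) \<Rightarrow> bool" where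
  "locally_integrable \<Omega> u \<longleftrightarrow> (\<forall>K. compact K \<and> K \<subseteq> \<Omega> \<longrightarrow> integrable (lebesgue_on K) u)"

definition has_weak_gradient ::
    "'a::euclidean_space set \<Rightarrow> ('a \<Rightarrow> real) \<Rightarrow> ('a \<Rightarrow> 'a) \<Rightarrow> bool" where
  "has_weak_gradient \<Omega> u G \<longleftrightarrow>
     locally_integrable \<Omega> u \<and> locally_integrable \<Omega> G \<and>
     (\<forall>\<phi>\<in>test_functions \<Omega>. \<forall>i\<in>Basis.
        (LINT x|lebesgue_on \<Omega>. u x * frechet_derivative \<phi> (at x) i)
          = - (LINT x|lebesgue_on \<Omega>. (G x \<bullet> i) * \<phi> x))"

text \<open>The weak gradient is unique up to null sets; this picks a representative when there is one.\<close>

definition wgrad :: "'a::euclidean_space set \<Rightarrow> ('a \<Rightarrow> real) \<Rightarrow> 'a \<Rightarrow> 'a" where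
  "wgrad \<Omega> u = (SOME G. has_weak_gradient \<Omega> u G)"

definition H1 :: "'a::euclidean_space set \<Rightarrow> ('a \<Rightarrow> real) set" where
  "H1 \<Omega> = {u \<in> L2 \<Omega>. \<exists>G\<in>L2 \<Omega>. has_weak_gradient \<Omega> u G}"

text \<open>The closure of the test functions in the norm of \<open>H\<^sup>1(\<Omega>)\<close>.\<close>

definition H10 :: "'a::euclidean_space set \<Rightarrow> ('a \<Rightarrow> real) set" where
  "H10 \<Omega> = {u \<in> H1 \<Omega>. \<exists>\<phi>::nat \<Rightarrow> 'a \<Rightarrow> real. (\<forall>n. \<phi> n \<in> test_functions \<Omega>) \<and>
     (\<lambda>n. LINT x|lebesgue_on \<Omega>. (\<phi> n x - u x)\<^sup>2) \<longlonglongrightarrow> 0 \<and>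
     (\<lambda>n. LINT x|lebesgue_on \<Omega>. (norm (grad (\<phi> n) x - wgrad \<Omega> u x))\<^sup>2) \<longlonglongrightarrow> 0}"

definition W1inf :: "'a::euclidean_space set \<Rightarrow> ('a \<Rightarrow> real) set" where
  "W1inf \<Omega> = {u \<in> Linf \<Omega>. \<exists>G\<in>Linf \<Omega>. has_weak_gradient \<Omega> u G}"

text \<open>Vanishing on the boundary refers to the representative that is continuous up to the boundary.\<close>

definition W1inf0 :: "'a::euclidean_space set \<Rightarrow> ('a \<Rightarrow> real) set" where
  "W1inf0 \<Omega> = {u \<in> W1inf \<Omega>. \<exists>u'. continuous_on (closure \<Omega>) u' \<and>
     (AE x in lebesgue_on \<Omega>. u x = u' x) \<and> (\<forall>x\<in>frontier \<Omega>. u' x = 0)}"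

section \<open>Functions of time with values in function spaces\<close>

definition cylinder :: "'a::euclidean_space set \<Rightarrow> real \<Rightarrow> ('a \<times> real) set" where
  "cylinder \<Omega> T = \<Omega> \<times> {0<..<T}"

text \<open>
  \<open>L\<^sup>\<infinity>(0,T; W\<^sup>1\<^sup>,\<^sup>\<infinity>\<^sub>0(\<Omega>))\<close>. Since \<open>W\<^sup>1\<^sup>,\<^sup>\<infinity>(\<Omega>)\<close> is not separable, measurability in time is the weak-star one,
  that is, of \<open>z(t)\<close> and \<open>\<nabla>z(t)\<close> tested against integrable functions.
\<close>

definition Linf_W1inf0 :: "'a::euclidean_space set \<Rightarrow> real \<Rightarrow> (real \<Rightarrow> 'a \<Rightarrow> real) set" where
  "Linf_W1inf0 \<Omega> T = {z.
     (AE t in lebesgue_on {0<..<T}. z t \<in> W1inf0 \<Omega>) \<and>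
     (\<exists>C. AE t in lebesgue_on {0<..<T}. AE x in lebesgue_on \<Omega>.
        \<bar>z t x\<bar> \<le> C \<and> norm (wgrad \<Omega> (z t) x) \<le> C) \<and>
     (\<forall>g. integrable (lebesgue_on \<Omega>) g \<longrightarrow>
        (\<lambda>t. LINT x|lebesgue_on \<Omega>. z t x * g x) \<in> borel_measurable (lebesgue_on {0<..<T}) \<and>
        (\<forall>i\<in>Basis. (\<lambda>t. LINT x|lebesgue_on \<Omega>. (wgrad \<Omega> (z t) x \<bullet> i) * g x)
           \<in> borel_measurable (lebesgue_on {0<..<T})))}"

text \<open>
  \<open>L\<^sup>2(0,T; L\<^sup>2(\<Omega>))\<close> is identified with \<open>L\<^sup>2\<close> of the cylinder. The weak derivative in time is that of
  an \<open>L\<^sup>2(\<Omega>)\<close>-valued function: the two Bochner integrals over \<open>(0,T)\<close> agree as elements of \<open>L\<^sup>2(\<Omega>)\<close>.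
\<close>

definition has_weak_time_derivative ::
    "'a::euclidean_space set \<Rightarrow> real \<Rightarrow> (real \<Rightarrow> 'a \<Rightarrow> real) \<Rightarrow> (real \<Rightarrow> 'a \<Rightarrow> real) \<Rightarrow> bool" where
  "has_weak_time_derivative \<Omega> T z w \<longleftrightarrow>
     (\<lambda>(x, t). w t x) \<in> L2 (cylinder \<Omega> T) \<and>
     (\<forall>\<psi>\<in>test_functions {0<..<T}. AE x in lebesgue_on \<Omega>.
        (LINT t|lebesgue_on {0<..<T}. deriv \<psi> t * z t x)
          = - (LINT t|lebesgue_on {0<..<T}. \<psi> t * w t x))"

definition H1_L2 :: "'a::euclidean_space set \<Rightarrow> real \<Rightarrow> (real \<Rightarrow> 'a \<Rightarrow> real) set" where
  "H1_L2 \<Omega> T = {z. (\<lambda>(x, t). z t x) \<in> L2 (cylinder \<Omega> T) \<and>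
                     (\<exists>w. has_weak_time_derivative \<Omega> T z w)}"

definition wdt :: "'a::euclidean_space set \<Rightarrow> real \<Rightarrow> (real \<Rightarrow> 'a \<Rightarrow> real) \<Rightarrow> real \<Rightarrow> 'a \<Rightarrow> real" where
  "wdt \<Omega> T z = (SOME w. has_weak_time_derivative \<Omega> T z w)"

section \<open>The variational inequalities\<close>

definition bdist :: "'a::euclidean_space set \<Rightarrow> 'a \<Rightarrow> real" where
  "bdist \<Omega> x = infdist x (frontier \<Omega>)"

definition K_grad :: "'a::euclidean_space set \<Rightarrow> ('a \<Rightarrow> real) set" where
  "K_grad \<Omega> = {v \<in> H10 \<Omega>. AE x in lebesgue_on \<Omega>. norm (wgrad \<Omega> v x) \<le> 1}"

definition K_obst :: "'a::euclidean_space set \<Rightarrow> ('a \<Rightarrow> real) set" where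
  "K_obst \<Omega> = {v \<in> H10 \<Omega>. AE x in lebesgue_on \<Omega>. - bdist \<Omega> x \<le> v x \<and> v x \<le> bdist \<Omega> x}"

definition VI_solution ::
    "('a \<Rightarrow> real) set \<Rightarrow> 'a::euclidean_space set \<Rightarrow> 'a \<Rightarrow> (real \<Rightarrow> real) \<Rightarrow> ('a \<Rightarrow> real)
      \<Rightarrow> (real \<Rightarrow> 'a \<Rightarrow> real) \<Rightarrow> bool" where
  "VI_solution K \<Omega> b f z0 z \<longleftrightarrow>
     (AE x in lebesgue_on \<Omega>. z 0 x = z0 x) \<and>
     (\<forall>T>0.
        z \<in> Linf_W1inf0 \<Omega> T \<and> z \<in> H1_L2 \<Omega> T \<and>
        continuous_on (closure (cylinder \<Omega> T)) (\<lambda>(x, t). z t x) \<and>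
        (AE t in lebesgue_on {0<..<T}. z t \<in> K) \<and>
        (AE t in lebesgue_on {0<..<T}. \<forall>v\<in>K.
           (LINT x|lebesgue_on \<Omega>. wdt \<Omega> T z t x * (v x - z t x))
             + (LINT x|lebesgue_on \<Omega>. (b \<bullet> wgrad \<Omega> (z t) x) * (v x - z t x))
           \<ge> (LINT x|lebesgue_on \<Omega>. f t * (v x - z t x))))"

end

theory Submission
  imports Defs
begin

text \<open>
  Fix a time \<open>t\<^sub>0\<close> and \<open>\<epsilon> > 0\<close> with \<open>f \<ge> norm b + \<epsilon>\<close> after \<open>t\<^sub>0\<close>. For a test function \<open>p \<le> bdist \<Omega>\<close> with
  \<open>norm (\<nabla>p) \<le> 1\<close> and a level \<open>m \<ge> 0\<close>, the function \<open>z + h(p - z - m)\<close> is a competitor in both variational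
  inequalities when \<open>h\<close> is a smooth increasing function with slope in \<open>[0, 1]\<close> that vanishes on the
  negative half-line. The transport term only sees \<open>\<nabla>p\<close>, because \<open>h(p - z - m) (\<nabla>p - \<nabla>z)\<close> is a gradient of
  a function vanishing on the boundary, so \<open>\<integral> \<partial>\<^sub>tz h(p - z - m) \<ge> \<epsilon> \<integral> h(p - z - m)\<close>. Letting \<open>m\<close> decrease to
  \<open>0\<close> at speed \<open>\<epsilon>\<close>, starting from a bound \<open>M\<close> of \<open>bdist \<Omega> - z(t\<^sub>0)\<close>, makes \<open>\<integral> H(p - z(t) - m(t))\<close> with \<open>H' = h\<close>
  nonincreasing, hence zero, and gives \<open>z \<ge> p\<close> after the time \<open>t\<^sub>0 + M/\<epsilon>\<close>, which does not depend on \<open>p\<close>.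
  Since \<open>bdist \<Omega>\<close> is the supremum of the cones \<open>bdist \<Omega> y - norm (x - y)\<close>, it suffices to take smoothed cones
  for \<open>p\<close>. The bound \<open>z \<le> bdist \<Omega>\<close> is the constraint itself, or follows from the gradient constraint
  along the segment to a nearest boundary point.
\<close>

section \<open>Smooth functions\<close>

text \<open>The natural competitor would use the positive part of \<open>p - z - m\<close>. But
  \<open>H10\<close> is known only through approximating test functions and \<open>wgrad\<close> is
  a choice of representative, so a smooth \<open>ramp\<close> takes its place: on test functions the
  ordinary chain rule applies, and a Lipschitz slope lets the gradients pass to the L2 limit. A
  slope in [0, 1] serves both constraints: the gradient of the competitor is a convex combination of
  those of \<open>p\<close> and \<open>z\<close>, and its values lie between \<open>z\<close> and
  the maximum of \<open>z\<close> and \<open>p\<close>. The condition \<open>m \<ge> 0\<close> keeps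
  the correction zero outside the supports. The level falls at speed \<open>\<epsilon>\<close>
  because the gap \<open>p - z - m\<close> then has time derivative \<open>\<epsilon>\<close> minus
  that of \<open>z\<close>, whose integral against \<open>h\<close> is nonpositive. The obstacle is
  time regularity. The time derivative is only square integrable on the cylinder, so the energy is
  not differentiated. On short time intervals, convexity of \<open>H\<close> at the later time
  bounds its increment, and uniform continuity of \<open>z\<close> exchanges the later time for the
  running time, at the cost of \<open>\<eta>\<close> times the increment of a fixed weight. These
  errors add up over the steps and vanish as \<open>\<eta>\<close> tends to 0.\<close>

lemma C_k_SucI:
  assumes "\<And>x. (f has_derivative f' x) (at x)" "\<And>i. i \<in> Basis \<Longrightarrow> C_k k (\<lambda>x. f' x i)"
  shows "C_k (Suc k) f"
proof -
  have "frechet_derivative f (at x) = f' x" for x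
    using frechet_derivative_at[OF assms(1)] by simp
  with assms show ?thesis by (auto simp: differentiable_def)
qed

lemma C_k_Suc_has_derivative:
  "C_k (Suc k) f \<Longrightarrow> (f has_derivative frechet_derivative f (at x)) (at x)"
  by (simp add: frechet_derivative_works)

lemma C_k_SucD: "C_k (Suc k) f \<Longrightarrow> C_k k f"
proof (induction k arbitrary: f)
  case 0
  then show ?case
    by (auto intro!: continuous_at_imp_continuous_on differentiable_imp_continuous_within)
qed (simp only: C_k.simps, blast)

lemma C_k_antimono: "C_k k f \<Longrightarrow> j \<le> k \<Longrightarrow> C_k j f"
  by (induction k) (auto simp del: C_k.simps dest: C_k_SucD elim!: le_SucE)

lemma C_k_imp_continuous_on: "C_k k f \<Longrightarrow> continuous_on S f"
  using C_k_antimono[of k f 0] by (auto intro: continuous_on_subset)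

lemma C_k_const [simp]: "C_k k (\<lambda>x. c)"
proof (induction k arbitrary: c)
  case (Suc k)
  then show ?case by (intro C_k_SucI[where f' = "\<lambda>_ _. 0"]) auto
qed simp

lemma C_k_inner: "C_k k (\<lambda>x. (x - a) \<bullet> v)"
proof (cases k)
  case (Suc j)
  then show ?thesis
    by (auto intro!: C_k_SucI[where f' = "\<lambda>_ h. h \<bullet> v"] derivative_eq_intros simp del: C_k.simps)
qed (auto intro!: continuous_intros)

lemma C_k_add: "C_k k f \<Longrightarrow> C_k k g \<Longrightarrow> C_k k (\<lambda>x. f x + g x)"
proof (induction k arbitrary: f g)
  case (Suc k)
  show ?case
    by (rule C_k_SucI[OF has_derivative_add[OF Suc.prems[THEN C_k_Suc_has_derivative]]])
      (use Suc in \<open>simp add: Suc.IH\<close>)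
qed (auto intro!: continuous_intros)

lemma C_k_mult: "C_k k f \<Longrightarrow> C_k k g \<Longrightarrow> C_k k (\<lambda>x. f x * g x)"
proof (induction k arbitrary: f g)
  case (Suc k)
  show ?case
  proof (rule C_k_SucI[OF has_derivative_mult[OF Suc.prems[THEN C_k_Suc_has_derivative]]])
    fix i :: 'a assume "i \<in> Basis"
    then show "C_k k (\<lambda>x. f x * frechet_derivative g (at x) i + frechet_derivative f (at x) i * g x)"
      using Suc.prems by (intro C_k_add Suc.IH C_k_SucD[of k f] C_k_SucD[of k g]) auto
  qed
qed (auto intro!: continuous_intros)

lemma C_k_cmult: "C_k k f \<Longrightarrow> C_k k (\<lambda>x. c * f x)"
  by (intro C_k_mult) auto

lemma C_k_diff: "C_k k f \<Longrightarrow> C_k k g \<Longrightarrow> C_k k (\<lambda>x. f x - g x)"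
  using C_k_add[of k f "\<lambda>x. (-1) * g x"] C_k_cmult[of k g "-1"] by simp

lemma C_k_norm_square: "C_k k (\<lambda>x. (norm (x - a))\<^sup>2)"
proof (cases k)
  case (Suc j)
  show ?thesis unfolding Suc power2_norm_eq_inner
  proof (rule C_k_SucI[where f' = "\<lambda>x h. 2 * ((x - a) \<bullet> h)"])
    show "((\<lambda>x. (x - a) \<bullet> (x - a)) has_derivative (\<lambda>h. 2 * ((x - a) \<bullet> h))) (at x)" for x
      by (auto intro!: derivative_eq_intros simp: inner_commute)
  qed (intro C_k_cmult C_k_inner)
qed (auto intro!: continuous_intros)

lemma C_k_prod:
  "finite I \<Longrightarrow> (\<And>i. i \<in> I \<Longrightarrow> C_k k (g i)) \<Longrightarrow> C_k k (\<lambda>x. \<Prod>i\<in>I. g i x)"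
proof (induction I rule: finite_induct)
  case (insert i I)
  then have "C_k k (\<lambda>x. g i x * (\<Prod>i\<in>I. g i x))" by (intro C_k_mult insert.IH insert.prems) blast+
  then show ?case using insert.hyps by simp
qed simp

text \<open>Induction on the order, for all members of the family at once: a derivative is a finite
  combination of members, so it is covered by the induction hypothesis. The derivative rule is asked
  only at values of \<open>f\<close>, which admits real powers of positive functions.\<close>

lemma C_k_comp_family:
  fixes f :: "'a::euclidean_space \<Rightarrow> real" and g :: "'b \<Rightarrow> real \<Rightarrow> real"
  assumes deriv: "\<And>j x. (g j has_real_derivative (\<Sum>l\<in>S j. c j l * g l (f x))) (at (f x))"
    and fin: "\<And>j. finite (S j)" and f: "C_k k f"
  shows "C_k k (\<lambda>x. g j (f x))"
  using f
proof (induction k arbitrary: j)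
  case 0
  have "isCont (\<lambda>x. g j (f x)) x" for x
    using 0 DERIV_isCont[OF deriv[of j x]]
    by (rule_tac isCont_o2[of _ f]) (auto simp: continuous_on_eq_continuous_at)
  then show ?case by (simp add: continuous_on_eq_continuous_at)
next
  case (Suc k)
  have IH: "C_k k (\<lambda>x. g l (f x))" for l using Suc C_k_SucD by blast
  have sum: "C_k k (\<lambda>x. \<Sum>l\<in>A. c j l * g l (f x))" if "finite A" for A
    using that by (induction A rule: finite_induct) (auto intro!: C_k_add C_k_cmult IH)
  have "((\<lambda>x. g j (f x)) has_derivative
      (\<lambda>h. (\<Sum>l\<in>S j. c j l * g l (f x)) * frechet_derivative f (at x) h)) (at x)" for x
    using deriv[of j x] C_k_Suc_has_derivative[OF Suc.prems, of x]
    by (auto simp: has_field_derivative_def dest: diff_chain_at[unfolded o_def])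
  then show ?case
    by (rule C_k_SucI) (use Suc.prems in \<open>auto intro!: C_k_mult sum fin\<close>)
qed

lemma C_k_powr:
  assumes "C_k k f" "\<And>x. f x > 0"
  shows "C_k k (\<lambda>x. f x powr a)"
proof (rule C_k_comp_family[where g = "\<lambda>a s. s powr a" and S = "\<lambda>a. {a - 1}" and c = "\<lambda>a _. a"])
  show "((\<lambda>s. s powr a) has_real_derivative (\<Sum>l\<in>{a - 1}. a * f x powr l)) (at (f x))" for a x
    using assms(2)[of x] by (auto intro!: derivative_eq_intros simp: powr_diff)
qed (use assms in auto)

text \<open>This family is closed under differentiation, which makes all its members smooth.\<close>

definition eta :: "nat \<Rightarrow> real \<Rightarrow> real" where
  "eta n s = (if s > 0 then exp (- (1/s)) / s ^ n else 0)"

lemma eta_nonneg: "eta n s \<ge> 0"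
  by (simp add: eta_def)

lemma eta_pos: "s > 0 \<Longrightarrow> eta n s > 0"
  by (simp add: eta_def)

lemma eta_nonpos_arg: "s \<le> 0 \<Longrightarrow> eta n s = 0"
  by (simp add: eta_def)

lemma power_le_fact_exp:
  fixes y :: real assumes "y \<ge> 0" shows "y ^ n \<le> fact n * exp y"
proof -
  have "(\<Sum>k\<in>{n}. y ^ k /\<^sub>R fact k) \<le> (\<Sum>k. y ^ k /\<^sub>R fact k)"
    using assms summable_exp_generic[of y] by (intro sum_le_suminf) auto
  then show ?thesis by (simp add: exp_def divide_simps mult.commute)
qed

text \<open>With \<open>y = 1/s\<close> this is one term of the exponential series against the
  whole. The explicit constant reappears in the Lipschitz constant of \<open>ramp'\<close>.\<close>

lemma eta_le: "eta n s \<le> fact n"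
proof (cases "s > 0")
  case True
  then show ?thesis using power_le_fact_exp[of "1/s" n]
    by (simp add: eta_def exp_minus field_simps)
qed (simp add: eta_def)

lemma mult_eta: "s * eta (Suc n) s = eta n s"
  by (simp add: eta_def)

lemma eta_has_derivative:
  "(eta n has_real_derivative (eta (n+2) s - real n * eta (n+1) s)) (at s)"
proof -
  consider "s > 0" | "s < 0" | "s = 0" by linarith
  then show ?thesis
  proof cases
    case 1
    have pw: "m = 0 \<or> s ^ m = s * s ^ (m - Suc 0)" for m by (cases m) auto
    have "((\<lambda>s. exp (- (1/s)) / s ^ n) has_real_derivative (eta (n+2) s - real n * eta (n+1) s)) (at s)"
      using 1
      by (cases n) (auto intro!: derivative_eq_intros simp: eta_def field_simps power2_eq_square,
          use pw in blast)
    then show ?thesis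
      by (rule has_field_derivative_transform_within_open[where S = "{0<..}"]) (use 1 in \<open>auto simp: eta_def\<close>)
  next
    case 2
    have "((\<lambda>s. 0) has_real_derivative (eta (n+2) s - real n * eta (n+1) s)) (at s)"
      using 2 by (auto simp: eta_def)
    then show ?thesis
      by (rule has_field_derivative_transform_within_open[where S = "{..<0}"]) (use 2 in \<open>auto simp: eta_def\<close>)
  next
    case 3
    \<comment> \<open>At the origin the difference quotient equals \<open>h * eta (n + 2) h\<close>,
      and the second factor is bounded.\<close>
    have "(\<lambda>h. (eta n (0 + h) - eta n 0) / h) \<midarrow>0\<rightarrow> 0"
    proof (rule Lim_null_comparison)
      have "norm ((eta n (0 + h) - eta n 0) / h) \<le> fact (n+2) * \<bar>h\<bar>" if "h \<noteq> 0" for h :: real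
      proof -
        have "(eta n (0 + h) - eta n 0) / h = h * eta (n + 2) h"
          using that mult_eta[of h n] mult_eta[of h "n+1"] by (auto simp: eta_nonpos_arg field_simps)
        then show ?thesis using eta_le[of "n+2" h] eta_nonneg[of "n+2" h]
          by (simp only: real_norm_def abs_mult) (metis abs_ge_zero abs_of_nonneg mult.commute mult_left_mono)
      qed
      then show "\<forall>\<^sub>F h in at 0. norm ((eta n (0 + h) - eta n 0) / h) \<le> fact (n+2) * \<bar>h\<bar>"
        by (auto simp: eventually_at_filter)
      show "(\<lambda>h::real. fact (n+2) * \<bar>h\<bar>) \<midarrow>0\<rightarrow> 0"
        by (auto intro!: tendsto_eq_intros)
    qed
    then show ?thesis using 3 by (simp add: DERIV_def eta_nonpos_arg)
  qed
qed

lemma C_k_eta: "C_k k f \<Longrightarrow> C_k k (\<lambda>x. eta n (f x))"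
proof (rule C_k_comp_family[where g = eta and S = "\<lambda>n. {n+1, n+2}"
      and c = "\<lambda>n l. if l = n + 2 then 1 else - real n"])
  show "(eta n has_real_derivative
      (\<Sum>l\<in>{n+1, n+2}. (if l = n + 2 then 1 else - real n) * eta l (f x))) (at (f x))" for n x
    using eta_has_derivative[of n "f x"] by simp
qed auto

text \<open>
  A smooth substitute for the positive part, with antiderivative \<open>ramp_int\<close>, whose slope stays in \<open>[0, 1]\<close>
  because \<open>1 + y + y\<^sup>2/2 \<le> exp y\<close> for \<open>y = 1/s\<close>.
\<close>

definition ramp :: "real \<Rightarrow> real" where "ramp s = (s + 1/2) * eta 0 s"
definition ramp' :: "real \<Rightarrow> real" where "ramp' s = eta 0 s + eta 1 s + eta 2 s / 2"
definition ramp_int :: "real \<Rightarrow> real" where "ramp_int s = s\<^sup>2 * eta 0 s / 2"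

lemma ramp_has_derivative: "(ramp has_real_derivative ramp' s) (at s)"
proof -
  have "s * eta (Suc (Suc 0)) s = eta (Suc 0) s" by (rule mult_eta)
  then show ?thesis unfolding ramp_def[abs_def] ramp'_def
    by (auto intro!: derivative_eq_intros eta_has_derivative simp: algebra_simps numeral_2_eq_2)
qed

text \<open>This is the origin of the factor \<open>s + 1/2\<close> in \<open>ramp\<close>: the
  derivative of \<open>s\<^sup>2 * eta 0 s / 2\<close> is
  \<open>s * eta 0 s + s\<^sup>2 * eta 2 s / 2\<close>, and the last product collapses to
  \<open>eta 0 s / 2\<close>.\<close>

lemma ramp_int_has_derivative: "(ramp_int has_real_derivative ramp s) (at s)"
proof -
  have *: "s * eta (Suc (Suc 0)) s = eta (Suc 0) s" "s * eta (Suc 0) s = eta 0 s" by (rule mult_eta)+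
  have "s\<^sup>2 * eta (Suc (Suc 0)) s = eta 0 s"
    using * by (simp add: power2_eq_square mult.assoc)
  then show ?thesis unfolding ramp_def ramp_int_def[abs_def]
    by (auto intro!: derivative_eq_intros eta_has_derivative simp: algebra_simps numeral_2_eq_2)
qed

text \<open>The contributions of \<open>eta 2\<close> and \<open>eta 3\<close> cancel, which leaves
  a single bounded term.\<close>

lemma ramp'_has_derivative: "(ramp' has_real_derivative eta 4 s / 2) (at s)"
proof -
  have [simp]: "eta (Suc 3) s = eta 4 s" by (simp add: eval_nat_numeral)
  show ?thesis unfolding ramp'_def[abs_def]
    by (auto intro!: derivative_eq_intros eta_has_derivative simp: eval_nat_numeral field_simps)
qed

lemma ramp'_nonneg: "0 \<le> ramp' s"
  using eta_nonneg by (simp add: ramp'_def)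

lemma ramp'_le_1: "ramp' s \<le> 1"
proof (cases "s > 0")
  case True
  have "1 + 1/s + (1/s)\<^sup>2 / 2 \<le> exp (1/s)" using True by (intro exp_lower_Taylor_quadratic) auto
  then have "exp (- (1/s)) * (1 + 1/s + (1/s)\<^sup>2 / 2) \<le> exp (- (1/s)) * exp (1/s)" by simp
  also have "\<dots> = 1" by (simp flip: exp_add)
  finally show ?thesis using True by (simp add: ramp'_def eta_def field_simps)
qed (simp add: ramp'_def eta_def)

text \<open>The constant is 4!/2, from the bound \<open>fact 4\<close> on \<open>eta 4\<close>. This
  Lipschitz property makes the slope factor converge in L2 when competitors are
  approximated.\<close>

lemma ramp'_lipschitz: "\<bar>ramp' a - ramp' b\<bar> \<le> 12 * \<bar>a - b\<bar>"
proof -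
  have "norm (ramp' a - ramp' b) \<le> 12 * norm (a - b)"
    by (rule field_differentiable_bound[where S = UNIV and f' = "\<lambda>s. eta 4 s / 2"])
      (use ramp'_has_derivative eta_nonneg[of 4] eta_le[of 4] in \<open>auto simp: fact_numeral\<close>)
  then show ?thesis by simp
qed

lemma ramp_lipschitz: "\<bar>ramp a - ramp b\<bar> \<le> \<bar>a - b\<bar>"
proof -
  have "norm (ramp a - ramp b) \<le> 1 * norm (a - b)"
    by (rule field_differentiable_bound[where S = UNIV and f' = ramp'])
      (use ramp_has_derivative ramp'_nonneg ramp'_le_1 in auto)
  then show ?thesis by simp
qed

lemma ramp_nonneg: "ramp s \<ge> 0"
  by (cases "s > 0") (auto simp: ramp_def eta_def)

lemma ramp_nonpos_arg: "s \<le> 0 \<Longrightarrow> ramp s = 0"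
  by (simp add: ramp_def eta_nonpos_arg)

lemma ramp_le: "ramp s \<le> max 0 s"
  using ramp_lipschitz[of s 0] ramp_nonpos_arg[of 0] ramp_nonpos_arg[of s] by (cases "s \<ge> 0") auto

lemma ramp_int_nonneg: "ramp_int s \<ge> 0"
  by (simp add: ramp_int_def eta_nonneg)

lemma ramp_int_nonpos_arg: "s \<le> 0 \<Longrightarrow> ramp_int s = 0"
  by (simp add: ramp_int_def eta_nonpos_arg)

lemma ramp_int_eq_0D: "ramp_int s = 0 \<Longrightarrow> s \<le> 0"
  using eta_pos[of s 0] by (auto simp: ramp_int_def) (metis less_irrefl not_le_imp_less)

lemma ramp_mono: "a \<le> b \<Longrightarrow> ramp a \<le> ramp b"
  using ramp_has_derivative ramp'_nonneg by (blast intro: DERIV_nonneg_imp_nondecreasing)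

text \<open>Tangent inequality for a convex function, since \<open>ramp\<close> is nondecreasing.
  The slope is taken at \<open>a\<close>, which will be the later of two times.\<close>

lemma ramp_int_diff_le: "ramp_int a - ramp_int b \<le> ramp a * (a - b)"
proof (cases a b rule: linorder_cases)
  case less
  then obtain c where "a < c" "c < b" "ramp_int b - ramp_int a = (b - a) * ramp c"
    using MVT2[OF less ramp_int_has_derivative] by auto
  then show ?thesis using mult_left_mono[OF ramp_mono[of a c], of "b - a"] by (simp add: algebra_simps)
next
  case greater
  then obtain c where "b < c" "c < a" "ramp_int a - ramp_int b = (a - b) * ramp c"
    using MVT2[OF greater ramp_int_has_derivative] by auto
  then show ?thesis using mult_left_mono[OF ramp_mono[of c a], of "a - b"] by (simp add: algebra_simps)
qed simp

lemma continuous_on_ramp [continuous_intros]: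
  "continuous_on S f \<Longrightarrow> continuous_on S (\<lambda>x. ramp (f x))"
  by (rule continuous_on_compose2[of UNIV ramp S f])
    (auto intro!: DERIV_continuous_on ramp_has_derivative)

lemma continuous_on_ramp' [continuous_intros]:
  "continuous_on S f \<Longrightarrow> continuous_on S (\<lambda>x. ramp' (f x))"
  by (rule continuous_on_compose2[of UNIV ramp' S f])
    (auto intro!: DERIV_continuous_on ramp'_has_derivative)

lemma continuous_on_ramp_int [continuous_intros]:
  "continuous_on S f \<Longrightarrow> continuous_on S (\<lambda>x. ramp_int (f x))"
  by (rule continuous_on_compose2[of UNIV ramp_int S f])
    (auto intro!: DERIV_continuous_on ramp_int_has_derivative)

lemma C_k_ramp: "C_k k f \<Longrightarrow> C_k k (\<lambda>x. ramp (f x))"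
  unfolding ramp_def by (intro C_k_mult C_k_add C_k_eta C_k_const)

lemma C_k_ramp_int: "C_k k f \<Longrightarrow> C_k k (\<lambda>x. ramp_int (f x))"
  unfolding ramp_int_def power2_eq_square divide_inverse by (intro C_k_mult C_k_eta C_k_const)

section \<open>Test functions\<close>

lemma test_functionsI:
  "(\<And>k. C_k k \<phi>) \<Longrightarrow> compact K \<Longrightarrow> K \<subseteq> S \<Longrightarrow> (\<And>x. x \<notin> K \<Longrightarrow> \<phi> x = 0) \<Longrightarrow> \<phi> \<in> test_functions S"
  by (auto simp: test_functions_def)

lemma test_functionsE:
  assumes "\<phi> \<in> test_functions S"
  obtains K where "compact K" "K \<subseteq> S" "\<And>x. x \<notin> K \<Longrightarrow> \<phi> x = 0"
  using assms by (auto simp: test_functions_def)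

lemma test_functions_C_k: "\<phi> \<in> test_functions S \<Longrightarrow> C_k k \<phi>"
  by (auto simp: test_functions_def)

lemma test_functions_has_derivative:
  "\<phi> \<in> test_functions S \<Longrightarrow> (\<phi> has_derivative frechet_derivative \<phi> (at x)) (at x)"
  using C_k_Suc_has_derivative[of 0] test_functions_C_k by blast

lemma has_derivative_imp_grad:
  fixes f :: "'a::euclidean_space \<Rightarrow> real"
  assumes "(f has_derivative f') (at x)"
  shows "grad f x \<bullet> v = f' v"
proof -
  have f': "frechet_derivative f (at x) = f'" using frechet_derivative_at[OF assms] by simp
  interpret f': bounded_linear f' using assms by (rule has_derivative_bounded_linear)
  have "f' v = f' (\<Sum>i\<in>Basis. (v \<bullet> i) *\<^sub>R i)" by (simp add: euclidean_representation)
  also have "\<dots> = (\<Sum>i\<in>Basis. (v \<bullet> i) * f' i)" by (simp add: f'.sum f'.scaleR)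
  also have "\<dots> = grad f x \<bullet> v" by (simp add: grad_def f' inner_sum_left inner_commute[of v] mult.commute)
  finally show ?thesis by simp
qed

lemma grad_eqI:
  assumes "(f has_derivative (\<lambda>v. g \<bullet> v)) (at x)"
  shows "grad f x = g"
  using has_derivative_imp_grad[OF assms] by (metis inner_commute vector_eq_ldot)

lemma has_derivative_grad:
  assumes "C_k (Suc k) f"
  shows "(f has_derivative (\<lambda>v. grad f x \<bullet> v)) (at x)"
  using C_k_Suc_has_derivative[OF assms, of x] has_derivative_imp_grad[OF C_k_Suc_has_derivative[OF assms]]
  by simp

lemma continuous_on_grad: "C_k (Suc k) f \<Longrightarrow> continuous_on S (grad f)"
  unfolding grad_def[abs_def]
  by (intro continuous_on_sum continuous_on_scaleR continuous_on_const)
    (auto intro: C_k_imp_continuous_on)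

text \<open>A smooth version of the cone \<open>x \<mapsto> r - norm (x - p)\<close>, recovered as \<open>\<kappa> \<rightarrow> 0\<close>.\<close>

definition smooth_cone :: "real \<Rightarrow> 'a::euclidean_space \<Rightarrow> real \<Rightarrow> 'a \<Rightarrow> real" where
  "smooth_cone \<kappa> p r x = \<kappa> * ramp ((r - sqrt (\<kappa>\<^sup>2 + (norm (x - p))\<^sup>2)) / \<kappa>)"

lemma smooth_cone_le:
  assumes "\<kappa> > 0"
  shows "smooth_cone \<kappa> p r x \<le> max 0 (r - norm (x - p))"
proof -
  have "norm (x - p) \<le> sqrt (\<kappa>\<^sup>2 + (norm (x - p))\<^sup>2)" by (rule real_le_rsqrt) simp
  moreover have "smooth_cone \<kappa> p r x \<le> \<kappa> * max 0 ((r - sqrt (\<kappa>\<^sup>2 + (norm (x - p))\<^sup>2)) / \<kappa>)"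
    unfolding smooth_cone_def using assms ramp_le by (intro mult_left_mono) auto
  moreover have "\<dots> = max 0 (r - sqrt (\<kappa>\<^sup>2 + (norm (x - p))\<^sup>2))"
    using assms by (auto simp: max_def field_simps)
  ultimately show ?thesis by linarith
qed

lemma C_k_smooth_cone:
  assumes "\<kappa> > 0"
  shows "C_k k (smooth_cone \<kappa> p r)"
proof -
  have "C_k k (\<lambda>x. \<kappa> * ramp ((1/\<kappa>) * (r - (\<kappa>\<^sup>2 + (norm (x - p))\<^sup>2) powr (1/2))))"
    using assms by (intro C_k_cmult C_k_ramp C_k_diff C_k_powr C_k_add C_k_const C_k_norm_square)
      (simp add: add_pos_nonneg)
  then show ?thesis unfolding smooth_cone_def[abs_def] by (simp add: powr_half_sqrt)
qed

lemma smooth_cone_in_test_functions: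
  assumes "\<kappa> > 0" "\<And>x. norm (x - p) < r \<Longrightarrow> x \<in> S"
  shows "smooth_cone \<kappa> p r \<in> test_functions S"
proof (rule test_functionsI)
  let ?K = "{x. sqrt (\<kappa>\<^sup>2 + (norm (x - p))\<^sup>2) \<le> r}"
  \<comment> \<open>Strictness, due to \<open>\<kappa> > 0\<close>, puts the compact set
    \<open>?K\<close> inside the open ball of radius \<open>r\<close>.\<close>
  have lt: "norm (x - p) < sqrt (\<kappa>\<^sup>2 + (norm (x - p))\<^sup>2)" for x
    using assms(1) by (intro real_less_rsqrt) simp
  show "compact ?K"
  proof (rule compact_eq_bounded_closed[THEN iffD2], intro conjI)
    show "bounded ?K"
    proof (rule bounded_subset)
      show "?K \<subseteq> cball p r" using order_trans[OF less_imp_le[OF lt]] by (auto simp: dist_norm norm_minus_commute)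
    qed simp
    show "closed ?K" by (intro closed_Collect_le continuous_intros)
  qed
  show "?K \<subseteq> S" using lt assms(2) by (force intro: less_le_trans)
  show "smooth_cone \<kappa> p r x = 0" if "x \<notin> ?K" for x
    using that assms(1) by (auto simp: smooth_cone_def intro!: ramp_nonpos_arg divide_nonpos_pos)
qed (use assms C_k_smooth_cone in blast)

lemma norm_grad_smooth_cone_le:
  assumes "\<kappa> > 0"
  shows "norm (grad (smooth_cone \<kappa> p r) x) \<le> 1"
proof -
  let ?s = "sqrt (\<kappa>\<^sup>2 + (norm (x - p))\<^sup>2)"
  have pos: "\<kappa>\<^sup>2 + (norm (x - p))\<^sup>2 > 0" using assms by (simp add: add_pos_nonneg)
  have 0: "((\<lambda>x. \<kappa>\<^sup>2 + (norm (x - p))\<^sup>2) has_derivative (\<lambda>v. 2 * ((x - p) \<bullet> v))) (at x)"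
    unfolding power2_norm_eq_inner by (auto intro!: derivative_eq_intros simp: inner_commute)
  have "((\<lambda>x. sqrt (\<kappa>\<^sup>2 + (norm (x - p))\<^sup>2)) has_derivative (\<lambda>v. ((x - p) \<bullet> v) / ?s)) (at x)"
    by (rule has_derivative_eq_rhs, rule has_derivative_real_sqrt, rule pos, rule 0, rule ext)
      (simp only: divide_inverse mult.assoc, simp)
  from has_derivative_mult_right[OF has_derivative_diff[OF has_derivative_const[of r] this], of "1/\<kappa>"]
  have 1: "((\<lambda>x. (r - sqrt (\<kappa>\<^sup>2 + (norm (x - p))\<^sup>2)) / \<kappa>) has_derivative (\<lambda>v. - ((x - p) \<bullet> v) / (\<kappa> * ?s))) (at x)"
    by simp
  have "(ramp has_derivative (\<lambda>t. ramp' ((r - ?s) / \<kappa>) * t)) (at ((r - ?s) / \<kappa>))"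
    using ramp_has_derivative has_field_derivative_def by blast
  from has_derivative_mult_right[OF diff_chain_at[OF 1 this], of \<kappa>]
  have "(smooth_cone \<kappa> p r has_derivative
      (\<lambda>v. \<kappa> * (ramp' ((r - ?s) / \<kappa>) * (- ((x - p) \<bullet> v) / (\<kappa> * ?s))))) (at x)"
    unfolding smooth_cone_def[abs_def] o_def .
  from has_derivative_imp_grad[OF this]
  have g: "grad (smooth_cone \<kappa> p r) x \<bullet> v = - ramp' ((r - ?s) / \<kappa>) * (((x - p) \<bullet> v) / ?s)" for v
    using assms by (simp add: field_simps)
  have s: "norm (x - p) \<le> ?s" "?s > 0" using pos by (auto intro: real_le_rsqrt)
  let ?g = "grad (smooth_cone \<kappa> p r) x"
  let ?q = "((x - p) \<bullet> ?g) / ?s"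
  have "\<bar>(x - p) \<bullet> ?g\<bar> \<le> norm (x - p) * norm ?g" by (rule Cauchy_Schwarz_ineq2)
  also have "\<dots> \<le> ?s * norm ?g" using s(1) by (rule mult_right_mono) simp
  finally have q: "\<bar>?q\<bar> \<le> norm ?g" using s(2) by (simp only: abs_divide abs_of_pos pos_divide_le_eq mult.commute)
  have *: "- u * v \<le> \<bar>u\<bar> * \<bar>v\<bar>" for u v :: real
    using abs_ge_self[of "- u * v"] by (simp add: abs_mult)
  \<comment> \<open>Pairing the gradient with itself turns the formula for directional derivatives
    into a bound of the squared norm by the norm.\<close>
  have "(norm ?g)\<^sup>2 = - ramp' ((r - ?s) / \<kappa>) * ?q" by (rule trans[OF power2_norm_eq_inner g])
  also have "\<dots> \<le> \<bar>ramp' ((r - ?s) / \<kappa>)\<bar> * \<bar>?q\<bar>" by (rule *)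
  also have "\<dots> \<le> 1 * norm ?g"
    using q ramp'_nonneg ramp'_le_1 by (intro mult_mono) (simp_all only: abs_of_nonneg abs_ge_zero zero_le_one)
  finally have "norm ?g * norm ?g \<le> 1 * norm ?g" by (simp only: power2_eq_square)
  moreover have "u \<le> 1" if "u * u \<le> 1 * u" "u \<ge> 0" for u :: real
    using that by (cases "u = 0") (simp_all add: mult_le_cancel_right)
  ultimately show ?thesis using norm_ge_zero by blast
qed

text \<open>At the apex the square root is just \<open>\<kappa>\<close>, so the value has an
  explicit formula with an evident limit.\<close>

lemma smooth_cone_tendsto:
  assumes "r > 0"
  shows "((\<lambda>\<kappa>. smooth_cone \<kappa> p r p) \<longlongrightarrow> r) (at_right 0)"
proof -
  have "((\<lambda>\<kappa>. ((r - \<kappa>) + \<kappa>/2) * exp (- (\<kappa> / (r - \<kappa>)))) \<longlongrightarrow> r) (at_right 0)"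
    using assms by (auto intro!: tendsto_eq_intros)
  moreover have "\<forall>\<^sub>F \<kappa> in at_right 0. ((r - \<kappa>) + \<kappa>/2) * exp (- (\<kappa> / (r - \<kappa>))) = smooth_cone \<kappa> p r p"
    using assms by (auto simp: eventually_at_right[of 0 r] smooth_cone_def ramp_def eta_def field_simps intro!: exI[of _ r])
  ultimately show ?thesis by (rule Lim_transform_eventually)
qed

section \<open>Integration of compactly supported functions\<close>

text \<open>The function spaces use the completed measure on the domain, whereas translation
  invariance and Fubini are applied to \<open>lborel\<close>. This is the bridge between
  them.\<close>

lemma LINT_lebesgue_on_eq_lborel:
  fixes f :: "'a::euclidean_space \<Rightarrow> 'b::euclidean_space"
  assumes "S \<in> sets lebesgue" "f \<in> borel_measurable borel" "\<And>x. x \<notin> S \<Longrightarrow> f x = 0"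
  shows "(LINT x|lebesgue_on S. f x) = (LINT x|lborel. f x)"
proof -
  have "(LINT x|lebesgue_on S. f x) = (LINT x|lebesgue. indicator S x *\<^sub>R f x)"
    using assms by (intro integral_restrict_space) auto
  also have "(\<lambda>x. indicator S x *\<^sub>R f x) = f"
    using assms(3) by (auto simp: indicator_def)
  also have "(LINT x|lebesgue. f x) = (LINT x|lborel. f x)"
    using assms(2) by (intro integral_completion) auto
  finally show ?thesis .
qed

lemma integrable_compact_support:
  fixes f :: "'a::euclidean_space \<Rightarrow> 'b::euclidean_space"
  assumes "continuous_on UNIV f" "compact K" "\<And>x. x \<notin> K \<Longrightarrow> f x = 0"
  shows "integrable lborel f"
proof -
  have "integrable lborel (\<lambda>x. indicator K x *\<^sub>R f x)"
    using assms by (intro borel_integrable_compact) (auto intro: continuous_on_subset)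
  also have "(\<lambda>x. indicator K x *\<^sub>R f x) = f"
    using assms(3) by (auto simp: indicator_def)
  finally show ?thesis .
qed

lemma LINT_lborel_translation:
  fixes f :: "'a::euclidean_space \<Rightarrow> real"
  assumes "f \<in> borel_measurable borel"
  shows "(LINT x|lborel. f (x + c)) = (LINT x|lborel. f x)"
proof -
  have "(LINT x|lborel. f x) = (LINT x|distr lborel borel ((+) c). f x)"
    by (simp add: lborel_distr_plus)
  also have "\<dots> = (LINT x|lborel. f (c + x))"
    using assms by (intro integral_distr) auto
  finally show ?thesis by (simp add: add.commute)
qed

lemma bounded_compact_support:
  fixes f :: "'a::euclidean_space \<Rightarrow> 'b::euclidean_space"
  assumes "continuous_on UNIV f" "compact K" "\<And>x. x \<notin> K \<Longrightarrow> f x = 0"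
  obtains B where "B > 0" "\<And>x. norm (f x) \<le> B"
proof -
  have "bounded (f ` K)"
    using assms by (intro compact_imp_bounded compact_continuous_image) (auto intro: continuous_on_subset)
  then obtain B where B: "B > 0" "\<forall>x\<in>K. norm (f x) \<le> B" by (auto simp: bounded_pos)
  have "norm (f x) \<le> B" for x using B assms(3)[of x] by (cases "x \<in> K") auto
  with B(1) that show ?thesis by blast
qed

lemma derivative_eq_0_outside_closed:
  fixes f :: "'a::euclidean_space \<Rightarrow> real"
  assumes "(f has_derivative f') (at x)" "closed K" "\<And>x. x \<notin> K \<Longrightarrow> f x = 0" "x \<notin> K"
  shows "f' = (\<lambda>_. 0)"
proof -
  have "((\<lambda>_. 0) has_derivative (\<lambda>_. 0)) (at x :: 'a filter)" by simp
  then have "(f has_derivative (\<lambda>_. 0)) (at x)"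
    by (rule has_derivative_transform_within_open[of _ _ _ _ "- K"]) (use assms in auto)
  then show ?thesis using assms(1) has_derivative_unique by blast
qed

lemma grad_eq_0_outside_closed:
  assumes "C_k (Suc k) f" "closed K" "\<And>x. x \<notin> K \<Longrightarrow> f x = 0" "x \<notin> K"
  shows "grad f x = 0"
  using derivative_eq_0_outside_closed[OF C_k_Suc_has_derivative[OF assms(1)] assms(2,3,4)]
  by (simp add: grad_def)

text \<open>The difference quotients of \<open>f\<close> have integral zero by translation invariance.\<close>

lemma LINT_grad_compact_support:
  fixes f :: "'a::euclidean_space \<Rightarrow> real"
  assumes f: "C_k (Suc k) f" and K: "compact K" "\<And>x. x \<notin> K \<Longrightarrow> f x = 0"
  shows "(LINT x|lborel. grad f x \<bullet> v) = 0"
proof -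
  have cf: "continuous_on UNIV f" using f by (rule C_k_imp_continuous_on)
  have meas [measurable]: "f \<in> borel_measurable borel" by (rule borel_measurable_continuous_onI[OF cf])
  have "grad f x = 0" if "x \<notin> K" for x
    using grad_eq_0_outside_closed[OF f compact_imp_closed[OF K(1)] K(2) that] .
  then obtain B where B: "B > 0" "\<And>x. norm (grad f x) \<le> B"
    using bounded_compact_support[OF continuous_on_grad[OF f] K(1)] by metis
  let ?h = "\<lambda>n::nat. inverse (real (Suc n))"
  let ?q = "\<lambda>n x. (f (x + ?h n *\<^sub>R v) - f x) / ?h n"
  \<comment> \<open>The steps \<open>?h n\<close> are at most 1, so the support enlarged by
    \<open>norm v\<close> contains the supports of all difference quotients and carries one
    dominating function.\<close>
  let ?K = "(\<lambda>(x, y). x + y) ` (K \<times> cball 0 (norm v))"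
  have cK: "compact ?K"
    by (intro compact_continuous_image compact_Times K) (auto intro!: continuous_intros simp: case_prod_beta)
  have h0: "?h n > 0" for n by simp
  have h1: "?h n \<le> 1" for n by (simp add: field_simps)
  have q0: "?q n x = 0" if "x \<notin> ?K" for n x
  proof -
    have "x \<notin> K" using that by (force intro: image_eqI[of _ _ "(x, 0)"])
    moreover have "x + ?h n *\<^sub>R v \<notin> K"
    proof
      assume "x + ?h n *\<^sub>R v \<in> K"
      moreover have "- (?h n *\<^sub>R v) \<in> cball 0 (norm v)" using h1[of n] by (simp add: mult_left_le_one_le)
      ultimately have "(\<lambda>(x, y). x + y) (x + ?h n *\<^sub>R v, - (?h n *\<^sub>R v)) \<in> ?K" by blast
      then show False using that by simp
    qed
    ultimately show ?thesis using K(2) by simp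
  qed
  have qB: "norm (?q n x) \<le> B * norm v" for n x
  proof -
    have "norm (f (x + ?h n *\<^sub>R v) - f x) \<le> B * norm (x + ?h n *\<^sub>R v - x)"
    proof (rule differentiable_bound[of UNIV f "\<lambda>x v. grad f x \<bullet> v"])
      show "onorm (\<lambda>w. grad f x \<bullet> w) \<le> B" for x
      proof (rule onorm_bound)
        show "norm (grad f x \<bullet> w) \<le> B * norm w" for w
          using Cauchy_Schwarz_ineq2[of "grad f x" w] mult_right_mono[OF B(2)[of x] norm_ge_zero[of w]] by simp
      qed (use B(1) in simp)
    qed (use has_derivative_grad[OF f] in auto)
    then have "\<bar>f (x + ?h n *\<^sub>R v) - f x\<bar> \<le> (B * norm v) * ?h n" by (simp add: divide_inverse mult_ac)
    then show ?thesis by (simp only: real_norm_def abs_divide abs_of_pos[OF h0] pos_divide_le_eq[OF h0])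
  qed
  have "(\<lambda>n. LINT x|lborel. ?q n x) \<longlonglongrightarrow> (LINT x|lborel. grad f x \<bullet> v)"
  proof (rule integral_dominated_convergence)
    show "integrable lborel (\<lambda>x. indicator ?K x *\<^sub>R (B * norm v))"
      by (intro borel_integrable_compact cK continuous_on_const)
    show "AE x in lborel. norm (?q n x) \<le> indicator ?K x *\<^sub>R (B * norm v)" for n
      using q0[where n = n] qB[where n = n] by (auto simp: indicator_def)
    show "AE x in lborel. (\<lambda>n. ?q n x) \<longlonglongrightarrow> grad f x \<bullet> v"
    proof (rule AE_I2)
      fix x
      have "((\<lambda>s. x + s *\<^sub>R v) has_derivative (\<lambda>s. s *\<^sub>R v)) (at 0)"
        by (auto intro!: derivative_eq_intros)
      moreover have "(f has_derivative (\<lambda>w. grad f x \<bullet> w)) (at (x + 0 *\<^sub>R v))"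
        using has_derivative_grad[OF f, of x] by simp
      ultimately have "((\<lambda>s. f (x + s *\<^sub>R v)) has_derivative (\<lambda>s. grad f x \<bullet> (s *\<^sub>R v))) (at 0)"
        by (rule diff_chain_at[unfolded o_def])
      then have "((\<lambda>s. f (x + s *\<^sub>R v)) has_real_derivative (grad f x \<bullet> v)) (at 0)"
        by (simp add: has_field_derivative_def mult.commute[of _ "grad f x \<bullet> v"])
      then have "(\<lambda>h. (f (x + h *\<^sub>R v) - f x) / h) \<midarrow>0\<rightarrow> grad f x \<bullet> v"
        by (simp add: DERIV_def)
      moreover have "filterlim ?h (at 0) sequentially"
        using LIMSEQ_inverse_real_of_nat by (auto simp: filterlim_at)
      ultimately show "(\<lambda>n. ?q n x) \<longlonglongrightarrow> grad f x \<bullet> v"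
        by (rule filterlim_compose)
    qed
  qed (use continuous_on_grad[OF f, of UNIV] in \<open>auto intro!: borel_measurable_continuous_onI continuous_intros\<close>)
  moreover have "(LINT x|lborel. ?q n x) = 0" for n
  proof -
    have "integrable lborel f" by (rule integrable_compact_support[OF cf K])
    moreover have "integrable lborel (\<lambda>x. f (x + c))" for c
    proof (rule integrable_compact_support)
      show "continuous_on UNIV (\<lambda>x. f (x + c))"
        by (rule continuous_on_compose2[OF cf]) (auto intro!: continuous_intros)
      show "compact ((\<lambda>x. x - c) ` K)"
        by (intro compact_continuous_image K continuous_intros)
      show "f (x + c) = 0" if "x \<notin> (\<lambda>x. x - c) ` K" for x
        using that K(2)[of "x + c"] by (metis add_diff_cancel_right' image_eqI)
    qed
    ultimately show ?thesis
      by (simp add: LINT_lborel_translation)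
  qed
  ultimately show ?thesis by (simp add: LIMSEQ_const_iff)
qed

section \<open>Square integrable functions\<close>

lemma L2_measurable: "u \<in> L2 S \<Longrightarrow> u \<in> borel_measurable (lebesgue_on S)"
  by (simp add: L2_def)

lemma L2_integrable_square: "u \<in> L2 S \<Longrightarrow> integrable (lebesgue_on S) (\<lambda>x. (norm (u x))\<^sup>2)"
  by (simp add: L2_def)

lemma L2_bound:
  assumes "g \<in> L2 S" "u \<in> borel_measurable (lebesgue_on S)"
    and "AE x in lebesgue_on S. norm (u x) \<le> c * norm (g x)"
  shows "u \<in> L2 S"
proof -
  have "integrable (lebesgue_on S) (\<lambda>x. (norm (u x))\<^sup>2)"
  proof (rule Bochner_Integration.integrable_bound)
    show "integrable (lebesgue_on S) (\<lambda>x. c\<^sup>2 * (norm (g x))\<^sup>2)"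
      using assms(1) by (auto simp: L2_def)
    show "AE x in lebesgue_on S. norm ((norm (u x))\<^sup>2) \<le> norm (c\<^sup>2 * (norm (g x))\<^sup>2)"
      using assms(3)
    proof eventually_elim
      case (elim x)
      then have "(norm (u x))\<^sup>2 \<le> (c * norm (g x))\<^sup>2" by (intro power_mono) auto
      then show ?case by (simp add: power_mult_distrib)
    qed
  qed (use assms(2) in measurable)
  then show ?thesis using assms(2) by (simp add: L2_def)
qed

lemma L2_inner_integrable:
  assumes "u \<in> L2 S" "v \<in> L2 S"
  shows "integrable (lebesgue_on S) (\<lambda>x. u x \<bullet> v x)"
proof (rule Bochner_Integration.integrable_bound)
  show "integrable (lebesgue_on S) (\<lambda>x. (norm (u x))\<^sup>2 + (norm (v x))\<^sup>2)"
    using assms by (auto simp: L2_def)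
  show "(\<lambda>x. u x \<bullet> v x) \<in> borel_measurable (lebesgue_on S)"
    using assms by (auto simp: L2_def)
  show "AE x in lebesgue_on S. norm (u x \<bullet> v x) \<le> norm ((norm (u x))\<^sup>2 + (norm (v x))\<^sup>2)"
  proof (rule AE_I2)
    fix x
    have "\<bar>u x \<bullet> v x\<bar> \<le> norm (u x) * norm (v x)" by (rule Cauchy_Schwarz_ineq2)
    also have "\<dots> \<le> 2 * norm (u x) * norm (v x)" by simp
    also have "\<dots> \<le> (norm (u x))\<^sup>2 + (norm (v x))\<^sup>2" by (rule sum_squares_bound)
    finally show "norm (u x \<bullet> v x) \<le> norm ((norm (u x))\<^sup>2 + (norm (v x))\<^sup>2)" by simp
  qed
qed

lemma L2_mult_integrable:
  fixes u v :: "_ \<Rightarrow> real"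
  shows "u \<in> L2 S \<Longrightarrow> v \<in> L2 S \<Longrightarrow> integrable (lebesgue_on S) (\<lambda>x. u x * v x)"
  using L2_inner_integrable[of u S v] by simp

lemma L2_add:
  assumes "u \<in> L2 S" "v \<in> L2 S"
  shows "(\<lambda>x. u x + v x) \<in> L2 S"
proof -
  have "(\<lambda>x. (norm (u x + v x))\<^sup>2) = (\<lambda>x. (norm (u x))\<^sup>2 + (norm (v x))\<^sup>2 + 2 * (u x \<bullet> v x))"
    by (simp add: power2_norm_eq_inner inner_add_left inner_add_right inner_commute fun_eq_iff)
  then show ?thesis
    using assms L2_inner_integrable[OF assms] by (auto simp: L2_def)
qed

lemma L2_uminus: "u \<in> L2 S \<Longrightarrow> (\<lambda>x. - u x) \<in> L2 S"
  by (rule L2_bound[where g = u and c = 1]) (auto simp: L2_def)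

lemma L2_diff: "u \<in> L2 S \<Longrightarrow> v \<in> L2 S \<Longrightarrow> (\<lambda>x. u x - v x) \<in> L2 S"
  using L2_add[OF _ L2_uminus, of u S v] by simp

lemma L2_component: "u \<in> L2 S \<Longrightarrow> (\<lambda>x. u x \<bullet> w) \<in> L2 S"
  by (rule L2_bound[where g = u and c = "norm w"])
    (auto simp: L2_def Cauchy_Schwarz_ineq2 mult.commute[of "norm w"] intro!: AE_I2)

lemma L2_bounded_scaleR:
  assumes "u \<in> L2 S" "g \<in> borel_measurable (lebesgue_on S)" "\<And>x. \<bar>g x\<bar> \<le> c"
  shows "(\<lambda>x. g x *\<^sub>R u x) \<in> L2 S"
  by (rule L2_bound[where g = u and c = c])
    (use assms in \<open>auto simp: L2_def intro!: mult_right_mono\<close>)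

lemma L2_bounded:
  assumes "S \<in> lmeasurable" "u \<in> borel_measurable (lebesgue_on S)" "AE x in lebesgue_on S. norm (u x) \<le> c"
  shows "u \<in> L2 S"
proof (rule L2_bound[where g = "\<lambda>_. 1 :: real" and c = c])
  have "finite_measure (lebesgue_on S)" using assms(1) by (rule finite_measure_lebesgue_on)
  then show "(\<lambda>_. 1 :: real) \<in> L2 S"
    using finite_measure.integrable_const[of "lebesgue_on S" "1::real"] by (simp add: L2_def)
qed (use assms in auto)

lemma L2_integrable:
  assumes "S \<in> lmeasurable" "u \<in> L2 S"
  shows "integrable (lebesgue_on S) u"
proof (rule Bochner_Integration.integrable_bound)
  have "finite_measure (lebesgue_on S)" using assms(1) by (rule finite_measure_lebesgue_on)
  then show "integrable (lebesgue_on S) (\<lambda>x. 1 + (norm (u x))\<^sup>2)"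
    using assms(2) finite_measure.integrable_const[of "lebesgue_on S" "1::real"] by (auto simp: L2_def)
  show "AE x in lebesgue_on S. norm (u x) \<le> norm (1 + (norm (u x))\<^sup>2)"
  proof (rule AE_I2)
    fix x
    have "2 * norm (u x) \<le> 1 + (norm (u x))\<^sup>2" using sum_squares_bound[of 1 "norm (u x)"] by simp
    then have "norm (u x) \<le> 1 + (norm (u x))\<^sup>2"
      using norm_ge_zero[of "u x"] by linarith
    then show "norm (u x) \<le> norm (1 + (norm (u x))\<^sup>2)" by simp
  qed
qed (use assms in \<open>auto simp: L2_def\<close>)

lemma L2_Cauchy_Schwarz:
  assumes u: "u \<in> L2 S" and v: "v \<in> L2 S"
  shows "(LINT x|lebesgue_on S. u x \<bullet> v x)\<^sup>2
    \<le> (LINT x|lebesgue_on S. (norm (u x))\<^sup>2) * (LINT x|lebesgue_on S. (norm (v x))\<^sup>2)"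
proof -
  let ?A = "LINT x|lebesgue_on S. (norm (u x))\<^sup>2" and ?B = "LINT x|lebesgue_on S. u x \<bullet> v x"
    and ?C = "LINT x|lebesgue_on S. (norm (v x))\<^sup>2"
  have ex: "(\<lambda>x. (norm (u x + t *\<^sub>R v x))\<^sup>2) = (\<lambda>x. (norm (u x))\<^sup>2 + ((2*t) * (u x \<bullet> v x) + (t * t) * (norm (v x))\<^sup>2))" for t
    by (simp add: power2_norm_eq_inner inner_add_left inner_add_right inner_commute fun_eq_iff)
  have quad: "0 \<le> ?A + (2*t) * ?B + (t * t) * ?C" for t
  proof -
    have "0 \<le> (LINT x|lebesgue_on S. (norm (u x + t *\<^sub>R v x))\<^sup>2)" by simp
    also have "\<dots> = ?A + ((2*t) * ?B + (t * t) * ?C)"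
      unfolding ex using u v L2_inner_integrable[OF u v] by (simp add: L2_def)
    finally show ?thesis by simp
  qed
  have C0: "?C \<ge> 0" by simp
  show ?thesis
  proof (cases "?C = 0")
    case True
    have "AE x in lebesgue_on S. (norm (v x))\<^sup>2 = 0"
      using True L2_integrable_square[OF v] by (subst (asm) integral_nonneg_eq_0_iff_AE) auto
    then have "AE x in lebesgue_on S. u x \<bullet> v x = 0" by eventually_elim simp
    then have "?B = 0" by (rule integral_eq_zero_AE)
    then show ?thesis using True by simp
  next
    case False
    then have "?C > 0" using C0 by linarith
    \<comment> \<open>The parameter is the minimizer of the nonnegative quadratic
      \<open>quad\<close>.\<close>
    then show ?thesis using quad[of "- ?B / ?C"] by (simp add: power2_eq_square field_simps)
  qed
qed

abbreviation L2_sq :: "'a::euclidean_space set \<Rightarrow> ('a \<Rightarrow> 'b::euclidean_space) \<Rightarrow> real" where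
  "L2_sq S u \<equiv> LINT x|lebesgue_on S. (norm (u x))\<^sup>2"

definition L2_tendsto :: "'a::euclidean_space set \<Rightarrow> (nat \<Rightarrow> 'a \<Rightarrow> 'b::euclidean_space) \<Rightarrow> ('a \<Rightarrow> 'b) \<Rightarrow> bool" where
  "L2_tendsto S u l \<longleftrightarrow> (\<lambda>n. L2_sq S (\<lambda>x. u n x - l x)) \<longlonglongrightarrow> 0"

lemma L2_tendsto_const: "L2_tendsto S (\<lambda>_. u) u"
  by (simp add: L2_tendsto_def)

text \<open>Transfers convergence along a pointwise Lipschitz estimate. Source and target may have
  different value types, so convergence of functions can control convergence of gradients.\<close>

lemma L2_tendsto_bound:
  assumes "L2_tendsto S v m" and "\<And>n. v n \<in> L2 S" "m \<in> L2 S"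
    and "\<And>n. u n \<in> borel_measurable (lebesgue_on S)" "l \<in> borel_measurable (lebesgue_on S)"
    and "\<And>n. AE x in lebesgue_on S. norm (u n x - l x) \<le> c * norm (v n x - m x)"
  shows "L2_tendsto S u l"
  unfolding L2_tendsto_def
proof (rule tendsto_sandwich[where f = "\<lambda>_. 0"])
  show "(\<lambda>n. c\<^sup>2 * L2_sq S (\<lambda>x. v n x - m x)) \<longlonglongrightarrow> 0"
    using assms(1) unfolding L2_tendsto_def by (rule tendsto_mult_right_zero)
  show "\<forall>\<^sub>F n in sequentially. L2_sq S (\<lambda>x. u n x - l x)
      \<le> c\<^sup>2 * L2_sq S (\<lambda>x. v n x - m x)"
  proof (rule always_eventually, rule allI)
    fix n
    have vm: "(\<lambda>x. v n x - m x) \<in> L2 S" by (intro L2_diff assms)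
    have "(\<lambda>x. u n x - l x) \<in> L2 S"
      by (rule L2_bound[OF vm _ assms(6)]) (use assms(4,5) in measurable)
    then have "L2_sq S (\<lambda>x. u n x - l x) \<le> (LINT x|lebesgue_on S. c\<^sup>2 * (norm (v n x - m x))\<^sup>2)"
    proof (intro integral_mono_AE L2_integrable_square)
      show "integrable (lebesgue_on S) (\<lambda>x. c\<^sup>2 * (norm (v n x - m x))\<^sup>2)"
        using L2_integrable_square[OF vm] by simp
      show "AE x in lebesgue_on S. (norm (u n x - l x))\<^sup>2 \<le> c\<^sup>2 * (norm (v n x - m x))\<^sup>2"
        using assms(6)[of n]
      proof eventually_elim
        case (elim x)
        then have "(norm (u n x - l x))\<^sup>2 \<le> (c * norm (v n x - m x))\<^sup>2" by (intro power_mono) auto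
        then show ?case by (simp add: power_mult_distrib)
      qed
    qed
    then show "L2_sq S (\<lambda>x. u n x - l x)
      \<le> c\<^sup>2 * L2_sq S (\<lambda>x. v n x - m x)" by simp
  qed
qed (auto intro: always_eventually)

lemma L2_tendsto_add:
  assumes "L2_tendsto S u l" "L2_tendsto S v m" "\<And>n. u n \<in> L2 S" "\<And>n. v n \<in> L2 S" "l \<in> L2 S" "m \<in> L2 S"
  shows "L2_tendsto S (\<lambda>n x. u n x + v n x) (\<lambda>x. l x + m x)"
  unfolding L2_tendsto_def
proof (rule tendsto_sandwich[where f = "\<lambda>_. 0"])
  show "(\<lambda>n. 2 * L2_sq S (\<lambda>x. u n x - l x) + 2 * L2_sq S (\<lambda>x. v n x - m x)) \<longlonglongrightarrow> 0"
    using assms(1,2) unfolding L2_tendsto_def by (auto intro!: tendsto_eq_intros)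
  show "\<forall>\<^sub>F n in sequentially. (LINT x|lebesgue_on S. (norm ((u n x + v n x) - (l x + m x)))\<^sup>2)
      \<le> 2 * L2_sq S (\<lambda>x. u n x - l x) + 2 * L2_sq S (\<lambda>x. v n x - m x)"
  proof (rule always_eventually, rule allI)
    fix n
    have ul: "(\<lambda>x. u n x - l x) \<in> L2 S" and vm: "(\<lambda>x. v n x - m x) \<in> L2 S" by (intro L2_diff assms)+
    have "(LINT x|lebesgue_on S. (norm ((u n x + v n x) - (l x + m x)))\<^sup>2)
      \<le> (LINT x|lebesgue_on S. 2 * (norm (u n x - l x))\<^sup>2 + 2 * (norm (v n x - m x))\<^sup>2)"
    proof (intro integral_mono_AE L2_integrable_square L2_diff L2_add assms AE_I2)
      fix x
      let ?p = "u n x - l x" and ?q = "v n x - m x"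
      have "(norm (?p + ?q))\<^sup>2 \<le> (norm ?p + norm ?q)\<^sup>2" by (intro power_mono norm_triangle_ineq) auto
      also have "\<dots> \<le> 2 * (norm ?p)\<^sup>2 + 2 * (norm ?q)\<^sup>2"
        using sum_squares_bound[of "norm ?p" "norm ?q"] by (simp add: power2_sum)
      finally show "(norm ((u n x + v n x) - (l x + m x)))\<^sup>2 \<le> 2 * (norm ?p)\<^sup>2 + 2 * (norm ?q)\<^sup>2"
        by (simp add: algebra_simps)
    qed (use ul vm in \<open>auto simp: L2_def\<close>)
    also have "\<dots> = 2 * L2_sq S (\<lambda>x. u n x - l x) + 2 * L2_sq S (\<lambda>x. v n x - m x)"
      using ul vm by (auto simp: L2_def)
    finally show "(LINT x|lebesgue_on S. (norm ((u n x + v n x) - (l x + m x)))\<^sup>2) \<le> \<dots>" .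
  qed
qed (auto intro: always_eventually)

text \<open>Cauchy-Schwarz. The hypothesis concerns the product of the squared norms so that one
  factor may stay fixed while the other tends to 0.\<close>

lemma LINT_inner_tendsto_0:
  assumes "(\<lambda>n. L2_sq S (u n) * L2_sq S (v n)) \<longlonglongrightarrow> 0" "\<And>n. u n \<in> L2 S" "\<And>n. v n \<in> L2 S"
  shows "(\<lambda>n. LINT x|lebesgue_on S. u n x \<bullet> v n x) \<longlonglongrightarrow> 0"
proof -
  have "(\<lambda>n. (LINT x|lebesgue_on S. u n x \<bullet> v n x)\<^sup>2) \<longlonglongrightarrow> 0"
    by (rule tendsto_sandwich[OF _ _ tendsto_const assms(1)])
      (intro always_eventually allI zero_le_power2 L2_Cauchy_Schwarz assms)+
  from tendsto_real_sqrt[OF this] show ?thesis by (simp add: tendsto_rabs_zero_iff)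
qed

lemma L2_tendsto_inner:
  assumes "L2_tendsto S u l" "L2_tendsto S v m" "\<And>n. u n \<in> L2 S" "\<And>n. v n \<in> L2 S" "l \<in> L2 S" "m \<in> L2 S"
  shows "(\<lambda>n. LINT x|lebesgue_on S. u n x \<bullet> v n x) \<longlonglongrightarrow> (LINT x|lebesgue_on S. l x \<bullet> m x)"
proof -
  let ?I = "\<lambda>f. LINT x|lebesgue_on S. f x"
  let ?d = "\<lambda>n x. u n x - l x" and ?e = "\<lambda>n x. v n x - m x"
  note lim = assms(1,2)[unfolded L2_tendsto_def]
  have de: "?d n \<in> L2 S" "?e n \<in> L2 S" for n by (intro L2_diff assms)+
  have "(\<lambda>n. ?I (\<lambda>x. ?d n x \<bullet> ?e n x)) \<longlonglongrightarrow> 0" "(\<lambda>n. ?I (\<lambda>x. ?d n x \<bullet> m x)) \<longlonglongrightarrow> 0"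
    "(\<lambda>n. ?I (\<lambda>x. l x \<bullet> ?e n x)) \<longlonglongrightarrow> 0"
    using tendsto_mult[OF lim] tendsto_mult_left_zero[OF lim(1)] tendsto_mult_right_zero[OF lim(2)]
    by (intro LINT_inner_tendsto_0 de assms; simp)+
  from tendsto_add[OF tendsto_add[OF tendsto_add[OF this(1,2)] this(3)] tendsto_const[of "?I (\<lambda>x. l x \<bullet> m x)"]]
  have "(\<lambda>n. ?I (\<lambda>x. ?d n x \<bullet> ?e n x) + ?I (\<lambda>x. ?d n x \<bullet> m x) + ?I (\<lambda>x. l x \<bullet> ?e n x) + ?I (\<lambda>x. l x \<bullet> m x))
      \<longlonglongrightarrow> ?I (\<lambda>x. l x \<bullet> m x)" by simp
  moreover have "?I (\<lambda>x. ?d n x \<bullet> ?e n x) + ?I (\<lambda>x. ?d n x \<bullet> m x) + ?I (\<lambda>x. l x \<bullet> ?e n x) + ?I (\<lambda>x. l x \<bullet> m x)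
      = ?I (\<lambda>x. u n x \<bullet> v n x)" for n
  proof -
    have "?I (\<lambda>x. ?d n x \<bullet> ?e n x) + ?I (\<lambda>x. ?d n x \<bullet> m x) + ?I (\<lambda>x. l x \<bullet> ?e n x) + ?I (\<lambda>x. l x \<bullet> m x)
        = ?I (\<lambda>x. ?d n x \<bullet> ?e n x + ?d n x \<bullet> m x + l x \<bullet> ?e n x + l x \<bullet> m x)"
      using L2_inner_integrable[OF de[of n]] L2_inner_integrable[OF de(1)[of n] assms(6)]
        L2_inner_integrable[OF assms(5) de(2)[of n]] L2_inner_integrable[OF assms(5,6)] by simp
    also have "\<dots> = ?I (\<lambda>x. u n x \<bullet> v n x)"
      by (intro arg_cong[of _ _ ?I] ext) (simp add: inner_diff_left inner_diff_right)
    finally show ?thesis .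
  qed
  ultimately show ?thesis by simp
qed

section \<open>Weak gradients\<close>

lemma grad_mult:
  assumes "C_k (Suc k) f" "C_k (Suc k) g"
  shows "grad (\<lambda>x. f x * g x) x = f x *\<^sub>R grad g x + g x *\<^sub>R grad f x"
proof (rule grad_eqI)
  show "((\<lambda>x. f x * g x) has_derivative (\<lambda>v. (f x *\<^sub>R grad g x + g x *\<^sub>R grad f x) \<bullet> v)) (at x)"
    by (rule has_derivative_eq_rhs[OF has_derivative_mult[OF assms[THEN has_derivative_grad]]])
      (simp add: inner_add_left mult.commute)
qed

lemma grad_add:
  assumes "C_k (Suc k) f" "C_k (Suc k) g"
  shows "grad (\<lambda>x. f x + g x) x = grad f x + grad g x"
proof (rule grad_eqI)
  show "((\<lambda>x. f x + g x) has_derivative (\<lambda>v. (grad f x + grad g x) \<bullet> v)) (at x)"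
    by (rule has_derivative_eq_rhs[OF has_derivative_add[OF assms[THEN has_derivative_grad]]])
      (simp add: inner_add_left)
qed

lemma grad_diff:
  assumes "C_k (Suc k) f" "C_k (Suc k) g"
  shows "grad (\<lambda>x. f x - g x - c) x = grad f x - grad g x"
proof (rule grad_eqI)
  show "((\<lambda>x. f x - g x - c) has_derivative (\<lambda>v. (grad f x - grad g x) \<bullet> v)) (at x)"
    by (rule has_derivative_eq_rhs[OF has_derivative_diff[OF has_derivative_diff[OF assms[THEN has_derivative_grad]] has_derivative_const]])
      (simp add: inner_diff_left)
qed

lemma grad_chain:
  assumes "C_k (Suc k) f" "(h has_real_derivative h') (at (f x))"
  shows "grad (\<lambda>x. h (f x)) x = h' *\<^sub>R grad f x"
proof (rule grad_eqI)
  show "((\<lambda>x. h (f x)) has_derivative (\<lambda>v. (h' *\<^sub>R grad f x) \<bullet> v)) (at x)"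
    using diff_chain_at[OF has_derivative_grad[OF assms(1)] assms(2)[unfolded has_field_derivative_def]]
    by (simp add: o_def)
qed

lemma test_function_frechet_derivative:
  "\<phi> \<in> test_functions S \<Longrightarrow> frechet_derivative \<phi> (at x) v = grad \<phi> x \<bullet> v"
  using has_derivative_imp_grad[OF test_functions_has_derivative] by metis

lemma test_functions_continuous_on: "\<phi> \<in> test_functions S \<Longrightarrow> continuous_on A \<phi>"
  using test_functions_C_k[of \<phi> S 0] by (rule C_k_imp_continuous_on)

lemma test_functions_continuous_on_grad: "\<phi> \<in> test_functions S \<Longrightarrow> continuous_on A (grad \<phi>)"
  using test_functions_C_k[of \<phi> S "Suc 0"] by (intro continuous_on_grad[of 0])

lemma has_weak_gradient_iff:
  "has_weak_gradient S u G \<longleftrightarrow> locally_integrable S u \<and> locally_integrable S G \<and>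
     (\<forall>\<phi>\<in>test_functions S. \<forall>i\<in>Basis.
        (LINT x|lebesgue_on S. u x * (grad \<phi> x \<bullet> i)) = - (LINT x|lebesgue_on S. (G x \<bullet> i) * \<phi> x))"
  by (simp add: has_weak_gradient_def test_function_frechet_derivative)

text \<open>The vanishing of all integrals over boxes passes to the Borel sets, which are generated by the boxes.\<close>

lemma AE_eq_0_if_box_integrals_eq_0:
  fixes g :: "'a::euclidean_space \<Rightarrow> real"
  assumes g: "integrable lborel g"
    and box: "\<And>c d. (LINT x|lborel. indicator (box c d) x * g x) = 0"
  shows "AE x in lborel. g x = 0"
proof -
  have [measurable]: "g \<in> borel_measurable borel" using g by simp
  \<comment> \<open>Since \<open>ennreal\<close> truncates at 0, these are the measures with
    densities the positive and the negative part of \<open>g\<close>. Equality on boxes will make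
    them equal.\<close>
  let ?P = "density lborel (\<lambda>x. ennreal (g x))" and ?N = "density lborel (\<lambda>x. ennreal (- g x))"
  have emb: "emeasure ?P (box c d) = ennreal (LINT x|lborel. indicator (box c d) x * max 0 (g x))"
    "emeasure ?N (box c d) = ennreal (LINT x|lborel. indicator (box c d) x * max 0 (- g x))" for c d :: 'a
  proof -
    have I: "integrable lborel (\<lambda>x. indicator (box c d) x * max 0 (s * g x))" for s :: real
    proof (rule Bochner_Integration.integrable_bound)
      show "integrable lborel (\<lambda>x. s * g x)" using g by simp
    qed (auto simp: indicator_def)
    have "emeasure (density lborel (\<lambda>x. ennreal (s * g x))) (box c d) = ennreal (LINT x|lborel. indicator (box c d) x * max 0 (s * g x))" for s
    proof -
      have "emeasure (density lborel (\<lambda>x. ennreal (s * g x))) (box c d) = (\<integral>\<^sup>+x. ennreal (indicator (box c d) x * max 0 (s * g x)) \<partial>lborel)"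
        by (subst emeasure_density) (auto intro!: nn_integral_cong simp: indicator_def ennreal_neg max_def)
      also have "\<dots> = ennreal (LINT x|lborel. indicator (box c d) x * max 0 (s * g x))"
        using I by (intro nn_integral_eq_integral) auto
      finally show ?thesis .
    qed
    from this[of 1] this[of "-1"] show "emeasure ?P (box c d) = ennreal (LINT x|lborel. indicator (box c d) x * max 0 (g x))"
      "emeasure ?N (box c d) = ennreal (LINT x|lborel. indicator (box c d) x * max 0 (- g x))" by simp_all
  qed
  have eq: "emeasure ?P (box c d) = emeasure ?N (box c d)" for c d
  proof -
    have "(LINT x|lborel. indicator (box c d) x * max 0 (g x)) - (LINT x|lborel. indicator (box c d) x * max 0 (- g x))
        = (LINT x|lborel. indicator (box c d) x * max 0 (g x) - indicator (box c d) x * max 0 (- g x))"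
      by (rule Bochner_Integration.integral_diff[symmetric]; rule Bochner_Integration.integrable_bound[OF g])
        (auto simp: indicator_def)
    also have "\<dots> = (LINT x|lborel. indicator (box c d) x * g x)"
      by (intro Bochner_Integration.integral_cong) (auto simp: max_def)
    finally show ?thesis using box[of c d] emb[of c d] by simp
  qed
  have "?P = ?N"
  proof (rule measure_eqI_generator_eq)
    let ?E = "range (\<lambda>(a, b). box a b::'a set)"
    show "Int_stable ?E" by (auto simp: Int_stable_def box_Int_box)
    show "?E \<subseteq> Pow UNIV" "sets ?P = sigma_sets UNIV ?E" "sets ?N = sigma_sets UNIV ?E"
      by (simp_all add: borel_eq_box)
    let ?A = "\<lambda>n::nat. box (- (real n *\<^sub>R One)) (real n *\<^sub>R One) :: 'a set"
    show "range ?A \<subseteq> ?E" "(\<Union>i. ?A i) = UNIV"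
      unfolding UN_box_eq_UNIV by auto
    show "emeasure ?P (?A i) \<noteq> \<infinity>" for i by (simp add: emb)
    show "emeasure ?P X = emeasure ?N X" if "X \<in> ?E" for X
      using that eq by auto
  qed
  \<comment> \<open>Equal measures determine their densities almost everywhere once the total mass
    is finite.\<close>
  moreover have "(\<integral>\<^sup>+x. ennreal (g x) \<partial>lborel) \<noteq> \<infinity>"
  proof -
    have "(\<integral>\<^sup>+x. ennreal (g x) \<partial>lborel) \<le> (\<integral>\<^sup>+x. ennreal (norm (g x)) \<partial>lborel)"
      by (intro nn_integral_mono ennreal_leI) auto
    also have "\<dots> < \<infinity>" using g by (simp add: integrable_iff_bounded)
    finally show ?thesis by simp
  qed
  ultimately have "AE x in lborel. ennreal (g x) = ennreal (- g x)"
    by (subst (asm) finite_density_unique) auto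
  then show ?thesis
  proof eventually_elim
    case (elim x)
    then show ?case by (cases "g x \<ge> 0") (auto simp: ennreal_neg ennreal_eq_0_iff)
  qed
qed

section \<open>Smooth approximation of boxes and the fundamental lemma of the calculus of
  variations\<close>

lemma eta_scaled_tendsto:
  "(\<lambda>n. eta 0 (real n * s)) \<longlonglongrightarrow> indicator {0<..} s"
proof (cases "s > 0")
  case True
  have "(\<lambda>n. exp (- (1 / s * inverse (real n)))) \<longlonglongrightarrow> exp (- (1 / s * 0))"
    by (intro tendsto_intros lim_inverse_n)
  moreover have "\<forall>\<^sub>F n in sequentially. exp (- (1 / s * inverse (real n))) = eta 0 (real n * s)"
    using eventually_gt_at_top[of 0] by eventually_elim (use True in \<open>simp add: eta_def field_simps\<close>)
  ultimately show ?thesis using True by (auto intro: Lim_transform_eventually)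
qed (simp add: eta_def zero_less_mult_iff)

text \<open>One smooth factor for each face. As \<open>n\<close> grows, the values inside the open
  box increase to 1, while the product vanishes outside for every \<open>n\<close>.\<close>

definition box_bump :: "'a::euclidean_space \<Rightarrow> 'a \<Rightarrow> nat \<Rightarrow> 'a \<Rightarrow> real" where
  "box_bump c d n x = (\<Prod>i\<in>Basis. eta 0 (real n * ((x - c) \<bullet> i)) * eta 0 (real n * (- ((x - d) \<bullet> i))))"

lemma box_bump_tendsto: "(\<lambda>n. box_bump c d n x) \<longlonglongrightarrow> indicator (box c d) x"
proof -
  have "(\<lambda>n. box_bump c d n x) \<longlonglongrightarrow>
      (\<Prod>i\<in>Basis. indicator {0<..} ((x - c) \<bullet> i) * indicator {0<..} (- ((x - d) \<bullet> i)))"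
    unfolding box_bump_def by (intro tendsto_intros eta_scaled_tendsto)
  also have "(\<Prod>i\<in>Basis. indicator {0<..} ((x - c) \<bullet> i) * indicator {0<..} (- ((x - d) \<bullet> i)))
      = (indicator (box c d) x :: real)"
  proof (cases "x \<in> box c d")
    case True
    then show ?thesis by (auto simp: mem_box inner_diff_left intro!: prod.neutral)
  next
    case False
    then obtain i where "i \<in> Basis" "\<not> (c \<bullet> i < x \<bullet> i \<and> x \<bullet> i < d \<bullet> i)" by (auto simp: mem_box)
    then show ?thesis using False by (auto simp: inner_diff_left prod_zero_iff indicator_def)
  qed
  finally show ?thesis .
qed

lemma box_bump_bounds: "0 \<le> box_bump c d n x" "box_bump c d n x \<le> 1"
  unfolding box_bump_def using eta_nonneg eta_le[of 0]
  by (auto intro!: prod_nonneg prod_le_1 mult_le_one)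

lemma box_bump_eq_0: "x \<notin> cbox c d \<Longrightarrow> box_bump c d n x = 0"
  by (force simp: box_bump_def mem_box inner_diff_left prod_zero_iff not_le intro!: eta_nonpos_arg mult_nonneg_nonpos)

lemma box_bump_in_test_functions:
  assumes "cbox c d \<subseteq> S"
  shows "box_bump c d n \<in> test_functions S"
proof (rule test_functionsI[OF _ compact_cbox assms box_bump_eq_0])
  have "C_k k (\<lambda>x. eta 0 (real n * ((x - c) \<bullet> i)) * eta 0 (real n * ((-1) * ((x - d) \<bullet> i))))" for k and i :: 'a
    by (intro C_k_mult C_k_eta C_k_cmult C_k_inner)
  then show "C_k k (box_bump c d n)" for k
    unfolding box_bump_def[abs_def] by (intro C_k_prod) auto
qed

text \<open>Localize to a closed box inside \<open>S\<close>, where \<open>F\<close> is integrable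
  and has a Borel representative. Smooth bumps show that its integrals over all boxes vanish, and
  countably many closed boxes cover \<open>S\<close>.\<close>

lemma AE_eq_0_if_weakly_0:
  fixes F :: "'a::euclidean_space \<Rightarrow> real"
  assumes S: "open S" and F: "locally_integrable S F"
    and 0: "\<And>\<phi>. \<phi> \<in> test_functions S \<Longrightarrow> (LINT x|lebesgue_on S. F x * \<phi> x) = 0"
  shows "AE x in lebesgue_on S. F x = 0"
proof -
  have cb: "AE x in lebesgue. x \<in> cbox a b \<longrightarrow> F x = 0" if ab: "cbox a b \<subseteq> S" for a b
  proof -
    let ?f = "\<lambda>x. indicator (cbox a b) x * F x"
    have "integrable (lebesgue_on (cbox a b)) F" using F ab by (auto simp: locally_integrable_def)
    then have f: "integrable lebesgue ?f" by (subst (asm) integrable_restrict_space) auto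
    then obtain g where g [measurable]: "g \<in> borel_measurable lborel" and fg': "AE x in lborel. ?f x = g x"
      using completion_ex_borel_measurable_real[of ?f lborel] by auto
    have fg: "AE x in lebesgue. ?f x = g x" using fg' by (rule AE_completion)
    have "integrable lebesgue g"
      using f fg g by (subst integrable_cong_AE[of _ _ ?f]) (auto intro: measurable_completion simp: eq_commute)
    then have ig: "integrable lborel g" using g by (simp add: integrable_completion)
    have "AE x in lborel. x \<notin> cbox a b \<longrightarrow> g x = 0"
      using fg' by eventually_elim auto
    \<comment> \<open>The bumps converge to indicators of open boxes, so the faces of the closed box
      must be discarded as a null set.\<close>
    moreover have "AE x in lborel. x \<notin> cbox a b - box a b"
    proof (rule AE_not_in)
      have "negligible (cbox a b - box a b)" by (rule negligible_frontier_interval)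
      then show "cbox a b - box a b \<in> null_sets lborel"
        by (simp add: negligible_iff_null_sets null_sets_completion_iff)
    qed
    ultimately have gb: "AE x in lborel. x \<notin> box a b \<longrightarrow> g x = 0" by eventually_elim auto
    have "(LINT x|lborel. indicator (box c d) x * g x) = 0" for c d
    proof -
      \<comment> \<open>The first factor confines the support to \<open>cbox a b\<close>, hence to
        \<open>S\<close>; the second approximates an arbitrary box.\<close>
      let ?\<beta> = "\<lambda>n x. box_bump a b n x * box_bump c d n x"
      have m [measurable]: "?\<beta> n \<in> borel_measurable borel" for n
        by (intro borel_measurable_times borel_measurable_continuous_onI
          test_functions_continuous_on[OF box_bump_in_test_functions[OF subset_refl]])
      have bounds: "0 \<le> ?\<beta> n x" "?\<beta> n x \<le> 1" for n x
        using box_bump_bounds[of a b n x] box_bump_bounds[of c d n x] by (auto intro: mult_le_one)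
      have z: "?\<beta> n x = 0" if "x \<notin> cbox a b" for n x using that by (simp add: box_bump_eq_0)
      have "(\<lambda>n. LINT x|lborel. ?\<beta> n x * g x) \<longlonglongrightarrow> (LINT x|lborel. (indicator (box a b) x * indicator (box c d) x) * g x)"
      proof (rule integral_dominated_convergence)
        show "integrable lborel (\<lambda>x. norm (g x))" using ig by simp
        show "AE x in lborel. (\<lambda>n. ?\<beta> n x * g x) \<longlonglongrightarrow> (indicator (box a b) x * indicator (box c d) x) * g x"
          by (intro AE_I2 tendsto_intros box_bump_tendsto)
        show "AE x in lborel. norm (?\<beta> n x * g x) \<le> norm (g x)" for n
        proof (rule AE_I2)
          fix x
          have "norm (?\<beta> n x * g x) = norm (?\<beta> n x) * norm (g x)" by (rule norm_mult)
          also have "\<dots> \<le> norm (g x)"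
            using bounds[of n x] by (intro mult_left_le_one_le norm_ge_zero) (simp only: real_norm_def abs_of_nonneg)
          finally show "norm (?\<beta> n x * g x) \<le> norm (g x)" .
        qed
        show "(\<lambda>x. ?\<beta> n x * g x) \<in> borel_measurable lborel" for n
          using borel_measurable_times[OF m[of n], of g] g by simp
      qed measurable
      moreover have "(LINT x|lborel. ?\<beta> n x * g x) = 0" for n
      proof -
        have t: "?\<beta> n \<in> test_functions S"
          by (rule test_functionsI[OF _ compact_cbox ab z])
            (intro C_k_mult test_functions_C_k[OF box_bump_in_test_functions[OF subset_refl]])
        have "(LINT x|lborel. ?\<beta> n x * g x) = (LINT x|lebesgue. ?\<beta> n x * g x)"
          using borel_measurable_times[OF m[of n], of g] g by (intro integral_completion[symmetric]) simp
        also have "\<dots> = (LINT x|lebesgue. indicator S x *\<^sub>R (F x * ?\<beta> n x))"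
        proof (rule integral_cong_AE)
          show "AE x in lebesgue. ?\<beta> n x * g x = indicator S x *\<^sub>R (F x * ?\<beta> n x)"
            using fg
          proof eventually_elim
            case (elim x)
            then show ?case using z[of x n] ab by (cases "x \<in> cbox a b") auto
          qed
          show "(\<lambda>x. ?\<beta> n x * g x) \<in> borel_measurable lebesgue"
            using borel_measurable_times[OF m[of n], of g] g by (intro measurable_completion) simp
          have "(\<lambda>x. indicator S x *\<^sub>R (F x * ?\<beta> n x)) = (\<lambda>x. ?f x * ?\<beta> n x)"
            using z ab by (auto simp: indicator_def fun_eq_iff)
          moreover have "?\<beta> n \<in> borel_measurable lebesgue" using m by (intro measurable_completion) simp
          ultimately show "(\<lambda>x. indicator S x *\<^sub>R (F x * ?\<beta> n x)) \<in> borel_measurable lebesgue"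
            using borel_measurable_times[OF borel_measurable_integrable[OF f]] by simp
        qed
        also have "\<dots> = (LINT x|lebesgue_on S. F x * ?\<beta> n x)"
          using S by (intro integral_restrict_space[symmetric]) auto
        also have "\<dots> = 0" using t by (rule 0)
        finally show ?thesis .
      qed
      ultimately have "(LINT x|lborel. (indicator (box a b) x * indicator (box c d) x) * g x) = 0"
        by (simp add: LIMSEQ_const_iff)
      moreover have "(LINT x|lborel. indicator (box c d) x * g x) = (LINT x|lborel. (indicator (box a b) x * indicator (box c d) x) * g x)"
      proof (rule integral_cong_AE)
        show "AE x in lborel. indicator (box c d) x * g x = (indicator (box a b) x * indicator (box c d) x) * g x"
          using gb by eventually_elim (auto simp: indicator_def)
      qed measurable
      ultimately show ?thesis by simp
    qed
    then have "AE x in lborel. g x = 0" by (rule AE_eq_0_if_box_integrals_eq_0[OF ig])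
    then have "AE x in lebesgue. g x = 0" by (rule AE_completion)
    with fg show ?thesis by eventually_elim auto
  qed
  obtain D where D: "countable D" "D \<subseteq> Pow S" "\<And>X. X \<in> D \<Longrightarrow> \<exists>a b. X = cbox a b" "\<Union>D = S"
    using open_countable_Union_open_cbox[OF S] by metis
  have "AE x in lebesgue. \<forall>X\<in>D. x \<in> X \<longrightarrow> F x = 0"
  proof (rule AE_ball_countable[OF D(1), THEN iffD2], rule ballI)
    fix X assume X: "X \<in> D"
    then obtain a b where "X = cbox a b" "cbox a b \<subseteq> S" using D(2,3) by blast
    then show "AE x in lebesgue. x \<in> X \<longrightarrow> F x = 0" using cb by simp
  qed
  then have "AE x in lebesgue. x \<in> S \<longrightarrow> F x = 0"
    by eventually_elim (use D(4) in auto)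
  then show ?thesis using S by (subst AE_restrict_space_iff) auto
qed

text \<open>Completeness of Lebesgue measure. It supplies measurability for representatives picked
  by \<open>SOME\<close>, which are only known up to null sets.\<close>

lemma borel_measurable_lebesgue_on_AE:
  fixes f :: "'a::euclidean_space \<Rightarrow> 'b::euclidean_space"
  assumes S: "S \<in> sets lebesgue" and f: "f \<in> borel_measurable (lebesgue_on S)"
    and ae: "AE x in lebesgue_on S. f x = g x"
  shows "g \<in> borel_measurable (lebesgue_on S)"
proof -
  have "(\<lambda>x. if x \<in> S then f x else 0) \<in> borel_measurable lebesgue"
    using borel_measurable_if[OF S] f by blast
  moreover have "AE x in lebesgue. (if x \<in> S then f x else 0) = (if x \<in> S then g x else 0)"
  proof -
    have "AE x in lebesgue. x \<in> S \<longrightarrow> f x = g x" using ae S by (subst (asm) AE_restrict_space_iff) auto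
    then show ?thesis by eventually_elim auto
  qed
  ultimately have "(\<lambda>x. if x \<in> S then g x else 0) \<in> borel_measurable lebesgue"
    by (rule borel_measurable_AE)
  then show ?thesis using borel_measurable_if[OF S] by blast
qed

lemma wgrad_has_weak_gradient: "has_weak_gradient S u G \<Longrightarrow> has_weak_gradient S u (wgrad S u)"
  unfolding wgrad_def by (rule someI[of "has_weak_gradient S u"])

lemma locally_integrable_inner:
  "locally_integrable S G \<Longrightarrow> locally_integrable S (\<lambda>x. G x \<bullet> i)"
  by (auto simp: locally_integrable_def)

lemma locally_integrable_diff:
  "locally_integrable S F \<Longrightarrow> locally_integrable S G \<Longrightarrow> locally_integrable S (\<lambda>x. F x - G x)"
  by (auto simp: locally_integrable_def)

lemma integrable_locally_integrable_mult_test: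
  assumes S: "open S" and F: "locally_integrable S F" and \<phi>: "\<phi> \<in> test_functions S"
  shows "integrable (lebesgue_on S) (\<lambda>x. F x * \<phi> x)"
proof -
  obtain K where K: "compact K" "K \<subseteq> S" "\<And>x. x \<notin> K \<Longrightarrow> \<phi> x = 0" using test_functionsE[OF \<phi>] by blast
  have c: "continuous_on UNIV \<phi>" using \<phi> by (rule test_functions_continuous_on)
  obtain B where B: "\<And>x. norm (\<phi> x) \<le> B" using bounded_compact_support[OF c K(1,3)] by blast
  have m: "K \<in> sets lebesgue" using K(1) by (simp add: borel_compact)
  have "integrable (lebesgue_on K) F" using F K by (auto simp: locally_integrable_def)
  then have iF: "integrable lebesgue (\<lambda>x. indicator K x * F x)"
    using m by (subst (asm) integrable_restrict_space) auto
  have "\<phi> \<in> borel_measurable lebesgue"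
    using borel_measurable_continuous_onI[OF c] by (intro measurable_completion) simp
  then have "integrable lebesgue (\<lambda>x. (indicator K x * F x) * \<phi> x)"
    using iF B by (intro Bochner_Integration.integrable_bound[OF integrable_mult_left[OF iF, of B]])
      (auto simp: abs_mult intro!: AE_I2 mult_left_mono intro: order_trans[OF _ abs_ge_self])
  also have "(\<lambda>x. (indicator K x * F x) * \<phi> x) = (\<lambda>x. indicator S x *\<^sub>R (F x * \<phi> x))"
    using K by (auto simp: indicator_def fun_eq_iff)
  finally show ?thesis using S by (subst integrable_restrict_space) auto
qed

text \<open>The fundamental lemma, applied to each component of the difference. It makes the
  arbitrary choice in \<open>wgrad\<close> harmless.\<close>

lemma weak_gradient_unique:
  assumes S: "open S" and G: "has_weak_gradient S u G" "has_weak_gradient S u G'"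
  shows "AE x in lebesgue_on S. G x = G' x"
proof -
  have "AE x in lebesgue_on S. (G x - G' x) \<bullet> i = 0" if i: "i \<in> Basis" for i
  proof (rule AE_eq_0_if_weakly_0[OF S])
    have l: "locally_integrable S G" "locally_integrable S G'" using G by (auto simp: has_weak_gradient_def)
    then show "locally_integrable S (\<lambda>x. (G x - G' x) \<bullet> i)"
      by (intro locally_integrable_inner locally_integrable_diff)
    fix \<phi> assume \<phi>: "\<phi> \<in> test_functions S"
    have "(LINT x|lebesgue_on S. (G x \<bullet> i) * \<phi> x) = (LINT x|lebesgue_on S. (G' x \<bullet> i) * \<phi> x)"
      using G \<phi> i by (auto simp: has_weak_gradient_def)
    then show "(LINT x|lebesgue_on S. ((G x - G' x) \<bullet> i) * \<phi> x) = 0"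
      using integrable_locally_integrable_mult_test[OF S locally_integrable_inner[OF l(1)] \<phi>, of i]
        integrable_locally_integrable_mult_test[OF S locally_integrable_inner[OF l(2)] \<phi>, of i]
      by (simp add: inner_diff_left left_diff_distrib)
  qed
  then have "AE x in lebesgue_on S. \<forall>i\<in>Basis. (G x - G' x) \<bullet> i = 0"
    by (intro AE_finite_allI) auto
  then show ?thesis by eventually_elim (auto simp: euclidean_eq_iff[of "G _"] inner_diff_left)
qed

lemma wgrad_AE_eq:
  "open S \<Longrightarrow> has_weak_gradient S u G \<Longrightarrow> AE x in lebesgue_on S. wgrad S u x = G x"
  using weak_gradient_unique wgrad_has_weak_gradient by blast

section \<open>Weak gradients and \<open>H10\<close> on a bounded open set\<close>

context
  fixes S :: "'a::euclidean_space set"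
  assumes op: "open S" and bd: "bounded S"
begin

lemma lmeasurable_domain: "S \<in> lmeasurable"
  using op bd by (intro bounded_set_imp_lmeasurable) auto

lemma sets_lebesgue_domain: "S \<in> sets lebesgue"
  using op by auto

lemma L2_locally_integrable:
  fixes u :: "'a \<Rightarrow> 'b::euclidean_space"
  assumes "u \<in> L2 S" shows "locally_integrable S u"
  unfolding locally_integrable_def
proof (intro allI impI)
  fix K assume K: "compact K \<and> K \<subseteq> S"
  have "integrable (lebesgue_on S) u" by (rule L2_integrable[OF lmeasurable_domain assms])
  then have "set_integrable lebesgue S u"
    using sets_lebesgue_domain by (subst (asm) integrable_restrict_space) (auto simp: set_integrable_def)
  then have "set_integrable lebesgue K u"
    using K by (intro set_integrable_subset[of _ S u K]) (auto simp: borel_compact)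
  then show "integrable (lebesgue_on K) u"
    using K by (subst integrable_restrict_space) (auto simp: set_integrable_def borel_compact)
qed

lemma L2_continuous_compact_support:
  fixes f :: "'a \<Rightarrow> 'b::euclidean_space"
  assumes "continuous_on UNIV f" "compact K" "\<And>x. x \<notin> K \<Longrightarrow> f x = 0"
  shows "f \<in> L2 S"
proof -
  obtain B where "\<And>x. norm (f x) \<le> B" using bounded_compact_support[OF assms] by blast
  then show ?thesis
    using assms(1) sets_lebesgue_domain
    by (intro L2_bounded[OF lmeasurable_domain, where c = B] continuous_imp_measurable_on_sets_lebesgue)
      (auto intro: continuous_on_subset)
qed

lemma
  assumes "\<phi> \<in> test_functions S"
  shows test_functions_L2: "\<phi> \<in> L2 S" and test_functions_grad_L2: "grad \<phi> \<in> L2 S"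
proof -
  obtain K where K: "compact K" "K \<subseteq> S" "\<And>x. x \<notin> K \<Longrightarrow> \<phi> x = 0" using test_functionsE[OF assms] by blast
  show "\<phi> \<in> L2 S"
    using assms K by (intro L2_continuous_compact_support[of _ K] test_functions_continuous_on) auto
  have "grad \<phi> x = 0" if "x \<notin> K" for x
    using grad_eq_0_outside_closed[OF test_functions_C_k[OF assms, of "Suc 0"] compact_imp_closed[OF K(1)] K(3) that] .
  then show "grad \<phi> \<in> L2 S"
    using assms K by (intro L2_continuous_compact_support[of _ K] test_functions_continuous_on_grad) auto
qed

lemma LINT_grad_test:
  assumes f: "C_k (Suc 0) f" and K: "compact K" "K \<subseteq> S" "\<And>x. x \<notin> K \<Longrightarrow> f x = 0"
  shows "(LINT x|lebesgue_on S. grad f x \<bullet> v) = 0"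
proof -
  have "grad f x = 0" if "x \<notin> S" for x
    using grad_eq_0_outside_closed[OF f compact_imp_closed[OF K(1)] K(3), of x] that K(2) by blast
  then have "(LINT x|lebesgue_on S. grad f x \<bullet> v) = (LINT x|lborel. grad f x \<bullet> v)"
    using continuous_on_grad[OF f, of UNIV]
    by (intro LINT_lebesgue_on_eq_lborel sets_lebesgue_domain) (auto intro!: borel_measurable_continuous_onI continuous_intros)
  also have "\<dots> = 0" by (rule LINT_grad_compact_support[OF f K(1,3)])
  finally show ?thesis .
qed

text \<open>Integration by parts: the gradient of the product of two test functions has integral
  zero.\<close>

lemma test_functions_has_weak_gradient:
  assumes \<phi>: "\<phi> \<in> test_functions S"
  shows "has_weak_gradient S \<phi> (grad \<phi>)"
  unfolding has_weak_gradient_iff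
proof (intro conjI ballI L2_locally_integrable test_functions_L2 test_functions_grad_L2 \<phi>)
  fix \<psi> i assume \<psi>: "\<psi> \<in> test_functions S" and i: "i \<in> (Basis :: 'a set)"
  note C = test_functions_C_k[OF \<phi>] test_functions_C_k[OF \<psi>]
  obtain K where K: "compact K" "K \<subseteq> S" "\<And>x. x \<notin> K \<Longrightarrow> \<psi> x = 0" using test_functionsE[OF \<psi>] by blast
  have "(LINT x|lebesgue_on S. grad (\<lambda>x. \<phi> x * \<psi> x) x \<bullet> i) = 0"
    using K by (intro LINT_grad_test[of _ K] C_k_mult C) auto
  also have "(\<lambda>x. grad (\<lambda>x. \<phi> x * \<psi> x) x \<bullet> i) = (\<lambda>x. \<phi> x * (grad \<psi> x \<bullet> i) + (grad \<phi> x \<bullet> i) * \<psi> x)"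
    using grad_mult[OF C[of "Suc 0"]] by (simp add: inner_add_left fun_eq_iff)
  also have "(LINT x|lebesgue_on S. \<dots> x) = (LINT x|lebesgue_on S. \<phi> x * (grad \<psi> x \<bullet> i)) + (LINT x|lebesgue_on S. (grad \<phi> x \<bullet> i) * \<psi> x)"
    by (intro Bochner_Integration.integral_add L2_mult_integrable L2_component test_functions_L2 test_functions_grad_L2 \<phi> \<psi>)
  finally show "(LINT x|lebesgue_on S. \<phi> x * (grad \<psi> x \<bullet> i)) = - (LINT x|lebesgue_on S. (grad \<phi> x \<bullet> i) * \<psi> x)"
    by simp
qed

lemma L2_tendsto_component:
  assumes "L2_tendsto S u l" "\<And>n. u n \<in> L2 S" "l \<in> L2 S"
  shows "L2_tendsto S (\<lambda>n x. u n x \<bullet> w) (\<lambda>x. l x \<bullet> w)"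
proof (rule L2_tendsto_bound[OF assms])
  show "AE x in lebesgue_on S. norm (u n x \<bullet> w - l x \<bullet> w) \<le> norm w * norm (u n x - l x)" for n
    using Cauchy_Schwarz_ineq2[of "u n _ - l _" w] by (auto simp: inner_diff_left mult.commute intro!: AE_I2)
  show "(\<lambda>x. u n x \<bullet> w) \<in> borel_measurable (lebesgue_on S)" for n
    using assms(2)[THEN L2_measurable] by measurable
  show "(\<lambda>x. l x \<bullet> w) \<in> borel_measurable (lebesgue_on S)"
    using assms(3)[THEN L2_measurable] by measurable
qed

text \<open>Both sides of the defining identity pair the sequence with a fixed square integrable
  function, so they pass to the limit.\<close>

lemma has_weak_gradient_L2_limit:
  assumes u: "\<And>n. u n \<in> L2 S" "l \<in> L2 S" "L2_tendsto S u l"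
    and G: "\<And>n. G n \<in> L2 S" "H \<in> L2 S" "L2_tendsto S G H"
    and weak: "\<And>n. has_weak_gradient S (u n) (G n)"
  shows "has_weak_gradient S l H"
  unfolding has_weak_gradient_iff
proof (intro conjI ballI L2_locally_integrable u G)
  fix \<psi> i assume \<psi>: "\<psi> \<in> test_functions S" and i: "i \<in> (Basis :: 'a set)"
  have "(\<lambda>n. LINT x|lebesgue_on S. u n x \<bullet> (grad \<psi> x \<bullet> i)) \<longlonglongrightarrow> (LINT x|lebesgue_on S. l x \<bullet> (grad \<psi> x \<bullet> i))"
    by (intro L2_tendsto_inner L2_tendsto_const u L2_component test_functions_grad_L2 \<psi>)
  moreover have "(\<lambda>n. LINT x|lebesgue_on S. (G n x \<bullet> i) \<bullet> \<psi> x) \<longlonglongrightarrow> (LINT x|lebesgue_on S. (H x \<bullet> i) \<bullet> \<psi> x)"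
    by (intro L2_tendsto_inner L2_tendsto_const L2_tendsto_component G L2_component test_functions_L2 \<psi>)
  then have "(\<lambda>n. - (LINT x|lebesgue_on S. (G n x \<bullet> i) \<bullet> \<psi> x)) \<longlonglongrightarrow> - (LINT x|lebesgue_on S. (H x \<bullet> i) \<bullet> \<psi> x)"
    by (rule tendsto_minus)
  moreover have "(LINT x|lebesgue_on S. u n x * (grad \<psi> x \<bullet> i)) = - (LINT x|lebesgue_on S. (G n x \<bullet> i) * \<psi> x)" for n
    using weak[of n] \<psi> i unfolding has_weak_gradient_iff by blast
  ultimately show "(LINT x|lebesgue_on S. l x * (grad \<psi> x \<bullet> i)) = - (LINT x|lebesgue_on S. (H x \<bullet> i) * \<psi> x)"
    by (simp add: LIMSEQ_unique)
qed

text \<open>The definition yields some square integrable weak gradient. Uniqueness transfers this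
  property to the chosen one, \<open>wgrad S u\<close>.\<close>

lemma H10E:
  assumes "u \<in> H10 S"
  obtains \<phi> where "u \<in> L2 S" "wgrad S u \<in> L2 S" "has_weak_gradient S u (wgrad S u)"
    "\<And>n. \<phi> n \<in> test_functions S" "L2_tendsto S \<phi> u" "L2_tendsto S (\<lambda>n. grad (\<phi> n)) (wgrad S u)"
proof -
  from assms obtain G \<phi> where u: "u \<in> L2 S" and G: "G \<in> L2 S" "has_weak_gradient S u G"
    and \<phi>: "\<And>n. \<phi> n \<in> test_functions S" "L2_tendsto S \<phi> u" "L2_tendsto S (\<lambda>n. grad (\<phi> n)) (wgrad S u)"
    by (auto simp: H10_def H1_def L2_tendsto_def)
  have w: "has_weak_gradient S u (wgrad S u)" using G(2) by (rule wgrad_has_weak_gradient)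
  have ae: "AE x in lebesgue_on S. wgrad S u x = G x" using op G(2) by (rule wgrad_AE_eq)
  have "wgrad S u \<in> borel_measurable (lebesgue_on S)"
    by (rule borel_measurable_lebesgue_on_AE[OF sets_lebesgue_domain L2_measurable[OF G(1)]])
      (use ae in \<open>eventually_elim, simp\<close>)
  then have "wgrad S u \<in> L2 S"
    by (rule L2_bound[OF G(1), where c = 1]) (use ae in \<open>eventually_elim, simp\<close>)
  with u w \<phi> that show ?thesis by blast
qed

text \<open>The limit \<open>G\<close> is itself a weak gradient, hence agrees with
  \<open>wgrad S u\<close> almost everywhere. Membership can thus be shown with an explicit
  candidate for the gradient.\<close>

lemma H10I:
  assumes \<phi>: "\<And>n. \<phi> n \<in> test_functions S" and u: "u \<in> L2 S" and G: "G \<in> L2 S"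
    and lim: "L2_tendsto S \<phi> u" "L2_tendsto S (\<lambda>n. grad (\<phi> n)) G"
  shows "u \<in> H10 S" "AE x in lebesgue_on S. wgrad S u x = G x"
proof -
  have w: "has_weak_gradient S u G"
    by (rule has_weak_gradient_L2_limit[OF _ u lim(1) _ G lim(2)])
      (intro test_functions_L2 test_functions_grad_L2 test_functions_has_weak_gradient \<phi>)+
  then show ae: "AE x in lebesgue_on S. wgrad S u x = G x" by (rule wgrad_AE_eq[OF op])
  have "(LINT x|lebesgue_on S. (norm (grad (\<phi> n) x - wgrad S u x))\<^sup>2)
      = (LINT x|lebesgue_on S. (norm (grad (\<phi> n) x - G x))\<^sup>2)" for n
    using ae L2_measurable[OF test_functions_grad_L2[OF \<phi>[of n]]] L2_measurable[OF G]
      borel_measurable_lebesgue_on_AE[OF sets_lebesgue_domain L2_measurable[OF G], of "wgrad S u"]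
    by (intro integral_cong_AE) (auto simp: eq_commute)
  then show "u \<in> H10 S"
    using u G w \<phi> lim by (auto simp: H10_def H1_def L2_tendsto_def intro!: exI[of _ \<phi>])
qed

end

section \<open>Admissible competitors\<close>

lemma borel_measurable_ramp [measurable]: "ramp \<in> borel_measurable borel"
  by (intro borel_measurable_continuous_onI continuous_on_ramp continuous_on_id)

lemma borel_measurable_ramp' [measurable]: "ramp' \<in> borel_measurable borel"
  by (intro borel_measurable_continuous_onI continuous_on_ramp' continuous_on_id)

lemma ramp_gap_lipschitz: "\<bar>ramp (c - a - m) - ramp (c - b - m)\<bar> \<le> \<bar>a - b\<bar>"
proof -
  have "(c - a - m) - (c - b - m) = - (a - b)" by simp
  then show ?thesis using ramp_lipschitz[of "c - a - m" "c - b - m"] by (simp only: abs_minus_cancel)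
qed

context
  fixes S :: "'a::euclidean_space set"
  assumes op: "open S" and bd: "bounded S"
begin

context
  fixes u g :: "'a \<Rightarrow> real" and m C :: real
  assumes u: "u \<in> H10 S" and uC: "AE x in lebesgue_on S. norm (wgrad S u x) \<le> C"
    and g: "g \<in> test_functions S" and m: "m \<ge> 0"
begin

lemma ramp_gap_L2:
  assumes "w \<in> L2 S" shows "(\<lambda>x. ramp (g x - w x - m)) \<in> L2 S"
proof (rule L2_bound[where g = "\<lambda>x. g x - w x" and c = 1])
  note g2 = test_functions_L2[OF op bd g]
  show "(\<lambda>x. g x - w x) \<in> L2 S" by (intro L2_diff g2 assms)
  show "(\<lambda>x. ramp (g x - w x - m)) \<in> borel_measurable (lebesgue_on S)"
    using L2_measurable[OF g2] L2_measurable[OF assms] by measurable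
  have "\<bar>ramp (s - m)\<bar> \<le> \<bar>s\<bar>" for s
    using ramp_le[of "s - m"] ramp_nonneg[of "s - m"] m by linarith
  then show "AE x in lebesgue_on S. norm (ramp (g x - w x - m)) \<le> 1 * norm (g x - w x)" by simp
qed

lemma C_k_gap: "w \<in> test_functions S \<Longrightarrow> C_k k (\<lambda>x. g x - w x - m)"
  by (intro C_k_diff C_k_const test_functions_C_k[OF g] test_functions_C_k[of w])

text \<open>Outside both supports the gap equals \<open>- m\<close>, so \<open>m \<ge> 0\<close>
  makes every function of it that vanishes on the negative half-line compactly supported in
  \<open>S\<close>.\<close>

lemma gap_support:
  assumes "w \<in> test_functions S"
  obtains K where "compact K" "K \<subseteq> S" "\<And>x. x \<notin> K \<Longrightarrow> w x = 0" "\<And>x. x \<notin> K \<Longrightarrow> g x - w x - m \<le> 0"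
proof -
  obtain K where K: "compact K" "K \<subseteq> S" "\<And>x. x \<notin> K \<Longrightarrow> w x = 0" using test_functionsE[OF assms] by blast
  obtain L where L: "compact L" "L \<subseteq> S" "\<And>x. x \<notin> L \<Longrightarrow> g x = 0" using test_functionsE[OF g] by blast
  show ?thesis
    by (rule that[of "K \<union> L"]) (use K L m in auto)
qed

lemma ramp_gap_test:
  assumes "w \<in> test_functions S"
  shows "(\<lambda>x. w x + ramp (g x - w x - m)) \<in> test_functions S"
    and "grad (\<lambda>x. w x + ramp (g x - w x - m)) x
      = grad w x + ramp' (g x - w x - m) *\<^sub>R (grad g x - grad w x)"
proof -
  obtain K where K: "compact K" "K \<subseteq> S" "\<And>x. x \<notin> K \<Longrightarrow> w x = 0" "\<And>x. x \<notin> K \<Longrightarrow> g x - w x - m \<le> 0"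
    using gap_support[OF assms] by blast
  have w: "C_k k w" and r: "C_k k (\<lambda>x. ramp (g x - w x - m))" for k
    using assms by (intro C_k_ramp C_k_gap test_functions_C_k[of w] | assumption)+
  show "(\<lambda>x. w x + ramp (g x - w x - m)) \<in> test_functions S"
    by (rule test_functionsI[of _ K]) (use K w r in \<open>auto intro!: C_k_add ramp_nonpos_arg\<close>)
  have "grad (\<lambda>x. w x + ramp (g x - w x - m)) x = grad w x + grad (\<lambda>x. ramp (g x - w x - m)) x"
    by (rule grad_add[of 0, OF w r])
  also have "grad (\<lambda>x. ramp (g x - w x - m)) x = ramp' (g x - w x - m) *\<^sub>R grad (\<lambda>x. g x - w x - m) x"
    by (rule grad_chain[of 0, OF C_k_gap[OF assms] ramp_has_derivative])
  also have "grad (\<lambda>x. g x - w x - m) x = grad g x - grad w x"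
    by (rule grad_diff[of 0, OF test_functions_C_k[OF g] w])
  finally show "grad (\<lambda>x. w x + ramp (g x - w x - m)) x
      = grad w x + ramp' (g x - w x - m) *\<^sub>R (grad g x - grad w x)" .
qed

text \<open>Test functions approximating \<open>u\<close> are modified by the same formula and obey
  the ordinary chain rule. The difference between their gradients and \<open>?G\<close> splits into
  a part with factor \<open>1 - ?s n\<close>, controlled by the convergence of gradients, and a part
  with factor \<open>?s n - ?r\<close>, controlled by the convergence of functions.\<close>

lemma
  shows ramp_competitor_H10: "(\<lambda>x. u x + ramp (g x - u x - m)) \<in> H10 S" (is ?H10)
    and wgrad_ramp_competitor: "AE x in lebesgue_on S. wgrad S (\<lambda>x. u x + ramp (g x - u x - m)) x
      = wgrad S u x + ramp' (g x - u x - m) *\<^sub>R (grad g x - wgrad S u x)" (is ?W)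
proof -
  obtain \<phi> where u2: "u \<in> L2 S" and wu2: "wgrad S u \<in> L2 S"
    and \<phi>: "\<And>n. \<phi> n \<in> test_functions S" and lim: "L2_tendsto S \<phi> u" "L2_tendsto S (\<lambda>n. grad (\<phi> n)) (wgrad S u)"
    using H10E[OF op bd u] by blast
  note \<phi>2 = test_functions_L2[OF op bd \<phi>] and g\<phi>2 = test_functions_grad_L2[OF op bd \<phi>]
    and g2 = test_functions_L2[OF op bd g] and gg2 = test_functions_grad_L2[OF op bd g]
  note [measurable] = L2_measurable[OF u2] L2_measurable[OF wu2] L2_measurable[OF \<phi>2] L2_measurable[OF g\<phi>2]
    L2_measurable[OF g2] L2_measurable[OF gg2]
  obtain L where L: "compact L" "\<And>x. x \<notin> L \<Longrightarrow> g x = 0" using test_functionsE[OF g] by metis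
  have "grad g x = 0" if "x \<notin> L" for x
    using grad_eq_0_outside_closed[OF test_functions_C_k[OF g, of "Suc 0"] compact_imp_closed[OF L(1)] L(2) that] .
  then obtain B where B: "\<And>x. norm (grad g x) \<le> B"
    using bounded_compact_support[OF test_functions_continuous_on_grad[OF g] L(1)] by metis
  let ?v = "\<lambda>x. u x + ramp (g x - u x - m)" and ?\<psi> = "\<lambda>n x. \<phi> n x + ramp (g x - \<phi> n x - m)"
  let ?r = "\<lambda>x. ramp' (g x - u x - m)" and ?s = "\<lambda>n x. ramp' (g x - \<phi> n x - m)"
  let ?G = "\<lambda>x. wgrad S u x + ?r x *\<^sub>R (grad g x - wgrad S u x)"
  let ?H = "\<lambda>n x. grad (\<phi> n) x + ?s n x *\<^sub>R (grad g x - grad (\<phi> n) x)"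
  have r1: "\<bar>ramp' s\<bar> \<le> 1" for s using ramp'_nonneg ramp'_le_1 by simp
  have v2: "?v \<in> L2 S" by (intro L2_add u2 ramp_gap_L2)
  have G2: "?G \<in> L2 S"
    by (intro L2_add wu2 L2_bounded_scaleR[where c = 1] L2_diff gg2 r1) measurable
  have conv_v: "L2_tendsto S ?\<psi> ?v"
  proof (rule L2_tendsto_bound[OF lim(1) \<phi>2 u2])
    have "\<bar>(a + ramp (c - a - m)) - (b + ramp (c - b - m))\<bar> \<le> 2 * \<bar>a - b\<bar>" for a b c
      using ramp_gap_lipschitz[of c a m b] abs_triangle_ineq[of "a - b" "ramp (c - a - m) - ramp (c - b - m)"]
      by (simp add: algebra_simps)
    then show "AE x in lebesgue_on S. norm (?\<psi> n x - ?v x) \<le> 2 * norm (\<phi> n x - u x)" for n by simp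
  qed measurable
  have conv1: "L2_tendsto S (\<lambda>n x. (1 - ?s n x) *\<^sub>R (grad (\<phi> n) x - wgrad S u x)) (\<lambda>_. 0)"
  proof (rule L2_tendsto_bound[OF lim(2) g\<phi>2 wu2])
    show "AE x in lebesgue_on S. norm ((1 - ?s n x) *\<^sub>R (grad (\<phi> n) x - wgrad S u x) - 0)
        \<le> 1 * norm (grad (\<phi> n) x - wgrad S u x)" for n
      using ramp'_nonneg ramp'_le_1 by (auto intro!: AE_I2 mult_left_le_one_le)
  qed measurable
  \<comment> \<open>The bound \<open>uC\<close> is essential here: with a bounded factor
    \<open>grad g - wgrad S u\<close>, the Lipschitz slope gives an L2 estimate by
    \<open>\<phi> n - u\<close>.\<close>
  have conv2: "L2_tendsto S (\<lambda>n x. (?s n x - ?r x) *\<^sub>R (grad g x - wgrad S u x)) (\<lambda>_. 0)"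
  proof (rule L2_tendsto_bound[OF lim(1) \<phi>2 u2])
    show "AE x in lebesgue_on S. norm ((?s n x - ?r x) *\<^sub>R (grad g x - wgrad S u x) - 0)
        \<le> (12 * (B + C)) * norm (\<phi> n x - u x)" for n
      using uC
    proof eventually_elim
      case (elim x)
      have "norm (grad g x - wgrad S u x) \<le> B + C"
        using norm_triangle_ineq4[of "grad g x" "wgrad S u x"] B[of x] elim by linarith
      moreover have "\<bar>?s n x - ?r x\<bar> \<le> 12 * \<bar>\<phi> n x - u x\<bar>"
        using ramp'_lipschitz[of "g x - \<phi> n x - m" "g x - u x - m"] by (simp add: abs_minus_commute)
      ultimately have "\<bar>?s n x - ?r x\<bar> * norm (grad g x - wgrad S u x) \<le> (12 * \<bar>\<phi> n x - u x\<bar>) * (B + C)"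
        by (intro mult_mono) auto
      also have "\<dots> = (12 * (B + C)) * \<bar>\<phi> n x - u x\<bar>" by (simp only: mult_ac)
      finally show ?case by simp
    qed
  qed measurable
  have "L2_tendsto S (\<lambda>n x. (1 - ?s n x) *\<^sub>R (grad (\<phi> n) x - wgrad S u x)
      + (?s n x - ?r x) *\<^sub>R (grad g x - wgrad S u x)) (\<lambda>x. 0 + 0)"
  proof (rule L2_tendsto_add[OF conv1 conv2])
    show "(\<lambda>x. (1 - ?s n x) *\<^sub>R (grad (\<phi> n) x - wgrad S u x)) \<in> L2 S" for n
      using ramp'_nonneg ramp'_le_1
      by (intro L2_bounded_scaleR[where c = 1] L2_diff g\<phi>2 wu2) auto
    show "(\<lambda>x. (?s n x - ?r x) *\<^sub>R (grad g x - wgrad S u x)) \<in> L2 S" for n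
    proof (intro L2_bounded_scaleR[where c = 1] L2_diff gg2 wu2)
      show "\<bar>?s n x - ?r x\<bar> \<le> 1" for x
        using ramp'_nonneg[of "g x - u x - m"] ramp'_le_1[of "g x - u x - m"]
          ramp'_nonneg[of "g x - \<phi> n x - m"] ramp'_le_1[of "g x - \<phi> n x - m"] by linarith
    qed measurable
  qed (simp_all add: L2_def)
  also have "(\<lambda>n x. (1 - ?s n x) *\<^sub>R (grad (\<phi> n) x - wgrad S u x) + (?s n x - ?r x) *\<^sub>R (grad g x - wgrad S u x))
      = (\<lambda>n x. ?H n x - ?G x)"
    by (simp add: fun_eq_iff algebra_simps)
  finally have "L2_tendsto S ?H ?G" by (simp add: L2_tendsto_def)
  moreover have "(\<lambda>n. grad (?\<psi> n)) = ?H" by (intro ext ramp_gap_test(2) \<phi>)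
  ultimately have "L2_tendsto S (\<lambda>n. grad (?\<psi> n)) ?G" by simp
  from H10I[OF op bd ramp_gap_test(1)[OF \<phi>] v2 G2 conv_v this] show ?H10 ?W .
qed

text \<open>Transport terms cancel because \<open>ramp (g - u - m) (\<nabla>g - \<nabla>u)\<close> is the gradient of
  \<open>ramp_int (g - u - m)\<close>, which vanishes near the boundary.\<close>

lemma LINT_transport_ramp:
  "(LINT x|lebesgue_on S. (b \<bullet> wgrad S u x) * ramp (g x - u x - m))
    = (LINT x|lebesgue_on S. (b \<bullet> grad g x) * ramp (g x - u x - m))"
proof -
  obtain \<phi> where u2: "u \<in> L2 S" and wu2: "wgrad S u \<in> L2 S"
    and \<phi>: "\<And>n. \<phi> n \<in> test_functions S" and lim: "L2_tendsto S \<phi> u" "L2_tendsto S (\<lambda>n. grad (\<phi> n)) (wgrad S u)"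
    using H10E[OF op bd u] by blast
  note \<phi>2 = test_functions_L2[OF op bd \<phi>] and g\<phi>2 = test_functions_grad_L2[OF op bd \<phi>]
    and g2 = test_functions_L2[OF op bd g] and gg2 = test_functions_grad_L2[OF op bd g]
  note [measurable] = L2_measurable[OF u2] L2_measurable[OF wu2] L2_measurable[OF \<phi>2] L2_measurable[OF g\<phi>2]
    L2_measurable[OF g2] L2_measurable[OF gg2]
  have "L2_tendsto S (\<lambda>n x. grad g x - grad (\<phi> n) x) (\<lambda>x. grad g x - wgrad S u x)"
    by (rule L2_tendsto_bound[OF lim(2) g\<phi>2 wu2, where c = 1]) (auto simp: norm_minus_commute)
  then have A: "L2_tendsto S (\<lambda>n x. (grad g x - grad (\<phi> n) x) \<bullet> b) (\<lambda>x. (grad g x - wgrad S u x) \<bullet> b)"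
    by (intro L2_tendsto_component[OF op bd] L2_diff gg2 g\<phi>2 wu2)
  have B: "L2_tendsto S (\<lambda>n x. ramp (g x - \<phi> n x - m)) (\<lambda>x. ramp (g x - u x - m))"
  proof (rule L2_tendsto_bound[OF lim(1) \<phi>2 u2])
    show "AE x in lebesgue_on S. norm (ramp (g x - \<phi> n x - m) - ramp (g x - u x - m)) \<le> 1 * norm (\<phi> n x - u x)" for n
      using ramp_gap_lipschitz by simp
  qed measurable
  have "(\<lambda>n. LINT x|lebesgue_on S. ((grad g x - grad (\<phi> n) x) \<bullet> b) \<bullet> ramp (g x - \<phi> n x - m))
      \<longlonglongrightarrow> (LINT x|lebesgue_on S. ((grad g x - wgrad S u x) \<bullet> b) \<bullet> ramp (g x - u x - m))"
    by (intro L2_tendsto_inner A B L2_component L2_diff gg2 g\<phi>2 wu2 ramp_gap_L2 \<phi>2 u2)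
  moreover have "(LINT x|lebesgue_on S. ((grad g x - grad (\<phi> n) x) \<bullet> b) \<bullet> ramp (g x - \<phi> n x - m)) = 0" for n
  proof -
    obtain K where K: "compact K" "K \<subseteq> S" "\<And>x. x \<notin> K \<Longrightarrow> g x - \<phi> n x - m \<le> 0"
      using gap_support[OF \<phi>[of n]] by metis
    have "grad (\<lambda>x. ramp_int (g x - \<phi> n x - m)) x \<bullet> b = ((grad g x - grad (\<phi> n) x) \<bullet> b) \<bullet> ramp (g x - \<phi> n x - m)" for x
      using grad_chain[of 0, OF C_k_gap[OF \<phi>[of n]] ramp_int_has_derivative, of x]
        grad_diff[of 0, OF test_functions_C_k[OF g] test_functions_C_k[OF \<phi>[of n]], of m x] by simp
    moreover have "(LINT x|lebesgue_on S. grad (\<lambda>x. ramp_int (g x - \<phi> n x - m)) x \<bullet> b) = 0"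
      by (rule LINT_grad_test[OF op bd C_k_ramp_int[OF C_k_gap[OF \<phi>[of n]]] K(1,2)]) (use K(3) ramp_int_nonpos_arg in auto)
    ultimately show ?thesis by simp
  qed
  ultimately have "(LINT x|lebesgue_on S. ((grad g x - wgrad S u x) \<bullet> b) * ramp (g x - u x - m)) = 0"
    by (simp add: LIMSEQ_const_iff)
  also have "(LINT x|lebesgue_on S. ((grad g x - wgrad S u x) \<bullet> b) * ramp (g x - u x - m))
      = (LINT x|lebesgue_on S. (grad g x \<bullet> b) * ramp (g x - u x - m)) - (LINT x|lebesgue_on S. (wgrad S u x \<bullet> b) * ramp (g x - u x - m))"
    unfolding inner_diff_left left_diff_distrib
    by (intro Bochner_Integration.integral_diff L2_mult_integrable L2_component gg2 wu2 ramp_gap_L2 u2)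
  finally show ?thesis by (simp add: inner_commute)
qed

text \<open>The new gradient is a convex combination of two vectors of the closed unit ball, with
  weights \<open>1 - ramp'\<close> and \<open>ramp'\<close>.\<close>

lemma competitor_K_grad:
  assumes "u \<in> K_grad S" "\<And>x. norm (grad g x) \<le> 1"
  shows "(\<lambda>x. u x + ramp (g x - u x - m)) \<in> K_grad S"
proof -
  have "AE x in lebesgue_on S. norm (wgrad S u x) \<le> 1" using assms by (simp add: K_grad_def)
  then have "AE x in lebesgue_on S. norm (wgrad S (\<lambda>x. u x + ramp (g x - u x - m)) x) \<le> 1"
    using wgrad_ramp_competitor
  proof eventually_elim
    case (elim x)
    let ?r = "ramp' (g x - u x - m)"
    have "wgrad S u x + ?r *\<^sub>R (grad g x - wgrad S u x) = (1 - ?r) *\<^sub>R wgrad S u x + ?r *\<^sub>R grad g x"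
      by (simp add: algebra_simps)
    moreover have "norm ((1 - ?r) *\<^sub>R wgrad S u x + ?r *\<^sub>R grad g x) \<le> 1"
      using elim(1) assms(2)[of x] ramp'_nonneg ramp'_le_1
        convexD[OF convex_cball[of "0::'a" 1], of "wgrad S u x" "grad g x" "1 - ?r" ?r] by auto
    ultimately show ?case using elim(2) by simp
  qed
  then show ?thesis using ramp_competitor_H10 by (simp add: K_grad_def)
qed

text \<open>The correction is nonnegative and at most \<open>max 0 (g x - u x - m)\<close>, so the
  result stays between \<open>u\<close> and the maximum of \<open>u\<close> and
  \<open>g\<close>.\<close>

lemma competitor_K_obst:
  assumes "u \<in> K_obst S" "\<And>x. x \<in> S \<Longrightarrow> g x \<le> bdist S x"
  shows "(\<lambda>x. u x + ramp (g x - u x - m)) \<in> K_obst S"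
proof -
  have "AE x in lebesgue_on S. - bdist S x \<le> u x \<and> u x \<le> bdist S x" using assms by (simp add: K_obst_def)
  then have "AE x in lebesgue_on S. - bdist S x \<le> u x + ramp (g x - u x - m) \<and> u x + ramp (g x - u x - m) \<le> bdist S x"
    using AE_space
  proof eventually_elim
    case (elim x)
    then show ?case
      using assms(2)[of x] ramp_nonneg[of "g x - u x - m"] ramp_le[of "g x - u x - m"] m
      by (auto simp: space_restrict_space max_def split: if_splits)
  qed
  then show ?thesis using ramp_competitor_H10 by (simp add: K_obst_def)
qed

text \<open>The transport identity replaces \<open>wgrad S u\<close>, which carries no sign, by
  \<open>grad g\<close>, whose product with \<open>b\<close> is at most \<open>norm b\<close>. What
  remains of \<open>c\<close> is at least \<open>\<epsilon>\<close>.\<close>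

lemma variational_inequality_ramp:
  assumes K: "u \<in> K" "K = K_grad S \<or> K = K_obst S"
    and g1: "\<And>x. norm (grad g x) \<le> 1" and gd: "\<And>x. x \<in> S \<Longrightarrow> g x \<le> bdist S x"
    and VI: "\<forall>v\<in>K. (LINT x|lebesgue_on S. w x * (v x - u x))
             + (LINT x|lebesgue_on S. (b \<bullet> wgrad S u x) * (v x - u x))
           \<ge> (LINT x|lebesgue_on S. c * (v x - u x))"
    and c: "c \<ge> norm b + \<epsilon>"
  shows "(LINT x|lebesgue_on S. w x * ramp (g x - u x - m)) \<ge> \<epsilon> * (LINT x|lebesgue_on S. ramp (g x - u x - m))"
proof -
  let ?R = "\<lambda>x. ramp (g x - u x - m)"
  obtain \<phi> where u2: "u \<in> L2 S" using H10E[OF op bd u] by blast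
  have "(\<lambda>x. u x + ?R x) \<in> K"
    using K competitor_K_grad[OF _ g1] competitor_K_obst[OF _ gd] by blast
  from VI[rule_format, OF this]
  have 1: "(LINT x|lebesgue_on S. w x * ?R x) + (LINT x|lebesgue_on S. (b \<bullet> grad g x) * ?R x)
           \<ge> c * (LINT x|lebesgue_on S. ?R x)"
    by (simp add: LINT_transport_ramp)
  have iR: "integrable (lebesgue_on S) ?R"
    by (intro L2_integrable lmeasurable_domain[OF op bd] ramp_gap_L2 u2)
  have "(LINT x|lebesgue_on S. (b \<bullet> grad g x) * ?R x) \<le> (LINT x|lebesgue_on S. norm b * ?R x)"
  proof (rule integral_mono)
    show "integrable (lebesgue_on S) (\<lambda>x. (b \<bullet> grad g x) * ?R x)"
      using L2_mult_integrable[OF L2_component[OF test_functions_grad_L2[OF op bd g], of b] ramp_gap_L2[OF u2]]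
      by (simp add: inner_commute)
    show "(b \<bullet> grad g x) * ?R x \<le> norm b * ?R x" for x
    proof (rule mult_right_mono[OF _ ramp_nonneg])
      have "b \<bullet> grad g x \<le> norm b * norm (grad g x)" by (rule norm_cauchy_schwarz)
      also have "\<dots> \<le> norm b * 1" using g1[of x] by (intro mult_left_mono) auto
      finally show "b \<bullet> grad g x \<le> norm b" by simp
    qed
  qed (use iR in simp)
  then have 2: "(LINT x|lebesgue_on S. (b \<bullet> grad g x) * ?R x) \<le> norm b * (LINT x|lebesgue_on S. ?R x)" by simp
  have "(norm b + \<epsilon>) * (LINT x|lebesgue_on S. ?R x) \<le> c * (LINT x|lebesgue_on S. ?R x)"
    using c by (intro mult_right_mono) (auto simp: ramp_nonneg)
  then show ?thesis using 1 2 by (simp add: algebra_simps)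
qed

end

end

section \<open>Differences in time\<close>

text \<open>The standard smooth transition from 0 to 1 on the unit interval. The quotient is written
  as a power so that \<open>C_k_powr\<close> applies to the positive denominator.\<close>

definition smooth_step :: "real \<Rightarrow> real" where
  "smooth_step s = eta 0 s * (eta 0 s + eta 0 (1 - s)) powr (-1)"

lemma smooth_step_denominator_pos: "eta 0 s + eta 0 (1 - s) > 0"
  using eta_pos[of s 0] eta_pos[of "1 - s" 0] eta_nonneg[of 0 s] eta_nonneg[of 0 "1 - s"]
  by (cases "s > 0") (auto simp: add_pos_nonneg add_nonneg_pos)

lemma smooth_step_bounds: "0 \<le> smooth_step s" "smooth_step s \<le> 1"
  using smooth_step_denominator_pos[of s] eta_nonneg[of 0 s] eta_nonneg[of 0 "1 - s"]
  by (auto simp: smooth_step_def powr_minus divide_simps)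

lemma smooth_step_eq_0: "s \<le> 0 \<Longrightarrow> smooth_step s = 0"
  by (simp add: smooth_step_def eta_nonpos_arg)

lemma smooth_step_eq_1: "s \<ge> 1 \<Longrightarrow> smooth_step s = 1"
  using eta_pos[of s 0] by (simp add: smooth_step_def eta_nonpos_arg powr_minus)

lemma C_k_affine: "C_k k (\<lambda>s::real. c * (s - a))"
  using C_k_cmult[OF C_k_inner[of k a 1], of c] by simp

lemma C_k_smooth_step: "C_k k f \<Longrightarrow> C_k k (\<lambda>x. smooth_step (f x))"
  unfolding smooth_step_def
  by (intro C_k_mult C_k_powr C_k_add C_k_eta C_k_diff C_k_const smooth_step_denominator_pos)

lemma C_k_smooth_step_id: "C_k k smooth_step"
  using C_k_smooth_step[OF C_k_affine[of k 1 0]] by simp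

definition smooth_step' :: "real \<Rightarrow> real" where
  "smooth_step' s = frechet_derivative smooth_step (at s) 1"

lemma smooth_step_has_derivative: "(smooth_step has_real_derivative smooth_step' s) (at s)"
proof -
  have d: "(smooth_step has_derivative frechet_derivative smooth_step (at s)) (at s)"
    using C_k_smooth_step_id by (rule C_k_Suc_has_derivative)
  interpret bounded_linear "frechet_derivative smooth_step (at s)" using d by (rule has_derivative_bounded_linear)
  have "frechet_derivative smooth_step (at s) h = smooth_step' s * h" for h
    using scaleR[of h 1] by (simp add: smooth_step'_def mult.commute)
  then have "frechet_derivative smooth_step (at s) = (*) (smooth_step' s)" by auto
  then show ?thesis using d by (simp add: has_field_derivative_def)
qed

lemma continuous_on_smooth_step': "continuous_on S smooth_step'"
proof -
  have "C_k 0 smooth_step'" using C_k_smooth_step_id[of "Suc 0"] by (simp add: smooth_step'_def[abs_def])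
  then show ?thesis by (rule C_k_imp_continuous_on)
qed

lemma borel_measurable_smooth_step' [measurable]: "smooth_step' \<in> borel_measurable borel"
  using continuous_on_smooth_step' by (rule borel_measurable_continuous_onI)

lemma smooth_step'_eq_0: "s \<notin> {0..1} \<Longrightarrow> smooth_step' s = 0"
proof -
  assume s: "s \<notin> {0..1}"
  define A where "A = (if s < 0 then {..<0} else {1<..} :: real set)"
  have "((\<lambda>_. if s < 0 then 0 else 1) has_real_derivative 0) (at s)" by (rule DERIV_const)
  then have "(smooth_step has_real_derivative 0) (at s)"
    by (rule has_field_derivative_transform_within_open[where S = A])
      (use s in \<open>auto simp: A_def smooth_step_eq_0 smooth_step_eq_1 split: if_splits\<close>)
  then show ?thesis using smooth_step_has_derivative DERIV_unique by blast
qed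

lemma LINT_smooth_step': "(LINT s|lborel. smooth_step' s) = 1"
proof -
  have "(LINT s|lborel. indicator {0..1} s *\<^sub>R smooth_step' s) = smooth_step 1 - smooth_step 0"
    using smooth_step_has_derivative
    by (intro integral_FTC_atLeastAtMost continuous_on_smooth_step')
      (auto simp: has_real_derivative_iff_has_vector_derivative intro: has_vector_derivative_at_within)
  also have "(\<lambda>s. indicator {0..1} s *\<^sub>R smooth_step' s) = smooth_step'"
    using smooth_step'_eq_0 by (auto simp: indicator_def fun_eq_iff)
  finally show ?thesis by (simp add: smooth_step_eq_0 smooth_step_eq_1)
qed

text \<open>An approximate identity: the kernel has integral 1 and is supported in [0, 1], and
  rescaling shrinks its support to \<open>s\<close> from the right. The substitution
  \<open>r = s + \<sigma> / (n + 1)\<close> moves the scaling into the argument of \<open>Y\<close>,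
  where continuity and dominated convergence apply.\<close>

lemma LINT_smooth_step'_concentrates:
  fixes Y :: "real \<Rightarrow> real"
  assumes Y: "continuous_on UNIV Y" and B: "\<And>s. \<bar>Y s\<bar> \<le> B"
  shows "(\<lambda>n. LINT r|lborel. (real (Suc n) * smooth_step' (real (Suc n) * (r - s))) * Y r) \<longlonglongrightarrow> Y s"
proof -
  have [measurable]: "Y \<in> borel_measurable borel"
    using Y by (auto intro: borel_measurable_continuous_onI)
  have i: "integrable lborel smooth_step'"
    by (rule integrable_compact_support[OF continuous_on_smooth_step' compact_Icc smooth_step'_eq_0])
  have "(\<lambda>n. LINT \<sigma>|lborel. smooth_step' \<sigma> * Y (s + \<sigma> * inverse (real (Suc n)))) \<longlonglongrightarrow> (LINT \<sigma>|lborel. smooth_step' \<sigma> * Y s)"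
  proof (rule integral_dominated_convergence)
    show "integrable lborel (\<lambda>\<sigma>. B * norm (smooth_step' \<sigma>))" using i by simp
    show "AE \<sigma> in lborel. (\<lambda>n. smooth_step' \<sigma> * Y (s + \<sigma> * inverse (real (Suc n)))) \<longlonglongrightarrow> smooth_step' \<sigma> * Y s"
    proof (intro AE_I2 tendsto_intros)
      fix \<sigma>
      have "(\<lambda>n. s + \<sigma> * inverse (real (Suc n))) \<longlonglongrightarrow> s + \<sigma> * 0"
        by (intro tendsto_intros LIMSEQ_inverse_real_of_nat)
      then have "(\<lambda>n. s + \<sigma> * inverse (real (Suc n))) \<longlonglongrightarrow> s" by simp
      moreover have "isCont Y s" using Y by (simp add: continuous_on_eq_continuous_at)
      ultimately show "(\<lambda>n. Y (s + \<sigma> * inverse (real (Suc n)))) \<longlonglongrightarrow> Y s"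
        by (rule isCont_tendsto_compose[rotated])
    qed
    show "AE \<sigma> in lborel. norm (smooth_step' \<sigma> * Y (s + \<sigma> * inverse (real (Suc n)))) \<le> B * norm (smooth_step' \<sigma>)" for n
      using B by (auto simp: abs_mult mult.commute[of B] intro!: AE_I2 mult_left_mono)
  qed measurable
  also have "(LINT \<sigma>|lborel. smooth_step' \<sigma> * Y s) = Y s" by (simp add: LINT_smooth_step')
  also have "(\<lambda>n. LINT \<sigma>|lborel. smooth_step' \<sigma> * Y (s + \<sigma> * inverse (real (Suc n))))
      = (\<lambda>n. LINT r|lborel. (real (Suc n) * smooth_step' (real (Suc n) * (r - s))) * Y r)"
  proof
    fix n
    let ?c = "inverse (real (Suc n))"
    have cn: "real (Suc n) * ((s + \<sigma> * ?c) - s) = \<sigma>" for \<sigma> by (simp add: field_simps)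
    have c0: "?c > 0" by simp
    have nc: "?c * (real (Suc n) * I) = I" for I by (simp add: field_simps)
    have "(LINT r|lborel. (real (Suc n) * smooth_step' (real (Suc n) * (r - s))) * Y r)
        = \<bar>?c\<bar> *\<^sub>R (LINT \<sigma>|lborel. (real (Suc n) * smooth_step' (real (Suc n) * ((s + ?c * \<sigma>) - s))) * Y (s + ?c * \<sigma>))"
      by (rule lborel_integral_real_affine) simp
    also have "\<dots> = ?c * (LINT \<sigma>|lborel. real (Suc n) * (smooth_step' \<sigma> * Y (s + \<sigma> * ?c)))"
      by (simp only: cn mult.assoc mult.commute[of ?c] real_scaleR_def abs_of_pos[OF c0])
    also have "\<dots> = (LINT \<sigma>|lborel. smooth_step' \<sigma> * Y (s + \<sigma> * ?c))"
      by (simp only: integral_mult_right_zero nc)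
    finally show "(LINT \<sigma>|lborel. smooth_step' \<sigma> * Y (s + \<sigma> * ?c))
        = (LINT r|lborel. (real (Suc n) * smooth_step' (real (Suc n) * (r - s))) * Y r)" by simp
  qed
  finally show ?thesis .
qed

lemma smooth_step_scaled_tendsto: "(\<lambda>n. smooth_step (real (Suc n) * s)) \<longlonglongrightarrow> indicator {0<..} s"
proof (cases "s > 0")
  case True
  have "\<forall>\<^sub>F n in sequentially. smooth_step (real (Suc n) * s) = 1"
  proof -
    obtain N :: nat where "1 / s < real N" using reals_Archimedean2 by blast
    then have N: "1 \<le> real N * s" using True by (simp add: divide_less_eq)
    have "smooth_step (real (Suc n) * s) = 1" if "n \<ge> N" for n
    proof (rule smooth_step_eq_1)
      have "real N * s \<le> real (Suc n) * s" using that True by (intro mult_right_mono) auto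
      then show "1 \<le> real (Suc n) * s" using N by linarith
    qed
    then show ?thesis by (auto simp: eventually_sequentially)
  qed
  then show ?thesis using True by (simp add: tendsto_eventually)
qed (simp add: smooth_step_eq_0 mult_nonneg_nonpos)

lemma scaled_in_unit_interval:
  assumes "real (Suc n) * d \<in> {0..1}"
  shows "0 \<le> d" "d \<le> inverse (real (Suc n))"
proof -
  have N: "real (Suc n) > 0" by simp
  show "0 \<le> d" using assms N by (simp add: zero_le_mult_iff del: of_nat_Suc)
  show "d \<le> inverse (real (Suc n))"
    using assms pos_le_divide_eq[OF N, of d 1] by (simp add: inverse_eq_divide mult.commute del: of_nat_Suc)
qed

text \<open>A smooth approximation of the indicator of \<open>{s<..t}\<close>, whose derivative is
  the difference of two concentrating kernels at \<open>s\<close> and \<open>t\<close>. Its support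
  exceeds \<open>t\<close> by at most \<open>1 / (n + 1)\<close>.\<close>

definition time_bump :: "real \<Rightarrow> real \<Rightarrow> nat \<Rightarrow> real \<Rightarrow> real" where
  "time_bump s t n r = smooth_step (real (Suc n) * (r - s)) - smooth_step (real (Suc n) * (r - t))"

lemma time_bump_eq_0:
  assumes "s \<le> t" "r \<notin> {s..t + inverse (real (Suc n))}"
  shows "time_bump s t n r = 0"
proof -
  consider "r < s" | "r > t + inverse (real (Suc n))" using assms(2) by force
  then show ?thesis
  proof cases
    case 1
    then show ?thesis using assms(1) by (simp add: time_bump_def smooth_step_eq_0 mult_nonneg_nonpos)
  next
    case 2
    then have "real (Suc n) * inverse (real (Suc n)) \<le> real (Suc n) * (r - t)" by (intro mult_left_mono) auto
    then have a: "1 \<le> real (Suc n) * (r - t)" by simp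
    also have "\<dots> \<le> real (Suc n) * (r - s)" using assms(1) by (intro mult_left_mono) auto
    finally show ?thesis using a by (simp only: time_bump_def smooth_step_eq_1 diff_self)
  qed
qed

lemma time_bump_in_test_functions:
  assumes "0 < s" "s \<le> t" "t + inverse (real (Suc n)) < T"
  shows "time_bump s t n \<in> test_functions {0<..<T}"
proof (rule test_functionsI[OF _ compact_Icc _ time_bump_eq_0[OF assms(2)]])
  show "C_k k (time_bump s t n)" for k
    unfolding time_bump_def[abs_def] by (intro C_k_diff C_k_smooth_step C_k_affine)
  show "{s..t + inverse (real (Suc n))} \<subseteq> {0<..<T}" using assms by auto
qed

lemma deriv_time_bump:
  "deriv (time_bump s t n) r = real (Suc n) * smooth_step' (real (Suc n) * (r - s))
    - real (Suc n) * smooth_step' (real (Suc n) * (r - t))"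
proof (rule DERIV_imp_deriv)
  have "((\<lambda>r. smooth_step (real (Suc n) * (r - a))) has_real_derivative
      smooth_step' (real (Suc n) * (r - a)) * real (Suc n)) (at r)" for a
    by (rule DERIV_chain2[OF smooth_step_has_derivative]) (auto intro!: derivative_eq_intros)
  from DERIV_diff[OF this[of s] this[of t]]
  show "(time_bump s t n has_real_derivative real (Suc n) * smooth_step' (real (Suc n) * (r - s))
    - real (Suc n) * smooth_step' (real (Suc n) * (r - t))) (at r)"
    unfolding time_bump_def[abs_def] by (simp only: mult.commute)
qed

lemma abs_time_bump_le: "\<bar>time_bump s t n r\<bar> \<le> 1"
  using smooth_step_bounds[of "real (Suc n) * (r - s)"] smooth_step_bounds[of "real (Suc n) * (r - t)"]
  unfolding time_bump_def by linarith

lemma time_bump_tendsto: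
  assumes "s \<le> t"
  shows "(\<lambda>n. time_bump s t n r) \<longlonglongrightarrow> indicator {s<..t} r"
proof -
  have "(\<lambda>n. time_bump s t n r) \<longlonglongrightarrow> indicator {0<..} (r - s) - indicator {0<..} (r - t)"
    unfolding time_bump_def by (intro tendsto_intros smooth_step_scaled_tendsto)
  also have "indicator {0<..} (r - s) - indicator {0<..} (r - t) = (indicator {s<..t} r :: real)"
    using assms by (auto simp: indicator_def)
  finally show ?thesis .
qed

lemma borel_measurable_time_bump [measurable]: "time_bump s t n \<in> borel_measurable borel"
proof -
  have "C_k 0 (time_bump s t n)"
    unfolding time_bump_def[abs_def] by (intro C_k_diff C_k_smooth_step C_k_affine)
  then show ?thesis by (simp add: borel_measurable_continuous_onI)
qed

section \<open>From the weak time derivative to differences in time\<close>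

lemma closure_cylinder: "T > 0 \<Longrightarrow> closure (cylinder S T) = closure S \<times> {0..T}"
  by (simp add: cylinder_def closure_Times)

lemma AE_lebesgue_onI:
  assumes "S \<in> sets lebesgue" "AE x in lborel. x \<in> S \<longrightarrow> P x"
  shows "AE x in lebesgue_on S. P x"
  using AE_completion[OF assms(2)] assms(1) by (subst AE_restrict_space_iff) auto

text \<open>Fubini needs a function measurable for the product of the Borel measures, while
  \<open>w\<close> is only Lebesgue measurable on the cylinder. Agreement is recorded in both
  orders: slices at fixed \<open>x\<close> serve the difference in time, slices at fixed
  \<open>t\<close> the variational inequality.\<close>

lemma borel_representative_on_cylinder:
  fixes S :: "'a::euclidean_space set" and w :: "real \<Rightarrow> 'a \<Rightarrow> real"
  assumes op: "open S" and bd: "bounded S" and w: "(\<lambda>(x, t). w t x) \<in> L2 (cylinder S T)"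
  obtains g :: "'a \<times> real \<Rightarrow> real" where "integrable lborel g"
    "AE x in lborel. AE t in lborel. x \<in> S \<longrightarrow> t \<in> {0<..<T} \<longrightarrow> w t x = g (x, t)"
    "AE t in lborel. AE x in lborel. x \<in> S \<longrightarrow> t \<in> {0<..<T} \<longrightarrow> w t x = g (x, t)"
proof -
  let ?Q = "cylinder S T" and ?w = "\<lambda>(x, t). w t x"
  have oQ: "open ?Q" unfolding cylinder_def using op by (intro open_Times) auto
  have bQ: "bounded ?Q" unfolding cylinder_def using bd by (intro bounded_Times) auto
  have sQ: "?Q \<in> sets lebesgue" using oQ by auto
  have "integrable (lebesgue_on ?Q) ?w" by (rule L2_integrable[OF lmeasurable_domain[OF oQ bQ] w])
  then have i: "integrable lebesgue (\<lambda>p. indicator ?Q p * ?w p)"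
    using sQ by (subst (asm) integrable_restrict_space) auto
  obtain g where g [measurable]: "g \<in> borel_measurable lborel"
    and ae: "AE p in lborel. indicator ?Q p * ?w p = g p"
    using completion_ex_borel_measurable_real[OF borel_measurable_integrable[OF i]] by blast
  have "integrable lebesgue g"
    using i AE_completion[OF ae] g
    by (subst integrable_cong_AE[of _ _ "\<lambda>p. indicator ?Q p * ?w p"]) (auto intro: measurable_completion simp: eq_commute)
  then have ig: "integrable lborel g" using g by (simp add: integrable_completion)
  \<comment> \<open>Exchanging the order of the quantifiers needs a measurable exceptional set,
    hence the Borel null set \<open>N\<close> around it.\<close>
  from ae obtain N where N: "{p \<in> space lborel. \<not> (indicator ?Q p * ?w p = g p)} \<subseteq> N" "emeasure lborel N = 0" "N \<in> sets lborel"
    by (rule AE_E)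
  have aeN: "AE p in lborel \<Otimes>\<^sub>M lborel. p \<notin> N"
    unfolding lborel_prod using N by (intro AE_not_in) auto
  have imp: "w t x = g (x, t)" if "(x, t) \<notin> N" "x \<in> S" "t \<in> {0<..<T}" for x t
  proof -
    have "(x, t) \<notin> {p \<in> space lborel. \<not> (indicator ?Q p * ?w p = g p)}" using that(1) N(1) by blast
    then show ?thesis using that(2,3) by (simp add: cylinder_def)
  qed
  have 1: "AE x in lborel. AE t in lborel. (x, t) \<notin> N"
    using lborel_pair.AE_pair[OF aeN] by simp
  have m: "{p \<in> space (lborel \<Otimes>\<^sub>M lborel). (fst p, snd p) \<notin> N} \<in> sets (lborel \<Otimes>\<^sub>M lborel)"
  proof -
    have "{p \<in> space (lborel \<Otimes>\<^sub>M lborel). (fst p, snd p) \<notin> N} = - N" by (auto simp: space_pair_measure)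
    then show ?thesis using N(3) unfolding lborel_prod by simp
  qed
  have 2: "AE t in lborel. AE x in lborel. (x, t) \<notin> N"
    using 1 lborel_pair.AE_commute[of "\<lambda>x t. (x, t) \<notin> N"] m by simp
  show ?thesis
  proof (rule that[OF ig])
    show "AE x in lborel. AE t in lborel. x \<in> S \<longrightarrow> t \<in> {0<..<T} \<longrightarrow> w t x = g (x, t)"
      using 1 by eventually_elim (auto elim!: eventually_mono intro: imp)
    show "AE t in lborel. AE x in lborel. x \<in> S \<longrightarrow> t \<in> {0<..<T} \<longrightarrow> w t x = g (x, t)"
      using 2 by eventually_elim (auto elim!: eventually_mono intro: imp)
  qed
qed

text \<open>Test the weak derivative with \<open>time_bump s t n\<close> and let \<open>n\<close>
  grow: the kernels in its derivative concentrate at \<open>s\<close> and \<open>t\<close>, and the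
  bump tends to the indicator of \<open>{s<..t}\<close>.\<close>

lemma time_difference:
  fixes S :: "'a::euclidean_space set" and z w :: "real \<Rightarrow> 'a \<Rightarrow> real"
  assumes op: "open S" and cont: "continuous_on (closure (cylinder S T)) (\<lambda>(x, t). z t x)"
    and w: "has_weak_time_derivative S T z w"
    and g: "integrable lborel g" "AE x in lborel. AE t in lborel. x \<in> S \<longrightarrow> t \<in> {0<..<T} \<longrightarrow> w t x = g (x, t)"
    and st: "0 < s" "s \<le> t" "t < T"
  shows "AE x in lborel. x \<in> S \<longrightarrow> z t x - z s x = (LINT r|lborel. indicator {s<..t} r * g (x, r))"
proof -
  have T: "T > 0" using st by simp
  \<comment> \<open>From this index on, the bump is supported inside the open interval from 0 to
    \<open>T\<close>.\<close>
  obtain N where N: "t + inverse (real (Suc N)) < T"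
    using reals_Archimedean[of "T - t"] st by (auto simp: algebra_simps)
  have Nn: "t + inverse (real (Suc n)) < T" if "n \<ge> N" for n
    using N that by (smt (verit) inverse_le_imp_le of_nat_0_less_iff of_nat_mono Suc_le_mono le_imp_inverse_le zero_less_Suc)
  \<comment> \<open>Countably many test functions, so a single null set of points \<open>x\<close>
    serves all of them.\<close>
  have "AE x in lebesgue_on S. \<forall>n\<in>{N..}. (LINT r|lebesgue_on {0<..<T}. deriv (time_bump s t n) r * z r x)
          = - (LINT r|lebesgue_on {0<..<T}. time_bump s t n r * w r x)"
    using w time_bump_in_test_functions[OF st(1,2) Nn]
    by (intro AE_ball_countable[THEN iffD2]) (auto simp: has_weak_time_derivative_def)
  then have "AE x in lebesgue. x \<in> S \<longrightarrow> (\<forall>n\<in>{N..}. (LINT r|lebesgue_on {0<..<T}. deriv (time_bump s t n) r * z r x)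
          = - (LINT r|lebesgue_on {0<..<T}. time_bump s t n r * w r x))"
    using op by (subst (asm) AE_restrict_space_iff) auto
  then have 1: "AE x in lborel. x \<in> S \<longrightarrow> (\<forall>n\<in>{N..}. (LINT r|lebesgue_on {0<..<T}. deriv (time_bump s t n) r * z r x)
          = - (LINT r|lebesgue_on {0<..<T}. time_bump s t n r * w r x))"
    by (simp only: AE_completion_iff)
  have "integrable (lborel \<Otimes>\<^sub>M lborel) g" using g(1) by (simp add: lborel_prod)
  then have 2: "AE x in lborel. integrable lborel (\<lambda>r. g (x, r))" by (rule lborel_pair.AE_integrable_fst')
  show ?thesis
    using 1 2 g(2)
  proof eventually_elim
    case (elim x)
    show ?case
    proof
      assume x: "x \<in> S"
      note [measurable] = borel_measurable_integrable[OF elim(2)]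
      \<comment> \<open>Clamping the time gives a bounded continuous function on the whole line, as
        the concentration lemma requires, that agrees with \<open>z\<close> on the supports of the
        bumps used.\<close>
      define Y where "Y = (\<lambda>r. z (max 0 (min T r)) x)"
      have cY: "continuous_on UNIV Y"
      proof -
        have "continuous_on UNIV ((\<lambda>(x, t). z t x) \<circ> (\<lambda>r. (x, max 0 (min T r))))"
          using x closure_subset[of S] T
          by (intro continuous_on_compose continuous_on_subset[OF cont] continuous_intros)
            (auto simp: closure_cylinder)
        then show ?thesis by (simp add: o_def Y_def)
      qed
      have "Y ` UNIV \<subseteq> Y ` {0..T}"
      proof safe
        fix r
        have "Y r = Y (max 0 (min T r))" using T by (simp add: Y_def max_def min_def)
        then show "Y r \<in> Y ` {0..T}" using T by auto
      qed
      moreover have "bounded (Y ` {0..T})"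
        by (intro compact_imp_bounded compact_continuous_image continuous_on_subset[OF cY]) auto
      ultimately have "bounded (range Y)" by (rule bounded_subset[rotated])
      then obtain B where B: "\<And>r. \<bar>Y r\<bar> \<le> B" by (auto simp: bounded_iff)
      let ?\<rho> = "\<lambda>n a r. real (Suc n) * smooth_step' (real (Suc n) * (r - a))"
      have mY [measurable]: "Y \<in> borel_measurable borel" using cY by (rule borel_measurable_continuous_onI)
      have i\<rho>: "integrable lborel (\<lambda>r. ?\<rho> n a r * Y r)" for n a
      proof (rule integrable_compact_support[of _ "{a..a + inverse (real (Suc n))}"])
        show "continuous_on UNIV (\<lambda>r. ?\<rho> n a r * Y r)"
          by (intro continuous_intros cY continuous_on_compose2[OF continuous_on_smooth_step', of UNIV]) auto
        fix r assume "r \<notin> {a..a + inverse (real (Suc n))}"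
        then have "real (Suc n) * (r - a) \<notin> {0..1}" using scaled_in_unit_interval[of n "r - a"] by force
        then show "?\<rho> n a r * Y r = 0" using smooth_step'_eq_0 by simp
      qed simp
      have lhs: "(LINT r|lebesgue_on {0<..<T}. deriv (time_bump s t n) r * z r x)
          = (LINT r|lborel. ?\<rho> n s r * Y r) - (LINT r|lborel. ?\<rho> n t r * Y r)" if n: "n \<ge> N" for n
      proof -
        have "(LINT r|lebesgue_on {0<..<T}. deriv (time_bump s t n) r * z r x)
            = (LINT r|lebesgue_on {0<..<T}. (?\<rho> n s r - ?\<rho> n t r) * Y r)"
          by (intro Bochner_Integration.integral_cong) (auto simp: deriv_time_bump Y_def space_restrict_space)
        also have "\<dots> = (LINT r|lborel. (?\<rho> n s r - ?\<rho> n t r) * Y r)"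
        proof (rule LINT_lebesgue_on_eq_lborel)
          fix r assume "r \<notin> {0<..<T}"
          then have "r < s \<or> r > t + inverse (real (Suc n))" using Nn[OF n] st by auto
          then have "real (Suc n) * (r - s) \<notin> {0..1} \<and> real (Suc n) * (r - t) \<notin> {0..1}"
            using st scaled_in_unit_interval[of n "r - s"] scaled_in_unit_interval[of n "r - t"] by force
          then show "(?\<rho> n s r - ?\<rho> n t r) * Y r = 0" using smooth_step'_eq_0 by simp
        next
          show "(\<lambda>r. (?\<rho> n s r - ?\<rho> n t r) * Y r) \<in> borel_measurable borel" by measurable
        qed simp
        also have "\<dots> = (LINT r|lborel. ?\<rho> n s r * Y r) - (LINT r|lborel. ?\<rho> n t r * Y r)"
          unfolding left_diff_distrib[of _ _ "Y _"] by (intro Bochner_Integration.integral_diff i\<rho>)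
        finally show ?thesis .
      qed
      have rhs: "(LINT r|lebesgue_on {0<..<T}. time_bump s t n r * w r x) = (LINT r|lborel. time_bump s t n r * g (x, r))"
        if n: "n \<ge> N" for n
      proof -
        have ae: "AE r in lebesgue_on {0<..<T}. time_bump s t n r * g (x, r) = time_bump s t n r * w r x"
          using elim(3) x by (intro AE_lebesgue_onI) (auto elim!: eventually_mono)
        have m: "(\<lambda>r. time_bump s t n r * g (x, r)) \<in> borel_measurable (lebesgue_on {0<..<T})"
          by (intro measurable_restrict_space1 measurable_completion) measurable
        have m': "(\<lambda>r. time_bump s t n r * w r x) \<in> borel_measurable (lebesgue_on {0<..<T})"
          by (rule borel_measurable_lebesgue_on_AE[OF _ m ae]) simp
        have "(LINT r|lebesgue_on {0<..<T}. time_bump s t n r * w r x) = (LINT r|lebesgue_on {0<..<T}. time_bump s t n r * g (x, r))"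
          by (rule integral_cong_AE[OF m m' ae, symmetric])
        also have "\<dots> = (LINT r|lborel. time_bump s t n r * g (x, r))"
        proof (rule LINT_lebesgue_on_eq_lborel)
          fix r assume "r \<notin> {0<..<T}"
          then have "r \<notin> {s..t + inverse (real (Suc n))}" using Nn[OF n] st by auto
          then show "time_bump s t n r * g (x, r) = 0" using time_bump_eq_0[OF st(2)] by simp
        qed auto
        finally show ?thesis .
      qed
      have L1: "(\<lambda>n. (LINT r|lborel. ?\<rho> n s r * Y r) - (LINT r|lborel. ?\<rho> n t r * Y r)) \<longlonglongrightarrow> Y s - Y t"
        by (intro tendsto_diff LINT_smooth_step'_concentrates[OF cY B])
      have L2: "(\<lambda>n. - (LINT r|lborel. time_bump s t n r * g (x, r))) \<longlonglongrightarrow> - (LINT r|lborel. indicator {s<..t} r * g (x, r))"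
      proof (rule tendsto_minus, rule integral_dominated_convergence)
        show "integrable lborel (\<lambda>r. norm (g (x, r)))" using elim(2) by simp
        show "AE r in lborel. (\<lambda>n. time_bump s t n r * g (x, r)) \<longlonglongrightarrow> indicator {s<..t} r * g (x, r)"
          by (intro AE_I2 tendsto_intros time_bump_tendsto st)
        show "AE r in lborel. norm (time_bump s t n r * g (x, r)) \<le> norm (g (x, r))" for n
          using abs_time_bump_le by (auto simp: abs_mult intro!: mult_left_le_one_le)
      qed measurable
      have ev: "\<forall>\<^sub>F n in sequentially. - (LINT r|lborel. time_bump s t n r * g (x, r))
          = (LINT r|lborel. ?\<rho> n s r * Y r) - (LINT r|lborel. ?\<rho> n t r * Y r)"
        using eventually_ge_at_top[of N]
      proof eventually_elim
        case (elim n)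
        then show ?case using lhs[OF elim] rhs[OF elim] \<open>x \<in> S \<longrightarrow> _\<close> x by auto
      qed
      have "- (LINT r|lborel. indicator {s<..t} r * g (x, r)) = Y s - Y t"
        by (rule LIMSEQ_unique[OF Lim_transform_eventually[OF L2 ev] L1])
      then show "z t x - z s x = (LINT r|lborel. indicator {s<..t} r * g (x, r))"
        using st by (simp add: Y_def)
    qed
  qed
qed

section \<open>The energy estimate\<close>

text \<open>For fixed \<open>\<eta>\<close>, steps of length at most \<open>\<delta>\<close> are
  chained and their errors telescope to \<open>\<eta> * (\<mu> t - \<mu> t0)\<close>. The function
  \<open>\<mu>\<close> does not depend on \<open>\<eta>\<close>, which may then tend to 0.\<close>

lemma nonincreasing_if_locally_almost_nonincreasing:
  fixes E \<mu> :: "real \<Rightarrow> real"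
  assumes loc: "\<And>\<eta>. \<eta> > 0 \<Longrightarrow> \<exists>\<delta>>0. \<forall>s t. t0 \<le> s \<and> s \<le> t \<and> t < T \<and> t - s \<le> \<delta> \<longrightarrow> E t - E s \<le> \<eta> * (\<mu> t - \<mu> s)"
    and t: "t0 \<le> t" "t < T"
  shows "E t \<le> E t0"
proof -
  have glob: "E t - E t0 \<le> \<eta> * (\<mu> t - \<mu> t0)" if \<eta>: "\<eta> > 0" for \<eta>
  proof -
    obtain \<delta> where \<delta>: "\<delta> > 0"
      "\<And>s t. t0 \<le> s \<Longrightarrow> s \<le> t \<Longrightarrow> t < T \<Longrightarrow> t - s \<le> \<delta> \<Longrightarrow> E t - E s \<le> \<eta> * (\<mu> t - \<mu> s)"
      using loc[OF \<eta>] by blast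
    have "E r - E t0 \<le> \<eta> * (\<mu> r - \<mu> t0)" if "t0 \<le> r" "r < T" "r - t0 \<le> real n * \<delta>" for n r
      using that
    proof (induction n arbitrary: r)
      case 0
      then have "r = t0" by simp
      then show ?case by simp
    next
      case (Suc n)
      \<comment> \<open>One step back from \<open>r\<close>, stopped at \<open>t0\<close>.\<close>
      define q where "q = max t0 (r - \<delta>)"
      have q: "t0 \<le> q" "q \<le> r" "q < T" "r - q \<le> \<delta>" "q - t0 \<le> real n * \<delta>"
        using Suc.prems \<delta>(1) by (auto simp: q_def algebra_simps max_def)
      have "E q - E t0 \<le> \<eta> * (\<mu> q - \<mu> t0)" using q by (intro Suc.IH) auto
      moreover have "E r - E q \<le> \<eta> * (\<mu> r - \<mu> q)" using q Suc.prems by (intro \<delta>(2)) auto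
      ultimately show ?case by (simp add: algebra_simps)
    qed
    moreover obtain n :: nat where "(t - t0) / \<delta> < real n" using reals_Archimedean2 by blast
    then have "t - t0 \<le> real n * \<delta>" using \<delta>(1) by (simp add: divide_less_eq)
    ultimately show ?thesis using t by blast
  qed
  show ?thesis
  proof (rule ccontr)
    assume "\<not> E t \<le> E t0"
    then have c: "E t - E t0 > 0" by simp
    \<comment> \<open>The summand 1 keeps \<open>d\<close> positive for the division that
      follows.\<close>
    define d where "d = \<bar>\<mu> t - \<mu> t0\<bar> + 1"
    define \<eta> where "\<eta> = (E t - E t0) / (2 * d)"
    have d: "d > 0" unfolding d_def by linarith
    then have \<eta>: "\<eta> > 0" "\<eta> * d = (E t - E t0) / 2" using c by (simp_all add: \<eta>_def)
    have "E t - E t0 \<le> \<eta> * (\<mu> t - \<mu> t0)" using \<eta>(1) by (rule glob)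
    also have "\<dots> \<le> \<eta> * d" using \<eta>(1) unfolding d_def by (intro mult_left_mono) auto
    finally show False using \<eta>(2) c by simp
  qed
qed

text \<open>The set where \<open>\<phi>\<close> is positive is open and null, hence empty. This
  upgrades every almost-everywhere statement about the solution, in space and in time.\<close>

lemma nonpos_if_AE_nonpos:
  fixes \<phi> :: "'a::euclidean_space \<Rightarrow> real"
  assumes S: "open S" and \<phi>: "continuous_on S \<phi>" and ae: "AE x in lebesgue. x \<in> S \<longrightarrow> \<phi> x \<le> 0" and x: "x \<in> S"
  shows "\<phi> x \<le> 0"
proof (rule ccontr)
  assume "\<not> \<phi> x \<le> 0"
  then have x': "x \<in> S \<inter> \<phi> -` {0<..}" using x by simp
  have o: "open (S \<inter> \<phi> -` {0<..})" using \<phi> S by (rule continuous_open_preimage) simp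
  have "AE y in lebesgue. y \<in> S \<inter> \<phi> -` {0<..} \<longrightarrow> y \<in> {}"
    using ae by eventually_elim auto
  then have "x \<in> {}" by (rule mem_closed_if_AE_lebesgue_open[OF o closed_empty _ x'])
  then show False by simp
qed

lemma integrable_indicator_continuous:
  fixes \<phi> :: "'a::euclidean_space \<Rightarrow> real"
  assumes "bounded S" "S \<in> sets borel" "continuous_on (closure S) \<phi>"
  shows "integrable lborel (\<lambda>x. indicator S x * \<phi> x)"
proof -
  have "integrable lborel (\<lambda>x. indicator (closure S) x *\<^sub>R \<phi> x)"
    using assms by (intro borel_integrable_compact) (auto simp: compact_closure)
  then have "integrable lborel (\<lambda>x. indicator S x *\<^sub>R (indicator (closure S) x *\<^sub>R \<phi> x))"
    by (rule integrable_mult_indicator[rotated]) (use assms(2) in simp)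
  also have "(\<lambda>x. indicator S x *\<^sub>R (indicator (closure S) x *\<^sub>R \<phi> x)) = (\<lambda>x. indicator S x * \<phi> x)"
    using closure_subset[of S] by (auto simp: indicator_def fun_eq_iff)
  finally show ?thesis .
qed

text \<open>In \<open>VI\<close> the quantifier over \<open>m\<close> stands inside the
  almost-everywhere quantifier over time, so the level may be chosen depending on \<open>r\<close>.
  All integrals are over \<open>lborel\<close>, ready for Fubini, with \<open>g\<close> a Borel
  version of the time derivative.\<close>

locale energy =
  fixes S :: "'a::euclidean_space set" and z :: "real \<Rightarrow> 'a \<Rightarrow> real" and g :: "'a \<times> real \<Rightarrow> real"
    and p :: "'a \<Rightarrow> real" and T t0 \<epsilon> M :: real
  assumes op: "open S" and bd: "bounded S" and t0: "0 < t0" and eps: "\<epsilon> > 0" and M: "M \<ge> 0"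
    and cont: "continuous_on (closure S \<times> {0..T}) (\<lambda>(x, t). z t x)"
    and p: "continuous_on UNIV p" and g: "integrable lborel g"
    and diff: "\<And>s t. 0 < s \<Longrightarrow> s \<le> t \<Longrightarrow> t < T \<Longrightarrow>
      AE x in lborel. x \<in> S \<longrightarrow> z t x - z s x = (LINT r|lborel. indicator {s<..t} r * g (x, r))"
    and VI: "AE r in lborel. r \<in> {t0<..<T} \<longrightarrow> (\<forall>m\<ge>0.
      \<epsilon> * (LINT x|lborel. indicator S x * ramp (p x - z r x - m))
      \<le> (LINT x|lborel. indicator S x * (g (x, r) * ramp (p x - z r x - m))))"
    and init: "\<And>x. x \<in> S \<Longrightarrow> p x - z t0 x \<le> M"
begin

definition "level r = max 0 (M - \<epsilon> * (r - t0))"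
definition "gap r x = p x - z r x - level r"
definition "nrg r = (LINT x|lborel. indicator S x * ramp_int (gap r x))"
text \<open>The weight that measures the error of freezing time: its density dominates
  \<open>\<bar>\<epsilon> - g\<bar>\<close>, and it does not depend on the length of the time
  steps.\<close>

definition "mass t = (LINT q|lborel. indicator (S \<times> {0<..t}) q * (\<epsilon> + \<bar>g q\<bar>))"

lemma level_diff: "s \<le> t \<Longrightarrow> - \<epsilon> * (t - s) \<le> level t - level s \<and> level t - level s \<le> 0"
proof -
  assume "s \<le> t"
  then have "\<epsilon> * (s - t0) \<le> \<epsilon> * (t - t0)" using eps by (intro mult_left_mono) auto
  moreover have "- (v - u) \<le> max 0 (M - v) - max 0 (M - u) \<and> max 0 (M - v) - max 0 (M - u) \<le> 0"
    if "u \<le> v" for u v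
    using that by (auto simp: max_def)
  ultimately have "- (\<epsilon> * (t - t0) - \<epsilon> * (s - t0)) \<le> level t - level s \<and> level t - level s \<le> 0"
    unfolding level_def by blast
  then show ?thesis by (simp add: algebra_simps)
qed

lemma continuous_on_level: "continuous_on A level"
  unfolding level_def[abs_def] by (intro continuous_intros)

lemma continuous_on_z:
  assumes "r \<in> {0..T}" shows "continuous_on (closure S) (z r)"
proof -
  have "continuous_on (closure S) (\<lambda>x. (\<lambda>(x, t). z t x) (x, r))"
    by (rule continuous_on_compose2[OF cont]) (use assms in \<open>auto intro!: continuous_intros\<close>)
  then show ?thesis by simp
qed

lemma continuous_on_gap: "r \<in> {0..T} \<Longrightarrow> continuous_on (closure S) (gap r)"
  unfolding gap_def[abs_def] by (intro continuous_intros continuous_on_z continuous_on_subset[OF p]) auto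

lemma continuous_on_gap_joint: "continuous_on (closure S \<times> {0..T}) (\<lambda>q. gap (snd q) (fst q))"
  unfolding gap_def
proof (intro continuous_intros)
  show "continuous_on (closure S \<times> {0..T}) (\<lambda>q. p (fst q))"
    by (rule continuous_on_compose2[OF p]) (auto intro!: continuous_intros)
  show "continuous_on (closure S \<times> {0..T}) (\<lambda>q. level (snd q))"
    by (rule continuous_on_compose2[OF continuous_on_level[of UNIV]]) (auto intro!: continuous_intros)
  show "continuous_on (closure S \<times> {0..T}) (\<lambda>q. z (snd q) (fst q))"
    using cont by (simp add: case_prod_beta)
qed

lemma integrable_gap:
  fixes F :: "real \<Rightarrow> real"
  assumes "r \<in> {0..T}" "continuous_on UNIV F"
  shows "integrable lborel (\<lambda>x. indicator S x * F (gap r x))"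
  using op bd continuous_on_gap[OF assms(1)]
  by (intro integrable_indicator_continuous continuous_on_compose2[OF assms(2)]) auto

lemma gap_uniformly_continuous:
  assumes "\<eta> > 0"
  obtains \<delta> where "\<delta> > 0"
    "\<And>x s t. x \<in> S \<Longrightarrow> s \<in> {0..T} \<Longrightarrow> t \<in> {0..T} \<Longrightarrow> \<bar>t - s\<bar> \<le> \<delta> \<Longrightarrow> \<bar>gap t x - gap s x\<bar> \<le> \<eta>"
proof -
  have "compact (closure S \<times> {0..T})" using bd by (intro compact_Times) (auto simp: compact_closure)
  then have "uniformly_continuous_on (closure S \<times> {0..T}) (\<lambda>q. gap (snd q) (fst q))"
    using continuous_on_gap_joint by (intro compact_uniformly_continuous)
  then obtain \<delta> where \<delta>: "\<delta> > 0" "\<And>q q'. q \<in> closure S \<times> {0..T} \<Longrightarrow> q' \<in> closure S \<times> {0..T} \<Longrightarrow>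
      dist q' q < \<delta> \<Longrightarrow> dist (gap (snd q') (fst q')) (gap (snd q) (fst q)) < \<eta>"
    using assms unfolding uniformly_continuous_on_def by blast
  show ?thesis
  proof (rule that[of "\<delta> / 2"])
    fix x s t assume "x \<in> S" "s \<in> {0..T}" "t \<in> {0..T}" "\<bar>t - s\<bar> \<le> \<delta> / 2"
    then show "\<bar>gap t x - gap s x\<bar> \<le> \<eta>"
      using \<delta>(1) \<delta>(2)[of "(x, s)" "(x, t)"] closure_subset[of S] by (auto simp: dist_Pair_Pair dist_real_def)
  qed (use \<delta> in simp)
qed

lemma slab_borel: "S \<times> {s<..t::real} \<in> sets borel"
  unfolding borel_prod[symmetric] using op by (intro pair_measureI) auto

lemma integrable_slab: "integrable lborel (\<lambda>q. indicator (S \<times> {s<..t}) q * (\<epsilon> + \<bar>g q\<bar>))"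
proof -
  have "bounded (S \<times> {s<..t})" using bd by (intro bounded_Times) auto
  then have "emeasure lborel (S \<times> {s<..t}) < \<infinity>" by (rule emeasure_bounded_finite)
  then have "integrable lborel (\<lambda>q. indicator (S \<times> {s<..t}) q * \<epsilon>)"
    using slab_borel by (intro integrable_mult_left integrable_real_indicator) auto
  moreover have "integrable lborel (\<lambda>q. indicator (S \<times> {s<..t}) q *\<^sub>R \<bar>g q\<bar>)"
    using g slab_borel by (intro integrable_mult_indicator) auto
  ultimately show ?thesis by (simp add: distrib_left)
qed

lemma mass_diff:
  assumes "0 \<le> s" "s \<le> t"
  shows "mass t - mass s = (LINT q|lborel. indicator (S \<times> {s<..t}) q * (\<epsilon> + \<bar>g q\<bar>))"
proof -
  have "mass t - mass s = (LINT q|lborel. indicator (S \<times> {0<..t}) q * (\<epsilon> + \<bar>g q\<bar>) - indicator (S \<times> {0<..s}) q * (\<epsilon> + \<bar>g q\<bar>))"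
    unfolding mass_def by (intro Bochner_Integration.integral_diff[symmetric] integrable_slab)
  also have "\<dots> = (LINT q|lborel. indicator (S \<times> {s<..t}) q * (\<epsilon> + \<bar>g q\<bar>))"
    using assms by (intro Bochner_Integration.integral_cong) (auto simp: indicator_def)
  finally show ?thesis .
qed

text \<open>Convexity bounds the increment at \<open>x\<close> by \<open>ramp (gap t x)\<close>
  times the increment of the gap, which is at most the time integral of
  \<open>\<epsilon> - g\<close>. Replacing \<open>gap t\<close> by the gap at the running time costs
  at most \<open>\<eta>\<close> times the mass. The resulting double integral, taken in
  \<open>x\<close> first, is nonpositive by the variational inequality.\<close>

lemma nrg_diff_le:
  assumes st: "t0 \<le> s" "s \<le> t" "t < T"
    and \<eta>: "\<And>x r. x \<in> S \<Longrightarrow> r \<in> {s<..t} \<Longrightarrow> \<bar>gap t x - gap r x\<bar> \<le> \<eta>"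
  shows "nrg t - nrg s \<le> \<eta> * (mass t - mass s)"
proof -
  have T: "s \<in> {0..T}" "t \<in> {0..T}" "{s<..t} \<subseteq> {0..T}" using st t0 by auto
  have [measurable]: "g \<in> borel_measurable borel" using g by simp
  let ?I = "\<lambda>q. indicator (S \<times> {s<..t}) q :: real"
  \<comment> \<open>\<open>?Q\<close> has the slope frozen at the end time, as convexity delivers
    it; \<open>?Q'\<close> has it at the running time, as the variational inequality needs
    it.\<close>
  let ?Q = "\<lambda>q. ?I q * (ramp (gap t (fst q)) * (\<epsilon> - g q))"
  let ?Q' = "\<lambda>q. ?I q * (ramp (gap (snd q) (fst q)) * (\<epsilon> - g q))"
  have [measurable]: "?I \<in> borel_measurable borel" using slab_borel by simp
  have cQ: "compact (closure S \<times> {0..T})" using bd by (intro compact_Times) (auto simp: compact_closure)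
  have int: "integrable lborel (\<lambda>q. ?I q * (\<phi> q * (\<epsilon> - g q)))"
    if \<phi>: "continuous_on (closure S \<times> {0..T}) \<phi>" for \<phi>
  proof -
    have "bounded (\<phi> ` (closure S \<times> {0..T}))"
      by (intro compact_imp_bounded compact_continuous_image \<phi> cQ)
    then obtain B where B: "\<And>q. q \<in> closure S \<times> {0..T} \<Longrightarrow> \<bar>\<phi> q\<bar> \<le> B" by (auto simp: bounded_iff)
    have in_Q: "q \<in> closure S \<times> {0..T}" if "q \<in> S \<times> {s<..t}" for q
      using that T closure_subset[of S] by auto
    have "(\<lambda>q. indicator (closure S \<times> {0..T}) q *\<^sub>R \<phi> q) \<in> borel_measurable borel"
      using cQ \<phi> by (intro borel_measurable_continuous_on_indicator) (auto simp: borel_compact)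
    then have "(\<lambda>q. ?I q * ((indicator (closure S \<times> {0..T}) q *\<^sub>R \<phi> q) * (\<epsilon> - g q))) \<in> borel_measurable borel"
      by measurable
    also have "(\<lambda>q. ?I q * ((indicator (closure S \<times> {0..T}) q *\<^sub>R \<phi> q) * (\<epsilon> - g q))) = (\<lambda>q. ?I q * (\<phi> q * (\<epsilon> - g q)))"
      using in_Q by (auto simp: indicator_def fun_eq_iff)
    finally have m: "(\<lambda>q. ?I q * (\<phi> q * (\<epsilon> - g q))) \<in> borel_measurable lborel" by simp
    show ?thesis
    proof (rule Bochner_Integration.integrable_bound[OF _ m])
      show "integrable lborel (\<lambda>q. B * (?I q * (\<epsilon> + \<bar>g q\<bar>)))"
        using integrable_slab by (intro integrable_mult_right)
      show "AE q in lborel. norm (?I q * (\<phi> q * (\<epsilon> - g q))) \<le> norm (B * (?I q * (\<epsilon> + \<bar>g q\<bar>)))"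
      proof (rule AE_I2)
        fix q
        show "norm (?I q * (\<phi> q * (\<epsilon> - g q))) \<le> norm (B * (?I q * (\<epsilon> + \<bar>g q\<bar>)))"
        proof (cases "q \<in> S \<times> {s<..t}")
          case True
          have "norm (?I q * (\<phi> q * (\<epsilon> - g q))) = \<bar>\<phi> q\<bar> * \<bar>\<epsilon> - g q\<bar>"
            using True by (simp add: abs_mult)
          also have "\<dots> \<le> B * (\<epsilon> + \<bar>g q\<bar>)"
            using B[OF in_Q[OF True]] eps by (intro mult_mono) auto
          also have "\<dots> = B * (?I q * (\<epsilon> + \<bar>g q\<bar>))" using True by simp
          finally show ?thesis unfolding real_norm_def by (rule order_trans[OF _ abs_ge_self])
        qed simp
      qed
    qed
  qed
  have iQ: "integrable lborel ?Q"
    by (intro int continuous_intros continuous_on_compose2[OF continuous_on_gap[OF T(2)]]) auto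
  have iQ': "integrable lborel ?Q'"
    by (intro int continuous_on_ramp continuous_on_gap_joint)
  note P = lborel_prod[where 'a = 'a and 'b = real, symmetric]
  have c1: "continuous_on UNIV ramp_int" "continuous_on UNIV ramp"
    by (intro continuous_on_ramp_int continuous_on_ramp continuous_on_id)+
  have "nrg t - nrg s = (LINT x|lborel. indicator S x * ramp_int (gap t x) - indicator S x * ramp_int (gap s x))"
    unfolding nrg_def by (intro Bochner_Integration.integral_diff[symmetric] integrable_gap c1 T)
  also have "\<dots> \<le> (LINT x|lborel. LINT r|lborel. ?Q (x, r))"
  proof (rule integral_mono_AE)
    show "integrable lborel (\<lambda>x. LINT r|lborel. ?Q (x, r))"
      using iQ unfolding P by (rule lborel_pair.integrable_fst')
    show "integrable lborel (\<lambda>x. indicator S x * ramp_int (gap t x) - indicator S x * ramp_int (gap s x))"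
      by (intro Bochner_Integration.integrable_diff integrable_gap c1 T)
    have "AE x in lborel. integrable lborel (\<lambda>r. g (x, r))"
      using g unfolding P by (rule lborel_pair.AE_integrable_fst')
    then show "AE x in lborel. indicator S x * ramp_int (gap t x) - indicator S x * ramp_int (gap s x) \<le> (LINT r|lborel. ?Q (x, r))"
      using diff[OF less_le_trans[OF t0 st(1)] st(2,3)]
    proof eventually_elim
      case (elim x)
      show ?case
      proof (cases "x \<in> S")
        case True
        have ig: "integrable lborel (\<lambda>r. indicator {s<..t} r * g (x, r))"
          using integrable_mult_indicator[OF _ elim(1), of "{s<..t}"] by simp
        have ie: "integrable lborel (\<lambda>r. indicator {s<..t} r * \<epsilon>)"
          using st(2) by (intro integrable_mult_left integrable_real_indicator) auto
        have "ramp_int (gap t x) - ramp_int (gap s x) \<le> ramp (gap t x) * (gap t x - gap s x)"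
          by (rule ramp_int_diff_le)
        \<comment> \<open>The level drops by at most \<open>\<epsilon> * (t - s)\<close>, and
          \<open>p\<close> cancels from the difference of the gaps.\<close>
        also have "\<dots> \<le> ramp (gap t x) * (\<epsilon> * (t - s) - (z t x - z s x))"
          using level_diff[OF st(2)] by (intro mult_left_mono ramp_nonneg) (auto simp: gap_def)
        also have "\<epsilon> * (t - s) - (z t x - z s x) = (LINT r|lborel. indicator {s<..t} r * \<epsilon> - indicator {s<..t} r * g (x, r))"
          using elim(2) True st ig ie by (simp add: mult.commute)
        also have "ramp (gap t x) * \<dots> = (LINT r|lborel. ?Q (x, r))"
          unfolding integral_mult_right_zero[symmetric]
          using True by (intro Bochner_Integration.integral_cong) (auto simp: indicator_def)
        finally show ?thesis using True by simp
      qed simp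
    qed
  qed
  also have "\<dots> = (LINT q|lborel. ?Q q)"
    using lborel_pair.integral_fst'[of ?Q] iQ unfolding P by simp
  also have "\<dots> \<le> (LINT q|lborel. ?Q' q + \<eta> * (?I q * (\<epsilon> + \<bar>g q\<bar>)))"
  proof (rule integral_mono[OF iQ])
    show "integrable lborel (\<lambda>q. ?Q' q + \<eta> * (?I q * (\<epsilon> + \<bar>g q\<bar>)))"
      by (intro Bochner_Integration.integrable_add iQ' integrable_mult_right integrable_slab)
    fix q
    show "?Q q \<le> ?Q' q + \<eta> * (?I q * (\<epsilon> + \<bar>g q\<bar>))"
    proof (cases "q \<in> S \<times> {s<..t}")
      case True
      have "\<bar>ramp (gap t (fst q)) - ramp (gap (snd q) (fst q))\<bar> \<le> \<eta>"
        using ramp_lipschitz[of "gap t (fst q)" "gap (snd q) (fst q)"] \<eta>[of "fst q" "snd q"] True by auto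
      then have "\<bar>ramp (gap t (fst q)) - ramp (gap (snd q) (fst q))\<bar> * \<bar>\<epsilon> - g q\<bar> \<le> \<eta> * (\<epsilon> + \<bar>g q\<bar>)"
        using eps by (intro mult_mono) auto
      then have "(ramp (gap t (fst q)) - ramp (gap (snd q) (fst q))) * (\<epsilon> - g q) \<le> \<eta> * (\<epsilon> + \<bar>g q\<bar>)"
        unfolding abs_mult[symmetric] by (rule order_trans[OF abs_ge_self])
      then show ?thesis using True by (simp add: left_diff_distrib)
    qed simp
  qed
  also have "\<dots> = (LINT q|lborel. ?Q' q) + \<eta> * (mass t - mass s)"
    using mass_diff[of s t] st t0 iQ' integrable_slab[of s t] by simp
  \<comment> \<open>Now space is integrated first, and \<open>VI\<close> is used at almost every
    time \<open>r\<close> with \<open>m = level r\<close>.\<close>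
  also have "(LINT q|lborel. ?Q' q) \<le> 0"
  proof -
    have e: "case_prod (\<lambda>x r. ?Q' (x, r)) = ?Q'" by (auto simp: fun_eq_iff)
    have "integrable (lborel \<Otimes>\<^sub>M lborel) (case_prod (\<lambda>x r. ?Q' (x, r)))"
      unfolding e using iQ' unfolding P .
    from lborel_pair.integral_snd[OF this]
    have "(LINT q|lborel. ?Q' q) = (LINT r|lborel. LINT x|lborel. ?Q' (x, r))"
      by (simp only: e lborel_prod)
    also have "\<dots> \<le> 0"
    proof -
      have "AE r in lborel. integrable lborel (\<lambda>x. g (x, r))"
        using g lborel_pair.AE_integrable_snd[of "\<lambda>x r. g (x, r)"] unfolding P by (simp add: case_prod_beta)
      then have "AE r in lborel. 0 \<le> - (LINT x|lborel. ?Q' (x, r))"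
        using VI
      proof eventually_elim
        case (elim r)
        show ?case
        proof (cases "r \<in> {s<..t}")
          case True
          then have r: "r \<in> {t0<..<T}" "r \<in> {0..T}" using st t0 by auto
          have iR: "integrable lborel (\<lambda>x. indicator S x * ramp (gap r x))"
            by (intro integrable_gap c1 r)
          have "bounded ((\<lambda>x. ramp (gap r x)) ` closure S)"
            using bd by (intro compact_imp_bounded compact_continuous_image continuous_on_ramp continuous_on_gap r) (auto simp: compact_closure)
          then obtain B where B: "\<And>x. x \<in> closure S \<Longrightarrow> \<bar>ramp (gap r x)\<bar> \<le> B" by (auto simp: bounded_iff)
          have iG: "integrable lborel (\<lambda>x. indicator S x * (g (x, r) * ramp (gap r x)))"
          proof (rule Bochner_Integration.integrable_bound)
            show "integrable lborel (\<lambda>x. B * g (x, r))" using elim(1) by simp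
            have "(\<lambda>x. (indicator S x * ramp (gap r x)) * g (x, r)) \<in> borel_measurable lborel"
              by (intro borel_measurable_times borel_measurable_integrable[OF iR] borel_measurable_integrable[OF elim(1)])
            then show "(\<lambda>x. indicator S x * (g (x, r) * ramp (gap r x))) \<in> borel_measurable lborel"
              by (simp add: mult_ac)
            show "AE x in lborel. norm (indicator S x * (g (x, r) * ramp (gap r x))) \<le> norm (B * g (x, r))"
            proof (rule AE_I2)
              fix x
              show "norm (indicator S x * (g (x, r) * ramp (gap r x))) \<le> norm (B * g (x, r))"
                using B[of x] closure_subset[of S]
                by (cases "x \<in> S") (auto simp: abs_mult mult.commute[of "\<bar>B\<bar>"] intro!: mult_left_mono)
            qed
          qed
          have "(LINT x|lborel. ?Q' (x, r)) = (LINT x|lborel. \<epsilon> * (indicator S x * ramp (gap r x)) - indicator S x * (g (x, r) * ramp (gap r x)))"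
            using True by (intro Bochner_Integration.integral_cong) (auto simp: indicator_def algebra_simps)
          also have "\<dots> = \<epsilon> * (LINT x|lborel. indicator S x * ramp (gap r x)) - (LINT x|lborel. indicator S x * (g (x, r) * ramp (gap r x)))"
            using iR iG by simp
          also have "\<dots> \<le> 0"
            using elim(2)[rule_format, OF r(1), of "level r"] by (simp add: gap_def level_def)
          finally show ?thesis by simp
        qed simp
      qed
      then have "0 \<le> (LINT r|lborel. - (LINT x|lborel. ?Q' (x, r)))" by (rule integral_nonneg_AE)
      then show ?thesis by simp
    qed
    finally show ?thesis .
  qed
  finally show ?thesis by simp
qed

lemma p_le_z:
  assumes t: "t0 + M / \<epsilon> \<le> t" "t < T" and x: "x \<in> S"
  shows "p x \<le> z t x"
proof -
  have "M / \<epsilon> \<ge> 0" using M eps by simp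
  then have tT: "t0 \<le> t" "t \<in> {0..T}" "t0 \<in> {0..T}" using t t0 by auto
  have "nrg t \<le> nrg t0"
  proof (rule nonincreasing_if_locally_almost_nonincreasing[OF _ tT(1) t(2)])
    fix \<eta> :: real assume "\<eta> > 0"
    from gap_uniformly_continuous[OF this] obtain \<delta> where \<delta>: "\<delta> > 0"
      "\<And>x s t. x \<in> S \<Longrightarrow> s \<in> {0..T} \<Longrightarrow> t \<in> {0..T} \<Longrightarrow> \<bar>t - s\<bar> \<le> \<delta> \<Longrightarrow> \<bar>gap t x - gap s x\<bar> \<le> \<eta>" by blast
    show "\<exists>\<delta>>0. \<forall>s t. t0 \<le> s \<and> s \<le> t \<and> t < T \<and> t - s \<le> \<delta> \<longrightarrow> nrg t - nrg s \<le> \<eta> * (mass t - mass s)"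
      using \<delta> t0 by (intro exI[of _ \<delta>] conjI allI impI nrg_diff_le) auto
  qed
  \<comment> \<open>Here \<open>level t0 = M\<close> bounds the initial difference, so the gap is
    nonpositive and \<open>ramp_int\<close> vanishes.\<close>
  also have "nrg t0 = 0"
  proof -
    have "indicator S x * ramp_int (gap t0 x) = 0" for x
      using init[of x] M by (auto simp: indicator_def gap_def level_def intro!: ramp_int_nonpos_arg)
    then show ?thesis by (simp only: nrg_def Bochner_Integration.integral_zero)
  qed
  finally have "nrg t \<le> 0" .
  moreover have nn: "0 \<le> indicator S x * ramp_int (gap t x)" for x by (simp add: ramp_int_nonneg)
  ultimately have "nrg t = 0" unfolding nrg_def
    by (intro antisym integral_nonneg) auto
  moreover have "integrable lborel (\<lambda>x. indicator S x * ramp_int (gap t x))"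
    by (intro integrable_gap tT continuous_on_ramp_int continuous_on_id)
  ultimately have "AE x in lborel. indicator S x * ramp_int (gap t x) = 0"
    unfolding nrg_def using nn by (subst (asm) integral_nonneg_eq_0_iff_AE) auto
  then have "AE x in lborel. x \<in> S \<longrightarrow> gap t x \<le> 0"
    by eventually_elim (auto dest: ramp_int_eq_0D)
  then have ae: "AE x in lebesgue. x \<in> S \<longrightarrow> gap t x \<le> 0" by (rule AE_completion)
  have "level t = 0" using t(1) eps by (simp add: level_def field_simps)
  have "continuous_on S (gap t)"
    using continuous_on_gap[OF tT(2)] closure_subset by (rule continuous_on_subset)
  then have "gap t x \<le> 0" using ae x by (rule nonpos_if_AE_nonpos[OF op])
  then show ?thesis using \<open>level t = 0\<close> by (simp add: gap_def)
qed

end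

section \<open>Lipschitz bounds from weak gradients\<close>

text \<open>An unnormalized mollifier on the ball of radius \<open>\<delta>\<close> around
  \<open>w\<close>. Squares keep it smooth at the centre.\<close>

definition ball_bump :: "real \<Rightarrow> 'a::euclidean_space \<Rightarrow> 'a \<Rightarrow> real" where
  "ball_bump \<delta> w v = eta 0 (\<delta>\<^sup>2 - (norm (v - w))\<^sup>2)"

lemma ball_bump_nonneg: "ball_bump \<delta> w v \<ge> 0"
  by (simp add: ball_bump_def eta_nonneg)

lemma ball_bump_translate: "ball_bump \<delta> w v = ball_bump \<delta> 0 (v - w)"
  by (simp add: ball_bump_def)

lemma ball_bump_eq_0: "\<delta> > 0 \<Longrightarrow> v \<notin> cball w \<delta> \<Longrightarrow> ball_bump \<delta> w v = 0"
  by (auto simp: ball_bump_def dist_norm norm_minus_commute intro!: eta_nonpos_arg power_mono)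

lemma C_k_ball_bump: "C_k k (ball_bump \<delta> w)"
  unfolding ball_bump_def[abs_def] by (intro C_k_eta C_k_diff C_k_const C_k_norm_square)

lemma ball_bump_in_test_functions:
  "\<delta> > 0 \<Longrightarrow> cball w \<delta> \<subseteq> S \<Longrightarrow> ball_bump \<delta> w \<in> test_functions S"
  by (rule test_functionsI[OF C_k_ball_bump compact_cball _ ball_bump_eq_0])

lemma continuous_on_ball_bump: "continuous_on A (ball_bump \<delta> w)"
  by (rule C_k_imp_continuous_on[OF C_k_ball_bump[of 0]])

lemma integrable_ball_bump: "\<delta> > 0 \<Longrightarrow> integrable lborel (ball_bump \<delta> w)"
  by (rule integrable_compact_support[OF continuous_on_ball_bump compact_cball ball_bump_eq_0])

lemma LINT_ball_bump:
  fixes w :: "'a::euclidean_space"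
  shows "(LINT v|lborel. ball_bump \<delta> w v) = (LINT v|lborel. ball_bump \<delta> (0::'a) v)"
proof -
  have "(LINT v|lborel. ball_bump \<delta> w v) = (LINT v|lborel. ball_bump \<delta> (0::'a) (v + (- w)))"
    by (simp add: ball_bump_def)
  also have "\<dots> = (LINT v|lborel. ball_bump \<delta> (0::'a) v)"
    by (rule LINT_lborel_translation) (intro borel_measurable_continuous_onI continuous_on_ball_bump)
  finally show ?thesis .
qed

text \<open>A zero integral would make the bump vanish almost everywhere, hence by continuity also
  at its centre. Positivity allows the common factor to be cancelled without normalizing the
  mollifier.\<close>

lemma LINT_ball_bump_pos:
  assumes "\<delta> > 0" shows "(LINT v|lborel. ball_bump \<delta> (0::'a::euclidean_space) v) > 0"
proof (rule ccontr)
  let ?I = "LINT v|lborel. ball_bump \<delta> (0::'a) v"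
  assume "\<not> ?I > 0"
  moreover have "?I \<ge> 0" by (rule integral_nonneg_AE) (simp add: ball_bump_nonneg)
  ultimately have "?I = 0" by simp
  then have "AE v in lborel. ball_bump \<delta> (0::'a) v = 0"
    using integrable_ball_bump[OF assms, of "0::'a"] ball_bump_nonneg
    by (subst (asm) integral_nonneg_eq_0_iff_AE) auto
  then have "AE v in lborel. v \<in> UNIV \<longrightarrow> ball_bump \<delta> (0::'a) v \<le> 0" by eventually_elim simp
  then have "ball_bump \<delta> (0::'a) 0 \<le> 0"
    by (intro nonpos_if_AE_nonpos[OF open_UNIV continuous_on_ball_bump] AE_completion) auto
  then show False using eta_pos[of "\<delta>\<^sup>2" 0] assms by (simp add: ball_bump_def)
qed

text \<open>Passage to the gauge integral over a fixed box, for which the Leibniz rule is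
  available.\<close>

lemma LINT_lborel_eq_integral_cbox:
  fixes f :: "'a::euclidean_space \<Rightarrow> real"
  assumes "continuous_on UNIV f" "\<And>x. x \<notin> cbox a b \<Longrightarrow> f x = 0"
  shows "(LINT x|lborel. f x) = integral (cbox a b) f"
proof -
  have "set_integrable lborel (cbox a b) f"
    unfolding set_integrable_def using assms(1) by (intro borel_integrable_compact) (auto intro: continuous_on_subset)
  then have "(LINT x:cbox a b|lborel. f x) = integral (cbox a b) f" by (rule set_borel_integral_eq_integral)
  moreover have "(LINT x:cbox a b|lborel. f x) = (LINT x|lborel. f x)"
    unfolding set_lebesgue_integral_def using assms(2)
    by (intro Bochner_Integration.integral_cong) (auto simp: indicator_def)
  ultimately show ?thesis by simp
qed

text \<open>The defining identity is tested along basis vectors; expanding \<open>h\<close> in the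
  basis extends it by linearity.\<close>

lemma weak_gradient_direction:
  assumes op: "open S" and bd: "bounded S" and u: "u \<in> L2 S" and G: "G \<in> L2 S"
    and weak: "has_weak_gradient S u G" and \<phi>: "\<phi> \<in> test_functions S"
  shows "(LINT x|lebesgue_on S. u x * (grad \<phi> x \<bullet> h)) = - (LINT x|lebesgue_on S. (G x \<bullet> h) * \<phi> x)"
proof -
  have e: "v \<bullet> h = (\<Sum>i\<in>Basis. (h \<bullet> i) * (v \<bullet> i))" for v
    by (subst euclidean_inner) (simp add: mult.commute)
  have "(LINT x|lebesgue_on S. u x * (grad \<phi> x \<bullet> h)) = (LINT x|lebesgue_on S. (\<Sum>i\<in>Basis. (h \<bullet> i) * (u x * (grad \<phi> x \<bullet> i))))"
    by (simp only: e[of "grad \<phi> _"] sum_distrib_left mult.left_commute)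
  also have "\<dots> = (\<Sum>i\<in>Basis. (h \<bullet> i) * (LINT x|lebesgue_on S. u x * (grad \<phi> x \<bullet> i)))"
    by (subst Bochner_Integration.integral_sum)
      (auto intro!: integrable_mult_right L2_mult_integrable u L2_component test_functions_grad_L2[OF op bd \<phi>])
  also have "\<dots> = (\<Sum>i\<in>Basis. (h \<bullet> i) * - (LINT x|lebesgue_on S. (G x \<bullet> i) * \<phi> x))"
    using weak \<phi> by (intro sum.cong) (auto simp: has_weak_gradient_iff)
  also have "\<dots> = - (LINT x|lebesgue_on S. (\<Sum>i\<in>Basis. (h \<bullet> i) * ((G x \<bullet> i) * \<phi> x)))"
    by (subst Bochner_Integration.integral_sum)
      (auto intro!: integrable_mult_right L2_mult_integrable L2_component G test_functions_L2[OF op bd \<phi>] simp: sum_negf)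
  also have "(\<lambda>x. \<Sum>i\<in>Basis. (h \<bullet> i) * ((G x \<bullet> i) * \<phi> x)) = (\<lambda>x. (G x \<bullet> h) * \<phi> x)"
    by (simp only: e[of "G _"] sum_distrib_right mult.assoc)
  finally show ?thesis .
qed

text \<open>Average \<open>u\<close> against a bump that travels from \<open>x\<close> to
  \<open>y\<close>. Integration by parts turns the derivative of this average into an integral of
  \<open>G v \<bullet> h\<close> against the bump, at most \<open>norm h\<close> times the mass of
  the bump. The mean value theorem bounds the total change, and continuity compares both ends with
  \<open>u x\<close> and \<open>u y\<close>. A ball is convex, so the bump never leaves
  \<open>S\<close>.\<close>

lemma weak_gradient_increment_le:
  assumes op: "open S" and bd: "bounded S" and cu: "continuous_on UNIV u"
    and u: "u \<in> L2 S" and G: "G \<in> L2 S" and weak: "has_weak_gradient S u G"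
    and G1: "AE x in lebesgue_on S. norm (G x) \<le> 1"
    and ball: "ball c R \<subseteq> S" and xy: "x \<in> ball c R" "y \<in> ball c R"
  shows "u y - u x \<le> norm (y - x)"
proof (rule ccontr)
  define h where "h = y - x"
  define q where "q s = x + s *\<^sub>R h" for s :: real
  assume "\<not> u y - u x \<le> norm (y - x)"
  then have e: "u y - u x - norm h > 0" by (simp add: h_def)
  \<comment> \<open>A third of the excess: each endpoint loses one \<open>\<eta>\<close> to
    averaging, and one remains for the contradiction.\<close>
  define \<eta> where "\<eta> = (u y - u x - norm h) / 3"
  have \<eta>: "\<eta> > 0" using e by (simp add: \<eta>_def)
  have cont: "\<exists>d>0. \<forall>v. dist v w < d \<longrightarrow> \<bar>u v - u w\<bar> \<le> \<eta>" for w
    using cu \<eta> unfolding continuous_on_iff by (force simp: dist_real_def dist_commute intro: less_imp_le)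
  obtain dx where dx: "dx > 0" "\<And>v. dist v x < dx \<Longrightarrow> \<bar>u v - u x\<bar> \<le> \<eta>" using cont[of x] by blast
  obtain dy where dy: "dy > 0" "\<And>v. dist v y < dy \<Longrightarrow> \<bar>u v - u y\<bar> \<le> \<eta>" using cont[of y] by blast
  \<comment> \<open>Small enough for continuity at both ends, and for the balls of radius
    \<open>\<delta>\<close> around the segment to stay in \<open>ball c R\<close>.\<close>
  define \<delta> where "\<delta> = Min {dx, dy, R - dist c x, R - dist c y} / 2"
  have \<delta>: "\<delta> > 0" "\<delta> < dx" "\<delta> < dy" "\<delta> < R - dist c x" "\<delta> < R - dist c y"
    using dx(1) dy(1) xy by (auto simp: \<delta>_def min_def)
  have qs: "cball (q s) \<delta> \<subseteq> ball c R" if "0 \<le> s" "s \<le> 1" for s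
  proof
    fix v assume v: "v \<in> cball (q s) \<delta>"
    have "x \<in> ball c (R - \<delta>)" "y \<in> ball c (R - \<delta>)" using \<delta> by auto
    then have "(1 - s) *\<^sub>R x + s *\<^sub>R y \<in> ball c (R - \<delta>)"
      using that by (intro convexD[OF convex_ball]) auto
    moreover have "(1 - s) *\<^sub>R x + s *\<^sub>R y = q s" by (simp add: q_def h_def algebra_simps)
    ultimately have "dist c (q s) < R - \<delta>" by simp
    then show "v \<in> ball c R" using v dist_triangle[of c v "q s"] by (auto simp: dist_commute)
  qed
  have test: "ball_bump \<delta> (q s) \<in> test_functions S" if "0 \<le> s" "s \<le> 1" for s
    using qs[OF that] ball \<delta>(1) by (intro ball_bump_in_test_functions) auto
  obtain a b where ab: "S \<subseteq> cbox a b" using bounded_subset_cbox_symmetric[OF bd] by blast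
  let ?\<rho> = "ball_bump \<delta> 0"
  let ?f = "\<lambda>s v. u v * ?\<rho> (v - q s)" and ?f' = "\<lambda>s v. u v * - (grad ?\<rho> (v - q s) \<bullet> h)"
  let ?F = "\<lambda>s. integral (cbox a b) (?f s)"
  have cf: "continuous_on UNIV (?f s)" for s
    by (intro continuous_intros cu continuous_on_compose2[OF continuous_on_ball_bump[of UNIV]]) auto
  have cg: "continuous_on UNIV (grad ?\<rho>)" by (rule continuous_on_grad[OF C_k_ball_bump[of "Suc 0"]])
  have F_deriv: "(?F has_real_derivative integral (cbox a b) (?f' s)) (at s)" for s
  proof (rule leibniz_rule_field_derivative[of UNIV, simplified])
    show "((\<lambda>s. ?f s v) has_real_derivative ?f' s v) (at s)" for s v
    proof -
      have q: "((\<lambda>s. v - q s) has_derivative (\<lambda>t. - (t *\<^sub>R h))) (at s)"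
        unfolding q_def by (auto intro!: derivative_eq_intros)
      have "(?\<rho> has_derivative (\<lambda>w. grad ?\<rho> (v - q s) \<bullet> w)) (at (v - q s))"
        by (rule has_derivative_grad[OF C_k_ball_bump[of "Suc 0"]])
      from diff_chain_at[OF q this]
      have "((\<lambda>s. ?\<rho> (v - q s)) has_derivative (\<lambda>t. grad ?\<rho> (v - q s) \<bullet> - (t *\<^sub>R h))) (at s)"
        by (simp add: o_def)
      also have "(\<lambda>t. grad ?\<rho> (v - q s) \<bullet> - (t *\<^sub>R h)) = (*) (- (grad ?\<rho> (v - q s) \<bullet> h))" by (simp add: fun_eq_iff)
      finally have "((\<lambda>s. ?\<rho> (v - q s)) has_real_derivative - (grad ?\<rho> (v - q s) \<bullet> h)) (at s)"
        by (simp only: has_field_derivative_def)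
      then show ?thesis by (rule DERIV_cmult)
    qed
    show "?f s integrable_on cbox a b" for s
      using cf continuous_on_subset by (intro integrable_continuous) blast
    show "continuous_on (UNIV \<times> cbox a b) (\<lambda>(s, v). ?f' s v)"
      unfolding case_prod_beta q_def
      by (intro continuous_intros continuous_on_compose2[OF cu] continuous_on_compose2[OF cg]) auto
  qed
  have F_eq: "?F s = (LINT v|lborel. u v * ball_bump \<delta> (q s) v)" if s: "0 \<le> s" "s \<le> 1" for s
  proof -
    have "(LINT v|lborel. ?f s v) = ?F s"
    proof (rule LINT_lborel_eq_integral_cbox[OF cf])
      fix v assume "v \<notin> cbox a b"
      then have "v \<notin> cball (q s) \<delta>" using ab qs[OF s] ball by blast
      then show "?f s v = 0" using ball_bump_eq_0[OF \<delta>(1), of v "q s"] by (simp flip: ball_bump_translate)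
    qed
    then show ?thesis by (simp flip: ball_bump_translate)
  qed
  let ?I = "LINT v|lborel. ball_bump \<delta> (0::'a) v"
  have F'_le: "integral (cbox a b) (?f' s) \<le> norm h * ?I" if s: "0 \<le> s" "s \<le> 1" for s
  proof -
    let ?\<phi> = "ball_bump \<delta> (q s)"
    have g: "grad ?\<phi> v = grad ?\<rho> (v - q s)" for v
    proof (rule grad_eqI)
      have "((\<lambda>v. v - q s) has_derivative (\<lambda>w. w)) (at v)" by (auto intro!: derivative_eq_intros)
      from diff_chain_at[OF this has_derivative_grad[OF C_k_ball_bump[of "Suc 0"]]]
      show "(?\<phi> has_derivative (\<lambda>w. grad ?\<rho> (v - q s) \<bullet> w)) (at v)"
        by (simp add: o_def ball_bump_translate[of \<delta> "q s", abs_def])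
    qed
    have g0: "grad ?\<phi> v = 0" if "v \<notin> S" for v
    proof (rule grad_eq_0_outside_closed[OF C_k_ball_bump[of "Suc 0"] closed_cball ball_bump_eq_0[OF \<delta>(1)]])
      show "v \<notin> cball (q s) \<delta>" using that qs[OF s] ball by blast
    qed
    have cf': "continuous_on UNIV (?f' s)"
      by (intro continuous_intros cu continuous_on_compose2[OF cg]) auto
    have "integral (cbox a b) (?f' s) = (LINT v|lborel. ?f' s v)"
    proof (rule LINT_lborel_eq_integral_cbox[symmetric, OF cf'])
      show "?f' s v = 0" if "v \<notin> cbox a b" for v
      proof -
        have "grad ?\<phi> v = 0" using that ab by (intro g0) blast
        then show ?thesis by (simp flip: g)
      qed
    qed
    also have "\<dots> = (LINT v|lebesgue_on S. ?f' s v)"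
    proof (rule LINT_lebesgue_on_eq_lborel[symmetric, OF sets_lebesgue_domain[OF op bd] borel_measurable_continuous_onI[OF cf']])
      show "?f' s v = 0" if "v \<notin> S" for v
        using g0[OF that] by (simp flip: g)
    qed
    also have "\<dots> = - (LINT v|lebesgue_on S. u v * (grad ?\<phi> v \<bullet> h))"
      by (simp add: g)
    also have "\<dots> = (LINT v|lebesgue_on S. (G v \<bullet> h) * ?\<phi> v)"
      using weak_gradient_direction[OF op bd u G weak test[OF s]] by simp
    also have "\<dots> \<le> (LINT v|lebesgue_on S. norm h * ?\<phi> v)"
    proof (rule integral_mono_AE)
      show "integrable (lebesgue_on S) (\<lambda>v. (G v \<bullet> h) * ?\<phi> v)"
        by (intro L2_mult_integrable L2_component G test_functions_L2[OF op bd test[OF s]])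
      show "integrable (lebesgue_on S) (\<lambda>v. norm h * ?\<phi> v)"
        by (intro integrable_mult_right L2_integrable lmeasurable_domain[OF op bd] test_functions_L2[OF op bd test[OF s]])
      show "AE v in lebesgue_on S. (G v \<bullet> h) * ?\<phi> v \<le> norm h * ?\<phi> v"
        using G1
      proof eventually_elim
        case (elim v)
        have "G v \<bullet> h \<le> norm (G v) * norm h" by (rule norm_cauchy_schwarz)
        also have "\<dots> \<le> 1 * norm h" using elim by (intro mult_right_mono) auto
        finally show ?case by (intro mult_right_mono ball_bump_nonneg) simp
      qed
    qed
    also have "\<dots> = norm h * (LINT v|lebesgue_on S. ?\<phi> v)" by simp
    also have "(LINT v|lebesgue_on S. ?\<phi> v) = (LINT v|lborel. ?\<phi> v)"
    proof (rule LINT_lebesgue_on_eq_lborel[OF sets_lebesgue_domain[OF op bd]])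
      show "?\<phi> v = 0" if "v \<notin> S" for v
        using that qs[OF s] ball by (intro ball_bump_eq_0 \<delta>) blast
    qed (intro borel_measurable_continuous_onI continuous_on_ball_bump)
    finally show ?thesis by (simp only: LINT_ball_bump[of \<delta> "q s"])
  qed
  obtain s where s: "0 < s" "s < 1" "?F 1 - ?F 0 = (1 - 0) * integral (cbox a b) (?f' s)"
    using MVT2[of 0 1 ?F "\<lambda>s. integral (cbox a b) (?f' s)"] F_deriv by auto
  then have "?F 1 - ?F 0 \<le> norm h * ?I" using F'_le[of s] by simp
  moreover have "\<bar>(LINT v|lborel. u v * ball_bump \<delta> w v) - u w * ?I\<bar> \<le> \<eta> * ?I"
    if w: "\<And>v. v \<in> cball w \<delta> \<Longrightarrow> \<bar>u v - u w\<bar> \<le> \<eta>" for w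
  proof -
    note bw = integrable_ball_bump[OF \<delta>(1), of w]
    have i: "integrable lborel (\<lambda>v. u v * ball_bump \<delta> w v)"
      by (rule integrable_compact_support[OF _ compact_cball[of w \<delta>]])
        (auto intro!: continuous_intros cu continuous_on_ball_bump simp: ball_bump_eq_0[OF \<delta>(1)])
    have "(LINT v|lborel. u v * ball_bump \<delta> w v) - u w * ?I = (LINT v|lborel. (u v - u w) * ball_bump \<delta> w v)"
      using i bw by (simp add: left_diff_distrib LINT_ball_bump[of \<delta> w])
    also have "\<bar>\<dots>\<bar> \<le> (LINT v|lborel. \<eta> * ball_bump \<delta> w v)"
    proof (rule integral_abs_bound_integral)
      show "integrable lborel (\<lambda>v. (u v - u w) * ball_bump \<delta> w v)" using i bw by (simp add: left_diff_distrib)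
      show "\<bar>(u v - u w) * ball_bump \<delta> w v\<bar> \<le> \<eta> * ball_bump \<delta> w v" for v
        using w[of v] ball_bump_eq_0[OF \<delta>(1), of v w] ball_bump_nonneg[of \<delta> w v]
        by (cases "v \<in> cball w \<delta>") (auto simp: abs_mult intro!: mult_right_mono)
    qed (use bw in simp)
    finally show ?thesis by (simp add: LINT_ball_bump[of \<delta> w])
  qed
  from this[of x] this[of y]
  have "?F 0 \<le> (u x + \<eta>) * ?I" "(u y - \<eta>) * ?I \<le> ?F 1"
    using F_eq[of 0] F_eq[of 1] dx(2) dy(2) \<delta> by (auto simp: q_def h_def dist_commute algebra_simps abs_le_iff)
  ultimately have "(u y - \<eta>) * ?I - (u x + \<eta>) * ?I \<le> norm h * ?I" by linarith
  then have "(u y - u x - 2 * \<eta> - norm h) * ?I \<le> 0" by (simp add: algebra_simps)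
  moreover have "u y - u x - 2 * \<eta> - norm h = \<eta>" by (simp add: \<eta>_def field_simps)
  ultimately show False using LINT_ball_bump_pos[OF \<delta>(1), where 'a = 'a] \<eta> by (simp add: mult_le_0_iff)
qed

text \<open>A ball is connected, so leaving \<open>S\<close> would force it to meet the frontier at
  a distance below \<open>bdist S x\<close>.\<close>

lemma ball_bdist_subset:
  fixes S :: "'a::euclidean_space set"
  assumes "x \<in> S" shows "ball x (bdist S x) \<subseteq> S"
proof (rule ccontr)
  assume "\<not> ball x (bdist S x) \<subseteq> S"
  then obtain w where w: "w \<in> ball x (bdist S x)" "w \<notin> S" by blast
  then have "x \<in> ball x (bdist S x)" by (auto intro: le_less_trans[OF zero_le_dist])
  then have "ball x (bdist S x) \<inter> frontier S \<noteq> {}"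
    using w assms by (intro connected_Int_frontier connected_ball) blast+
  then obtain v where v: "v \<in> frontier S" "dist x v < bdist S x" by auto
  then have "bdist S x \<le> dist x v" unfolding bdist_def by (intro infdist_le)
  then show False using v by simp
qed

lemma le_bdist_if_wgrad_le_1:
  fixes S :: "'a::euclidean_space set"
  assumes op: "open S" and bd: "bounded S" and uK: "u \<in> K_grad S"
    and cont: "continuous_on (closure S) u" and 0: "\<And>x. x \<in> frontier S \<Longrightarrow> u x = 0" and x: "x \<in> S"
  shows "u x \<le> bdist S x"
proof -
  \<comment> \<open>Extension by zero is continuous because \<open>u\<close> vanishes on the
    frontier; the mollification argument needs continuity on the whole space.\<close>
  define U where "U = (\<lambda>x. if x \<in> closure S then u x else 0)"
  have cU: "continuous_on UNIV U"
  proof -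
    have fr: "frontier S = closure S - S" using op by (simp add: frontier_def interior_open)
    have "continuous_on (closure S \<union> (- S)) U"
      unfolding U_def
    proof (rule continuous_on_cases[OF closed_closure _ cont continuous_on_const])
      show "closed (- S)" using op by (simp add: closed_Compl)
      show "\<forall>x. x \<in> closure S \<and> x \<notin> closure S \<or> x \<in> - S \<and> x \<in> closure S \<longrightarrow> u x = 0"
        using 0 fr by auto
    qed
    moreover have "closure S \<union> (- S) = UNIV" using closure_subset[of S] by auto
    ultimately show ?thesis by simp
  qed
  have "u \<in> H10 S" and G1: "AE x in lebesgue_on S. norm (wgrad S u x) \<le> 1" using uK by (auto simp: K_grad_def)
  then have u: "u \<in> L2 S" "wgrad S u \<in> L2 S" "has_weak_gradient S u (wgrad S u)"
    using H10E[OF op bd \<open>u \<in> H10 S\<close>] by blast+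
  have Uu: "U x = u x" if "x \<in> S" for x using that closure_subset[of S] by (auto simp: U_def)
  have U2: "U \<in> L2 S"
  proof (rule L2_bound[OF u(1), where c = 1])
    show "U \<in> borel_measurable (lebesgue_on S)"
      using cU sets_lebesgue_domain[OF op bd] by (intro continuous_imp_measurable_on_sets_lebesgue) (auto intro: continuous_on_subset)
    show "AE x in lebesgue_on S. norm (U x) \<le> 1 * norm (u x)"
      by (rule AE_I2) (simp add: space_restrict_space Uu)
  qed
  have UG: "has_weak_gradient S U (wgrad S u)"
    unfolding has_weak_gradient_iff
  proof (intro conjI ballI L2_locally_integrable[OF op bd] U2 u(2))
    fix \<phi> i assume "\<phi> \<in> test_functions S" "i \<in> (Basis :: 'a set)"
    moreover have "(LINT x|lebesgue_on S. U x * (grad \<phi> x \<bullet> i)) = (LINT x|lebesgue_on S. u x * (grad \<phi> x \<bullet> i))"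
      by (intro Bochner_Integration.integral_cong) (auto simp: space_restrict_space Uu)
    ultimately show "(LINT x|lebesgue_on S. U x * (grad \<phi> x \<bullet> i)) = - (LINT x|lebesgue_on S. (wgrad S u x \<bullet> i) * \<phi> x)"
      using u(3) by (auto simp: has_weak_gradient_iff)
  qed
  have fr: "frontier S \<noteq> {}"
    using bd x by (intro frontier_not_empty) auto
  obtain q where q: "q \<in> frontier S" "bdist S x = dist x q"
    using infdist_attains_inf[OF frontier_closed fr, of x] unfolding bdist_def by metis
  have "q \<notin> S" using q(1) op by (simp add: frontier_def interior_open)
  then have R: "dist x q > 0" using x by auto
  \<comment> \<open>The nearest frontier point \<open>q\<close> lies on the sphere, outside the open
    ball where increments are controlled, so it is approached along the segment from
    \<open>x\<close>.\<close>
  let ?y = "\<lambda>n::nat. q + inverse (real (Suc n)) *\<^sub>R (x - q)"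
  have step: "U x - U (?y n) \<le> dist x q" for n
  proof -
    let ?c = "inverse (real (Suc n))"
    have c: "0 < ?c" "?c \<le> 1" by (simp_all add: field_simps)
    have xy: "x - ?y n = (1 - ?c) *\<^sub>R (x - q)" by (simp add: algebra_simps)
    have d: "norm (x - ?y n) = (1 - ?c) * dist x q" unfolding xy using c by (simp add: dist_norm)
    have lt: "(1 - ?c) * dist x q < 1 * dist x q" using c R by (intro mult_strict_right_mono) auto
    have "U x - U (?y n) \<le> norm (x - ?y n)"
    proof (rule weak_gradient_increment_le[OF op bd cU U2 u(2) UG G1 ball_bdist_subset[OF x]])
      show "?y n \<in> ball x (bdist S x)" using d lt q(2) by (simp add: dist_norm)
      show "x \<in> ball x (bdist S x)" using R q(2) by simp
    qed
    then show ?thesis using d lt by simp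
  qed
  have "isCont U q" using cU by (simp add: continuous_on_eq_continuous_at)
  moreover have "?y \<longlonglongrightarrow> q + 0 *\<^sub>R (x - q)" by (intro tendsto_intros LIMSEQ_inverse_real_of_nat)
  then have "?y \<longlonglongrightarrow> q" by simp
  ultimately have "(\<lambda>n. U (?y n)) \<longlonglongrightarrow> U q" by (rule isCont_tendsto_compose)
  then have "(\<lambda>n. U x - U (?y n)) \<longlonglongrightarrow> U x - U q" by (intro tendsto_intros)
  then have "U x - U q \<le> dist x q" using step by (intro LIMSEQ_le_const2) auto
  moreover have "U q = 0" using 0[OF q(1)] by (simp add: U_def)
  ultimately show ?thesis using q(2) Uu[OF x] by simp
qed

section \<open>Convergence to the distance function in finite time\<close>

lemma AE_lebesgue_onD:
  "S \<in> sets lebesgue \<Longrightarrow> AE x in lebesgue_on S. P x \<Longrightarrow> AE x in lebesgue. x \<in> S \<longrightarrow> P x"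
  by (subst (asm) AE_restrict_space_iff) auto

text \<open>The zero boundary values belong to some continuous representative. Two continuous
  functions that agree almost everywhere on an open set agree on it, and then on its
  closure.\<close>

lemma W1inf0_eq_0_on_frontier:
  fixes S :: "'a::euclidean_space set"
  assumes op: "open S" and u: "u \<in> W1inf0 S" and cont: "continuous_on (closure S) u" and x: "x \<in> frontier S"
  shows "u x = 0"
proof -
  obtain u' where u': "continuous_on (closure S) u'" "AE x in lebesgue_on S. u x = u' x" "u' x = 0"
    using u x by (auto simp: W1inf0_def)
  have ae: "AE x in lebesgue. x \<in> S \<longrightarrow> u x = u' x"
    using op u'(2) by (intro AE_lebesgue_onD) auto
  have c: "continuous_on S u" "continuous_on S u'"
    using cont u'(1) closure_subset continuous_on_subset by blast+
  have "u y - u' y = 0" if y: "y \<in> S" for y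
  proof (rule antisym)
    show "u y - u' y \<le> 0"
      using ae y c by (intro nonpos_if_AE_nonpos[OF op, of "\<lambda>y. u y - u' y"] continuous_intros) (auto elim!: eventually_mono)
    have "u' y - u y \<le> 0"
      using ae y c by (intro nonpos_if_AE_nonpos[OF op, of "\<lambda>y. u' y - u y"] continuous_intros) (auto elim!: eventually_mono)
    then show "0 \<le> u y - u' y" by simp
  qed
  moreover have "continuous_on (closure S) (\<lambda>y. u y - u' y)" using cont u'(1) by (rule continuous_on_diff)
  moreover have "x \<in> closure S" using x by (simp add: frontier_def)
  ultimately have "u x - u' x = 0"
    using continuous_constant_on_closure[of S "\<lambda>y. u y - u' y" 0 x] by blast
  then show ?thesis using u'(3) by simp
qed

lemma continuous_on_bdist: "continuous_on A (bdist S)"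
  unfolding bdist_def[abs_def] by (intro continuous_intros)

lemma bdist_nonneg: "bdist S x \<ge> 0"
  by (simp add: bdist_def infdist_nonneg)

text \<open>The distance to the frontier is 1-Lipschitz and nonnegative, so it lies above the
  truncated cone of height \<open>bdist S p\<close> with apex over \<open>p\<close>.\<close>

lemma smooth_cone_le_bdist:
  fixes p :: "'a::euclidean_space"
  assumes "\<kappa> > 0" shows "smooth_cone \<kappa> p (bdist S p) x \<le> bdist S x"
proof -
  have "bdist S p \<le> bdist S x + dist p x" unfolding bdist_def by (rule infdist_triangle)
  then show ?thesis
    using smooth_cone_le[OF assms, of p "bdist S p" x] bdist_nonneg[of S x]
    by (simp add: dist_norm norm_minus_commute)
qed

context
  fixes S :: "'a::euclidean_space set" and K :: "('a \<Rightarrow> real) set" and b :: 'a and f :: "real \<Rightarrow> real"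
    and z0 :: "'a \<Rightarrow> real" and z :: "real \<Rightarrow> 'a \<Rightarrow> real"
  assumes op: "open S" and bd: "bounded S" and K: "K = K_grad S \<or> K = K_obst S"
    and sol: "VI_solution K S b f z0 z"
begin

lemma solution_continuous: "T > 0 \<Longrightarrow> continuous_on (closure S \<times> {0..T}) (\<lambda>(x, t). z t x)"
  using sol by (auto simp: VI_solution_def closure_cylinder)

lemma solution_continuous_space:
  assumes "t \<ge> 0" shows "continuous_on (closure S) (z t)"
proof -
  have "continuous_on (closure S) (\<lambda>x. (\<lambda>(x, t). z t x) (x, t))"
    by (rule continuous_on_compose2[OF solution_continuous[of "t + 1"]])
      (use assms in \<open>auto intro!: continuous_intros\<close>)
  then show ?thesis by simp
qed

lemma solution_continuous_time:
  assumes "T > 0" "x \<in> closure S" shows "continuous_on {0<..<T} (\<lambda>t. z t x)"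
proof -
  have "continuous_on {0<..<T} (\<lambda>t. (\<lambda>(x, t). z t x) (x, t))"
    by (rule continuous_on_compose2[OF solution_continuous[OF assms(1)]])
      (use assms in \<open>auto intro!: continuous_intros\<close>)
  then show ?thesis by simp
qed

lemma solution_AE:
  assumes "T > 0"
  shows "AE t in lebesgue. t \<in> {0<..<T} \<longrightarrow> z t \<in> W1inf0 S \<and> z t \<in> K"
proof -
  have "AE t in lebesgue_on {0<..<T}. z t \<in> W1inf0 S" "AE t in lebesgue_on {0<..<T}. z t \<in> K"
    using sol assms by (auto simp: VI_solution_def Linf_W1inf0_def)
  then have "AE t in lebesgue_on {0<..<T}. z t \<in> W1inf0 S \<and> z t \<in> K" by eventually_elim simp
  then show ?thesis by (intro AE_lebesgue_onD) auto
qed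

text \<open>The membership in \<open>W1inf0\<close> holds only at almost every time; continuity in
  time, at a fixed frontier point, extends the boundary values to every positive time.\<close>

lemma solution_eq_0_on_frontier:
  assumes t: "t > 0" and x: "x \<in> frontier S"
  shows "z t x = 0"
proof -
  let ?T = "t + 1"
  have T: "?T > 0" "t \<in> {0<..<?T}" using t by auto
  have xc: "x \<in> closure S" using x by (simp add: frontier_def)
  have ae: "AE t in lebesgue. t \<in> {0<..<?T} \<longrightarrow> z t x = 0"
    using solution_AE[OF T(1)]
    by eventually_elim (auto intro!: W1inf0_eq_0_on_frontier[OF op _ _ x] solution_continuous_space)
  have "z t x \<le> 0"
    using ae by (intro nonpos_if_AE_nonpos[OF _ solution_continuous_time[OF T(1) xc] _ T(2)]) (auto elim!: eventually_mono)
  moreover have "- z t x \<le> 0"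
    using ae by (intro nonpos_if_AE_nonpos[OF _ continuous_on_minus[OF solution_continuous_time[OF T(1) xc]] _ T(2)]) (auto elim!: eventually_mono)
  ultimately show ?thesis by simp
qed

lemma K_le_bdist:
  assumes t: "t > 0" and u: "z t \<in> K" and x: "x \<in> S"
  shows "z t x \<le> bdist S x"
  using K
proof
  assume "K = K_grad S"
  then show ?thesis
    using u t x solution_eq_0_on_frontier[OF t]
    by (intro le_bdist_if_wgrad_le_1[OF op bd]) (auto intro: solution_continuous_space)
next
  assume "K = K_obst S"
  then have "AE x in lebesgue_on S. z t x - bdist S x \<le> 0"
    using u by (auto simp: K_obst_def elim!: eventually_mono)
  then have "AE x in lebesgue. x \<in> S \<longrightarrow> z t x - bdist S x \<le> 0"
    using op by (intro AE_lebesgue_onD) auto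
  moreover have "continuous_on S (\<lambda>x. z t x - bdist S x)"
    using t by (intro continuous_intros continuous_on_bdist continuous_on_subset[OF solution_continuous_space closure_subset]) auto
  ultimately have "z t x - bdist S x \<le> 0" using x by (intro nonpos_if_AE_nonpos[OF op, of "\<lambda>x. z t x - bdist S x"])
  then show ?thesis by simp
qed

lemma solution_le_bdist:
  assumes t: "t > 0" and x: "x \<in> S"
  shows "z t x \<le> bdist S x"
proof -
  let ?T = "t + 1"
  have T: "?T > 0" "t \<in> {0<..<?T}" using t by auto
  have xc: "x \<in> closure S" using x closure_subset by blast
  have "AE t in lebesgue. t \<in> {0<..<?T} \<longrightarrow> z t x - bdist S x \<le> 0"
    using solution_AE[OF T(1)] by eventually_elim (auto intro!: K_le_bdist x)
  then have "z t x - bdist S x \<le> 0"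
    by (intro nonpos_if_AE_nonpos[OF open_greaterThanLessThan _ _ T(2)] continuous_intros solution_continuous_time[OF T(1) xc])
  then show ?thesis by simp
qed

text \<open>Brings the inequality into the form required by \<open>energy\<close>. Because the
  inequality holds for all competitors outside one null set of times, so does its consequence for
  all levels \<open>m\<close>. The essential bound \<open>C\<close> on the gradients is what makes
  the ramp competitor admissible in \<open>H10\<close>.\<close>

lemma variational_inequality_lborel:
  assumes T: "T > 0" and t0: "t0 > 0" and f: "\<And>t. t \<ge> t0 \<Longrightarrow> f t \<ge> norm b + \<epsilon>"
    and p: "p \<in> test_functions S" "\<And>x. norm (grad p x) \<le> 1" "\<And>x. x \<in> S \<Longrightarrow> p x \<le> bdist S x"
    and g: "integrable lborel g"
      "AE t in lborel. AE x in lborel. x \<in> S \<longrightarrow> t \<in> {0<..<T} \<longrightarrow> wdt S T z t x = g (x, t)"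
  shows "AE r in lborel. r \<in> {t0<..<T} \<longrightarrow> (\<forall>m\<ge>0.
      \<epsilon> * (LINT x|lborel. indicator S x * ramp (p x - z r x - m))
      \<le> (LINT x|lborel. indicator S x * (g (x, r) * ramp (p x - z r x - m))))"
proof -
  have sT: "{0<..<T} \<in> sets lebesgue" and sO: "S \<in> sets lebesgue" using op by auto
  obtain C where "AE t in lebesgue_on {0<..<T}. AE x in lebesgue_on S. \<bar>z t x\<bar> \<le> C \<and> norm (wgrad S (z t) x) \<le> C"
    using sol T by (auto simp: VI_solution_def Linf_W1inf0_def)
  then have 1: "AE t in lborel. t \<in> {0<..<T} \<longrightarrow> (AE x in lebesgue_on S. norm (wgrad S (z t) x) \<le> C)"
    using AE_lebesgue_onD[OF sT] by (fastforce simp: AE_completion_iff elim!: eventually_mono)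
  have "AE t in lebesgue_on {0<..<T}. \<forall>v\<in>K.
           (LINT x|lebesgue_on S. wdt S T z t x * (v x - z t x))
             + (LINT x|lebesgue_on S. (b \<bullet> wgrad S (z t) x) * (v x - z t x))
           \<ge> (LINT x|lebesgue_on S. f t * (v x - z t x))"
    using sol T unfolding VI_solution_def by blast
  from AE_lebesgue_onD[OF sT this]
  have 2: "AE t in lborel. t \<in> {0<..<T} \<longrightarrow> (\<forall>v\<in>K.
           (LINT x|lebesgue_on S. wdt S T z t x * (v x - z t x))
             + (LINT x|lebesgue_on S. (b \<bullet> wgrad S (z t) x) * (v x - z t x))
           \<ge> (LINT x|lebesgue_on S. f t * (v x - z t x)))"
    by (simp only: AE_completion_iff)
  have 3: "AE t in lborel. t \<in> {0<..<T} \<longrightarrow> z t \<in> W1inf0 S \<and> z t \<in> K"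
    using solution_AE[OF T] by (simp only: AE_completion_iff)
  have 4: "AE r in lborel. integrable lborel (\<lambda>x. g (x, r))"
    using g(1) lborel_pair.AE_integrable_snd[of "\<lambda>x r. g (x, r)"] unfolding lborel_prod by simp
  show ?thesis
    using 1 2 3 4 g(2)
  proof eventually_elim
    case (elim r)
    show ?case
    proof (intro impI allI)
      fix m :: real assume r: "r \<in> {t0<..<T}" and m: "m \<ge> 0"
      let ?R = "\<lambda>x. ramp (p x - z r x - m)"
      have rT: "r \<in> {0<..<T}" using r t0 by auto
      have u: "z r \<in> K" "z r \<in> H10 S" using elim(3) rT K by (auto simp: K_grad_def K_obst_def)
      have ineq: "\<epsilon> * (LINT x|lebesgue_on S. ?R x) \<le> (LINT x|lebesgue_on S. wdt S T z r x * ?R x)"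
        by (rule variational_inequality_ramp[where b = b and c = "f r", OF op bd u(2) _ p(1) m u(1) K p(2,3)])
          (use elim(1,2) rT r f[of r] in auto)
      have "continuous_on S ?R"
        using r t0 by (intro continuous_intros test_functions_continuous_on[OF p(1)]
          continuous_on_subset[OF solution_continuous_space closure_subset]) auto
      then have mR: "(\<lambda>x. indicator S x * ?R x) \<in> borel_measurable borel"
        using borel_measurable_continuous_on_indicator[of S ?R] op by simp
      have mg: "(\<lambda>x. g (x, r)) \<in> borel_measurable borel" using borel_measurable_integrable[OF elim(4)] by simp
      have mgR: "(\<lambda>x. indicator S x * (g (x, r) * ?R x)) \<in> borel_measurable borel"
        using borel_measurable_times[OF mg mR] by (simp add: mult_ac)
      have e1: "(LINT x|lebesgue_on S. ?R x) = (LINT x|lborel. indicator S x * ?R x)"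
      proof -
        have "(LINT x|lebesgue_on S. ?R x) = (LINT x|lebesgue_on S. indicator S x * ?R x)"
          by (intro Bochner_Integration.integral_cong) (auto simp: space_restrict_space)
        also have "\<dots> = (LINT x|lborel. indicator S x * ?R x)"
          by (intro LINT_lebesgue_on_eq_lborel sO mR) simp
        finally show ?thesis .
      qed
      have ae: "AE x in lebesgue_on S. indicator S x * (g (x, r) * ?R x) = wdt S T z r x * ?R x"
        using elim(5) rT by (intro AE_lebesgue_onI[OF sO]) (auto elim!: eventually_mono)
      have mL: "(\<lambda>x. indicator S x * (g (x, r) * ?R x)) \<in> borel_measurable (lebesgue_on S)"
        using mgR by (intro measurable_restrict_space1 measurable_completion) simp
      have "(LINT x|lebesgue_on S. wdt S T z r x * ?R x) = (LINT x|lebesgue_on S. indicator S x * (g (x, r) * ?R x))"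
        by (rule integral_cong_AE[OF mL borel_measurable_lebesgue_on_AE[OF sO mL ae] ae, symmetric])
      also have "\<dots> = (LINT x|lborel. indicator S x * (g (x, r) * ?R x))"
        by (intro LINT_lebesgue_on_eq_lborel sO mgR) simp
      finally show "\<epsilon> * (LINT x|lborel. indicator S x * ?R x) \<le> (LINT x|lborel. indicator S x * (g (x, r) * ?R x))"
        using ineq e1 by simp
    qed
  qed
qed

lemma test_function_le_solution:
  assumes t0: "t0 > 0" and eps: "\<epsilon> > 0" and f: "\<And>t. t \<ge> t0 \<Longrightarrow> f t \<ge> norm b + \<epsilon>"
    and M: "M \<ge> 0" "\<And>x. x \<in> S \<Longrightarrow> bdist S x - z t0 x \<le> M"
    and p: "p \<in> test_functions S" "\<And>x. norm (grad p x) \<le> 1" "\<And>x. x \<in> S \<Longrightarrow> p x \<le> bdist S x"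
    and t: "t0 + M / \<epsilon> \<le> t" and x: "x \<in> S"
  shows "p x \<le> z t x"
proof -
  \<comment> \<open>Solutions are described separately on each cylinder, with \<open>wdt\<close>
    chosen for each \<open>T\<close>; this choice places \<open>t\<close> strictly inside.\<close>
  define T where "T = t + 1"
  have "M / \<epsilon> \<ge> 0" using M(1) eps by simp
  then have T: "T > 0" "t < T" using t t0 by (auto simp: T_def)
  have cont: "continuous_on (closure (cylinder S T)) (\<lambda>(x, t). z t x)" and H1: "z \<in> H1_L2 S T"
    using sol T(1) by (auto simp: VI_solution_def)
  then obtain w where "has_weak_time_derivative S T z w" by (auto simp: H1_L2_def)
  then have w: "has_weak_time_derivative S T z (wdt S T z)"
    unfolding wdt_def by (rule someI[of "has_weak_time_derivative S T z"])
  then have "(\<lambda>(x, t). wdt S T z t x) \<in> L2 (cylinder S T)" by (simp add: has_weak_time_derivative_def)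
  then obtain g where g: "integrable lborel g"
    "AE x in lborel. AE t in lborel. x \<in> S \<longrightarrow> t \<in> {0<..<T} \<longrightarrow> wdt S T z t x = g (x, t)"
    "AE t in lborel. AE x in lborel. x \<in> S \<longrightarrow> t \<in> {0<..<T} \<longrightarrow> wdt S T z t x = g (x, t)"
    by (rule borel_representative_on_cylinder[OF op bd])
  interpret energy S z g p T t0 \<epsilon> M
  proof
    show "p x - z t0 x \<le> M" if "x \<in> S" for x using M(2)[OF that] p(3)[OF that] by linarith
    show "continuous_on (closure S \<times> {0..T}) (\<lambda>(x, t). z t x)" using T(1) by (rule solution_continuous)
    show "continuous_on UNIV p" using p(1) by (rule test_functions_continuous_on)
    show "AE x in lborel. x \<in> S \<longrightarrow> z t x - z s x = (LINT r|lborel. indicator {s<..t} r * g (x, r))"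
      if "0 < s" "s \<le> t" "t < T" for s t
      by (rule time_difference[OF op cont w g(1,2) that])
  qed (use op bd t0 eps M(1) g(1) variational_inequality_lborel[OF T(1) t0 f p g(1,3)] in auto)
  show ?thesis using p_le_z[OF t T(2) x] .
qed

lemma bdist_le_solution:
  assumes t0: "t0 > 0" and eps: "\<epsilon> > 0" and f: "\<And>t. t \<ge> t0 \<Longrightarrow> f t \<ge> norm b + \<epsilon>"
    and M: "M \<ge> 0" "\<And>x. x \<in> S \<Longrightarrow> bdist S x - z t0 x \<le> M"
    and t: "t0 + M / \<epsilon> \<le> t" and x: "x \<in> S"
  shows "bdist S x \<le> z t x"
proof -
  have "frontier S \<noteq> {}" using bd x by (intro frontier_not_empty) auto
  moreover have "x \<notin> frontier S" using x op by (simp add: frontier_def interior_open)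
  ultimately have "bdist S x \<noteq> 0"
    using in_closed_iff_infdist_zero[OF frontier_closed, of S x] by (simp add: bdist_def)
  then have R: "bdist S x > 0" using bdist_nonneg[of S x] by linarith
  have "smooth_cone \<kappa> x (bdist S x) x \<le> z t x" if "\<kappa> > 0" for \<kappa>
  proof (rule test_function_le_solution[where p = "smooth_cone \<kappa> x (bdist S x)", OF t0 eps f M _ _ _ t x])
    show "smooth_cone \<kappa> x (bdist S x) \<in> test_functions S"
      using ball_bdist_subset[OF x] by (intro smooth_cone_in_test_functions that) (auto simp: dist_norm norm_minus_commute)
  qed (use that norm_grad_smooth_cone_le smooth_cone_le_bdist in auto)
  \<comment> \<open>The waiting time is the same for all \<open>\<kappa>\<close>, so the apex values
    may tend to \<open>bdist S x\<close> at the fixed time \<open>t\<close>.\<close>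
  then have "\<forall>\<^sub>F \<kappa> in at_right 0. smooth_cone \<kappa> x (bdist S x) x \<le> z t x"
    by (auto simp: eventually_at_filter)
  then show ?thesis
    by (intro tendsto_upperbound[OF smooth_cone_tendsto[OF R]]) auto
qed

lemma solution_eq_bdist_eventually:
  assumes t0: "t0 > 0" and eps: "\<epsilon> > 0" and f: "\<And>t. t \<ge> t0 \<Longrightarrow> f t \<ge> norm b + \<epsilon>"
  shows "\<exists>T_star\<ge>0. \<forall>t\<ge>T_star. \<forall>x\<in>closure S. z t x = bdist S x"
proof -
  have "bounded ((\<lambda>x. bdist S x - z t0 x) ` closure S)"
    using bd t0 by (intro compact_imp_bounded compact_continuous_image continuous_intros continuous_on_bdist solution_continuous_space)
      (auto simp: compact_closure)
  then obtain B where B: "\<And>x. x \<in> closure S \<Longrightarrow> \<bar>bdist S x - z t0 x\<bar> \<le> B"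
    by (auto simp: bounded_iff)
  \<comment> \<open>The maximum with 0 provides the nonnegativity of \<open>M\<close>.\<close>
  define M where "M = max 0 B"
  have M: "M \<ge> 0" "\<And>x. x \<in> S \<Longrightarrow> bdist S x - z t0 x \<le> M"
    using B closure_subset[of S] by (fastforce simp: M_def)+
  have M': "M / \<epsilon> \<ge> 0" using M(1) eps by simp
  show ?thesis
  proof (intro exI[of _ "t0 + M / \<epsilon>"] conjI allI impI ballI)
    show "t0 + M / \<epsilon> \<ge> 0" using t0 M' by simp
    fix t x assume t: "t0 + M / \<epsilon> \<le> t" and x: "x \<in> closure S"
    have tpos: "t > 0" using t t0 M' by linarith
    show "z t x = bdist S x"
    proof (cases "x \<in> S")
      case True
      then show ?thesis
        using bdist_le_solution[OF t0 eps f M t True] solution_le_bdist[OF tpos True] by simp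
    next
      case False
      then have "x \<in> frontier S" using x op by (simp add: frontier_def interior_open)
      then show ?thesis
        using solution_eq_0_on_frontier[OF tpos] by (simp add: bdist_def)
    qed
  qed
qed

end

theorem theorem4p3:
  fixes \<Omega> :: "'a::euclidean_space set" and b :: 'a and f :: "real \<Rightarrow> real"
    and z0 :: "'a \<Rightarrow> real" and z :: "real \<Rightarrow> 'a \<Rightarrow> real" and D :: real
  assumes "open \<Omega>" and "bounded \<Omega>" and "C2_boundary \<Omega>"
    and D_def: "D = (SUP x\<in>closure \<Omega>. bdist \<Omega> x)"
    and z0: "z0 \<in> K_grad \<Omega>"
    and f_Linf: "\<forall>T>0. f \<in> Linf {0<..<T}"
    and i: "\<forall>t>0. AE x in lebesgue_on \<Omega>. - bdist \<Omega> x < z0 x \<longrightarrow> b \<bullet> wgrad \<Omega> z0 x \<le> f t"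
    and ii: "\<forall>t>0. \<forall>h>0. f t \<le> f (t + h)" "\<forall>t>0. 0 \<le> f t"
    and iii: "Liminf at_top (\<lambda>t. ereal (f t)) > ereal (norm b + 2 * D)"
    and sol: "VI_solution (K_grad \<Omega>) \<Omega> b f z0 z \<or> VI_solution (K_obst \<Omega>) \<Omega> b f z0 z"
  shows "\<exists>T_star\<ge>0. \<forall>t\<ge>T_star. \<forall>x\<in>closure \<Omega>. z t x = bdist \<Omega> x"
proof (cases "\<Omega> = {}")
  case True
  then show ?thesis by (auto intro: exI[of _ 0])
next
  case False
  \<comment> \<open>A point of the closure makes \<open>D\<close> a supremum over a nonempty set,
    whence \<open>D \<ge> 0\<close>.\<close>
  then obtain x where x: "x \<in> closure \<Omega>" using closure_subset by blast
  have "bdd_above (bdist \<Omega> ` closure \<Omega>)"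
    using \<open>bounded \<Omega>\<close> by (intro bounded_imp_bdd_above compact_imp_bounded compact_continuous_image continuous_on_bdist)
      (auto simp: compact_closure)
  then have "bdist \<Omega> x \<le> D" unfolding D_def by (rule cSUP_upper[OF x])
  then have "D \<ge> 0" using bdist_nonneg[of \<Omega> x] by linarith
  \<comment> \<open>Any real number strictly below the limes inferior is eventually a lower bound
    for \<open>f\<close>; its excess over \<open>norm b\<close> becomes
    \<open>\<epsilon>\<close>.\<close>
  obtain c where c: "ereal (norm b + 2 * D) < ereal c" "ereal c < Liminf at_top (\<lambda>t. ereal (f t))"
    using ereal_dense2[OF iii] by blast
  from c(2) have "\<forall>\<^sub>F t in at_top. ereal c < ereal (f t)" by (rule less_LiminfD)
  then obtain t1 where t1: "\<And>t. t \<ge> t1 \<Longrightarrow> c < f t" by (auto simp: eventually_at_top_linorder)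
  have eps: "c - norm b > 0" using c(1) \<open>D \<ge> 0\<close> by simp
  have f: "f t \<ge> norm b + (c - norm b)" if "t \<ge> max 1 t1" for t using t1[of t] that by simp
  obtain K where K: "K = K_grad \<Omega> \<or> K = K_obst \<Omega>" "VI_solution K \<Omega> b f z0 z"
    using sol by blast
  have "max 1 t1 > 0" by simp
  then show ?thesis
    by (rule solution_eq_bdist_eventually[OF \<open>open \<Omega>\<close> \<open>bounded \<Omega>\<close> K _ eps f])
qed

end
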